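(* Let $T>0$, $Q=(0,1)\times(0,T)$, $y_0\in L^2(0,1)$ and $y_T\in\mathcal A_T(y_0)$. Let $u^*\in L^2(Q)$ be the optimal control of the hard terminal constraint problem and, for $\alpha>0$, let $u_\alpha^*\in L^2(Q)$ be the optimal control of the penalized problem with parameter $\alpha$, with corresponding state $y_\alpha$. Then $$u_\alpha^*\to u^*\quad\text{in }L^2(Q)\quad\text{as }\alpha\to\infty,$$ and moreover $$y_\alpha(\cdot,T)\to y_T\quad\text{in }L^2(0,1)\quad\text{as }\alpha\to\infty.$$
   Context: All functions are real-valued. Fix $T>0$ and put $Q=(0,1)\times(0,T)$. For $y_0\in L^2(0,1)$ and $u\in L^2(Q)$, the controlled heat equation is $$y_t-y_{xx}=u\ \text{ in }Q,\qquad y(0,t)=y(1,t)=0\ \text{ for }t\in(0,T),\qquad y(x,0)=y_0(x)\ \text{ for }x\in(0,1).$$ It has a unique weak solution $y=y^u\in L^2(0,T;H_0^1(0,1))$ (in the standard sense, with $y_t\in L^2(0,T;H^{-1}(0,1))$, so that $y\in C([0,T];L^2(0,1))$ and $y(\cdot,T)\in L^2(0,1)$ is well defined). Let $e_n(x)=\sqrt2\sin(n\pi x)$ and $\lambda_n=(n\pi)^2$ for $n\ge1$; $\{e_n\}$ is an orthonormal basis of $L^2(0,1)$. For $y_0,y_T\in L^2(0,1)$ let $y_{0,n}=\int_0^1 y_0e_n\,dx$ and $y_{T,n}=\int_0^1 y_Te_n\,dx$. The admissible target set is $$\mathcal A_T(y_0)=\left\{y_T\in L^2(0,1):\ \sum_{n=1}^\infty\frac{2\lambda_n}{1-e^{-2\lambda_nT}}\left|y_{T,n}-e^{-\lambda_nT}y_{0,n}\right|^2<\infty\right\}.$$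 Hard terminal constraint problem: minimize $J(u)=\frac12\|u\|_{L^2(Q)}^2$ over all $u\in L^2(Q)$ with $y^u(\cdot,T)=y_T$. For $y_T\in\mathcal A_T(y_0)$ it has a unique minimizer, denoted $u^*$. Penalized problem: for $\alpha>0$, minimize $J_\alpha(u)=\frac12\|u\|_{L^2(Q)}^2+\frac{\alpha}{2}\|y^u(\cdot,T)-y_T\|_{L^2(0,1)}^2$ over all $u\in L^2(Q)$. It has a unique minimizer, denoted $u_\alpha^*$, and $y_\alpha=y^{u_\alpha^*}$ denotes the corresponding state. *)

theory Defs
  imports "HOL-Analysis.Analysis"
begin

text \<open>
  Elements of the Lebesgue, Sobolev and Bochner spaces below are represented by functions; equality
  in such a space is equality almost everywhere, and the norms are seminorms on representatives.
  All measures are (complete) Lebesgue measures, so that almost-everywhere limits of measurable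
  functions stay measurable.
\<close>

definition L2 :: "'a measure \<Rightarrow> ('a \<Rightarrow> real) set" where
  "L2 M = {f. f \<in> borel_measurable M \<and> integrable M (\<lambda>x. (f x)\<^sup>2)}"

definition L2_norm :: "'a measure \<Rightarrow> ('a \<Rightarrow> real) \<Rightarrow> real" where
  "L2_norm M f = sqrt (\<integral>x. (f x)\<^sup>2 \<partial>M)"

abbreviation \<Omega> :: "real measure" where
  "\<Omega> \<equiv> lebesgue_on {0<..<1}"

abbreviation (input) Time :: "real \<Rightarrow> real measure" where
  "Time T \<equiv> lebesgue_on {0<..<T}"

text \<open>Points of the space-time cylinder are pairs \<open>(x, t)\<close>.\<close>

abbreviation Q :: "real \<Rightarrow> (real \<times> real) measure" where
  "Q T \<equiv> lebesgue_on ({0<..<1} \<times> {0<..<T})"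


section \<open>Sobolev spaces on the unit interval\<close>

definition test_functions :: "real \<Rightarrow> real \<Rightarrow> (real \<Rightarrow> real) set" where
  "test_functions a b = {\<phi>. (\<forall>k. (deriv ^^ k) \<phi> differentiable_on UNIV) \<and>
     (\<exists>K. compact K \<and> K \<subseteq> {a<..<b} \<and> (\<forall>x. x \<notin> K \<longrightarrow> \<phi> x = 0))}"

definition is_weak_deriv :: "(real \<Rightarrow> real) \<Rightarrow> (real \<Rightarrow> real) \<Rightarrow> bool" where
  "is_weak_deriv v g \<longleftrightarrow> g \<in> L2 \<Omega> \<and>
     (\<forall>\<phi>\<in>test_functions 0 1. (\<integral>x. v x * deriv \<phi> x \<partial>\<Omega>) = - (\<integral>x. g x * \<phi> x \<partial>\<Omega>))"

definition H1 :: "(real \<Rightarrow> real) set" where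
  "H1 = {v \<in> L2 \<Omega>. \<exists>g. is_weak_deriv v g}"

text \<open>A representative of the weak derivative, which is unique up to null sets; meaningful only
  on \<^term>\<open>H1\<close>.\<close>

definition weak_deriv :: "(real \<Rightarrow> real) \<Rightarrow> real \<Rightarrow> real" where
  "weak_deriv v = (SOME g. is_weak_deriv v g)"

definition H1_norm :: "(real \<Rightarrow> real) \<Rightarrow> real" where
  "H1_norm v = sqrt ((L2_norm \<Omega> v)\<^sup>2 + (L2_norm \<Omega> (weak_deriv v))\<^sup>2)"

definition H10 :: "(real \<Rightarrow> real) set" where
  "H10 = {v \<in> H1. \<exists>\<phi>. (\<forall>n. \<phi> n \<in> test_functions 0 1) \<and>
     (\<lambda>n. H1_norm (\<phi> n - v)) \<longlonglongrightarrow> 0}"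

text \<open>The dual space of \<^term>\<open>H10\<close>. Values of a functional outside \<^term>\<open>H10\<close> are
  irrelevant. Linearity and boundedness imply that functionals respect equality almost
  everywhere.\<close>

definition Hm1 :: "((real \<Rightarrow> real) \<Rightarrow> real) set" where
  "Hm1 = {F. (\<forall>v\<in>H10. \<forall>w\<in>H10. F (\<lambda>x. v x + w x) = F v + F w) \<and>
     (\<forall>c. \<forall>v\<in>H10. F (\<lambda>x. c * v x) = c * F v) \<and>
     (\<exists>C. \<forall>v\<in>H10. \<bar>F v\<bar> \<le> C * H1_norm v)}"

definition Hm1_norm :: "((real \<Rightarrow> real) \<Rightarrow> real) \<Rightarrow> real" where
  "Hm1_norm F = Sup {\<bar>F v\<bar> | v. v \<in> H10 \<and> H1_norm v \<le> 1}"


section \<open>Weak solutions of the controlled heat equation\<close>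

text \<open>The space \<open>L\<^sup>2(0,T;X)\<close> for a space \<open>X\<close> with (semi)norm \<open>nrm\<close>: strongly measurable functions
  (almost everywhere limits of \<open>X\<close>-valued simple functions) with square integrable norm.\<close>

definition bochner_L2 :: "real \<Rightarrow> 'a::minus set \<Rightarrow> ('a \<Rightarrow> real) \<Rightarrow> (real \<Rightarrow> 'a) set" where
  "bochner_L2 T X nrm = {f. (AE t in Time T. f t \<in> X) \<and>
     (\<exists>s. (\<forall>n. simple_function (Time T) (s n) \<and> (\<forall>t\<in>{0<..<T}. s n t \<in> X)) \<and>
          (AE t in Time T. (\<lambda>n. nrm (s n t - f t)) \<longlonglongrightarrow> 0)) \<and>
     integrable (Time T) (\<lambda>t. (nrm (f t))\<^sup>2)}"

text \<open>\<open>w\<close> is the distributional time derivative of \<open>y\<close>, where \<open>L\<^sup>2(0,1)\<close> is embedded into the dual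
  of \<^term>\<open>H10\<close> as usual. The identity \<open>\<integral> \<phi>' y dt = - \<integral> \<phi> w dt\<close> between elements of the dual
  is evaluated at every \<open>v\<close>.\<close>

definition is_time_deriv ::
  "real \<Rightarrow> (real \<Rightarrow> real \<Rightarrow> real) \<Rightarrow> (real \<Rightarrow> (real \<Rightarrow> real) \<Rightarrow> real) \<Rightarrow> bool" where
  "is_time_deriv T y w \<longleftrightarrow> (\<forall>\<phi>\<in>test_functions 0 T. \<forall>v\<in>H10.
     (\<integral>t. deriv \<phi> t * (\<integral>x. y t x * v x \<partial>\<Omega>) \<partial>(Time T)) = - (\<integral>t. \<phi> t * w t v \<partial>(Time T)))"

definition continuous_into_L2 :: "real \<Rightarrow> (real \<Rightarrow> real \<Rightarrow> real) \<Rightarrow> bool" where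
  "continuous_into_L2 T y \<longleftrightarrow> (\<forall>t\<in>{0..T}. y t \<in> L2 \<Omega> \<and>
     ((\<lambda>s. L2_norm \<Omega> (\<lambda>x. y s x - y t x)) \<longlongrightarrow> 0) (at t within {0..T}))"

text \<open>A state is a map \<open>t \<mapsto> y(\<cdot>,t)\<close>, always taken as the representative that is continuous into
  \<open>L\<^sup>2(0,1)\<close>, so that \<open>y 0\<close> and \<open>y T\<close> are meaningful.\<close>

definition weak_solution ::
  "real \<Rightarrow> (real \<Rightarrow> real) \<Rightarrow> (real \<times> real \<Rightarrow> real) \<Rightarrow> (real \<Rightarrow> real \<Rightarrow> real) \<Rightarrow> bool" where
  "weak_solution T y0 u y \<longleftrightarrow>
     y \<in> bochner_L2 T H10 H1_norm \<and>
     continuous_into_L2 T y \<and>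
     (\<exists>w \<in> bochner_L2 T Hm1 Hm1_norm. is_time_deriv T y w \<and>
        (AE t in Time T. \<forall>v\<in>H10.
           w t v + (\<integral>x. weak_deriv (y t) x * weak_deriv v x \<partial>\<Omega>) = (\<integral>x. u (x, t) * v x \<partial>\<Omega>))) \<and>
     (AE x in \<Omega>. y 0 x = y0 x)"


section \<open>Admissible targets\<close>

definition eigenfunction :: "nat \<Rightarrow> real \<Rightarrow> real" where
  "eigenfunction n x = sqrt 2 * sin (n * pi * x)"

definition eigenvalue :: "nat \<Rightarrow> real" where
  "eigenvalue n = (n * pi)\<^sup>2"

definition coefficient :: "(real \<Rightarrow> real) \<Rightarrow> nat \<Rightarrow> real" where
  "coefficient f n = (\<integral>x. f x * eigenfunction n x \<partial>\<Omega>)"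

text \<open>The series runs over \<open>n \<ge> 1\<close>, hence the index \<^term>\<open>Suc n\<close>.\<close>

definition admissible_targets :: "real \<Rightarrow> (real \<Rightarrow> real) \<Rightarrow> (real \<Rightarrow> real) set" where
  "admissible_targets T y0 = {yT \<in> L2 \<Omega>. summable (\<lambda>n. let m = Suc n; l = eigenvalue m in
     2 * l / (1 - exp (- 2 * l * T)) * \<bar>coefficient yT m - exp (- l * T) * coefficient y0 m\<bar>\<^sup>2)}"


section \<open>The optimal control problems\<close>

definition hard_cost :: "real \<Rightarrow> (real \<times> real \<Rightarrow> real) \<Rightarrow> real" where
  "hard_cost T u = 1 / 2 * (L2_norm (Q T) u)\<^sup>2"

definition hard_feasible ::
  "real \<Rightarrow> (real \<Rightarrow> real) \<Rightarrow> (real \<Rightarrow> real) \<Rightarrow> (real \<times> real \<Rightarrow> real) \<Rightarrow> bool" where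
  "hard_feasible T y0 yT u \<longleftrightarrow> u \<in> L2 (Q T) \<and>
     (\<exists>y. weak_solution T y0 u y \<and> (AE x in \<Omega>. y T x = yT x))"

definition hard_optimal ::
  "real \<Rightarrow> (real \<Rightarrow> real) \<Rightarrow> (real \<Rightarrow> real) \<Rightarrow> (real \<times> real \<Rightarrow> real) \<Rightarrow> bool" where
  "hard_optimal T y0 yT u \<longleftrightarrow> hard_feasible T y0 yT u \<and>
     (\<forall>v. hard_feasible T y0 yT v \<longrightarrow> hard_cost T u \<le> hard_cost T v)"

definition penalized_cost ::
  "real \<Rightarrow> (real \<Rightarrow> real) \<Rightarrow> real \<Rightarrow> (real \<times> real \<Rightarrow> real) \<Rightarrow> (real \<Rightarrow> real \<Rightarrow> real) \<Rightarrow> real" where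
  "penalized_cost T yT \<alpha> u y =
     1 / 2 * (L2_norm (Q T) u)\<^sup>2 + \<alpha> / 2 * (L2_norm \<Omega> (\<lambda>x. y T x - yT x))\<^sup>2"

text \<open>\<open>u\<close> is an optimal control with corresponding state \<open>y\<close>. The state is determined by the control
  up to null sets, so minimizing over controls is minimizing over pairs of a control and its
  state.\<close>

definition penalized_optimal ::
  "real \<Rightarrow> (real \<Rightarrow> real) \<Rightarrow> (real \<Rightarrow> real) \<Rightarrow> real \<Rightarrow> (real \<times> real \<Rightarrow> real) \<Rightarrow>
   (real \<Rightarrow> real \<Rightarrow> real) \<Rightarrow> bool" where
  "penalized_optimal T y0 yT \<alpha> u y \<longleftrightarrow> u \<in> L2 (Q T) \<and> weak_solution T y0 u y \<and>
     (\<forall>v\<in>L2 (Q T). \<forall>z. weak_solution T y0 v z \<longrightarrow>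
        penalized_cost T yT \<alpha> u y \<le> penalized_cost T yT \<alpha> v z)"

end

theory Submission
  imports Defs
begin

text \<open>
  Write \<open>u\<^sub>\<alpha>\<close>, \<open>y\<^sub>\<alpha>\<close> for the penalized optimum and \<open>u\<^sup>*\<close>, \<open>y\<^sup>*\<close> for the hard one. The control
  \<open>u\<^sup>*\<close> competes in every penalized problem and has no terminal error there, so
  \<open>\<parallel>u\<^sub>\<alpha>\<parallel>\<^sup>2 + \<alpha> \<parallel>y\<^sub>\<alpha>(T) - y\<^sub>T\<parallel>\<^sup>2 \<le> \<parallel>u\<^sup>*\<parallel>\<^sup>2\<close>. This bounds the controls and makes the terminal error at
  most of order \<open>\<alpha>\<close> to the power \<open>-1/2\<close>, which is the second claim. For \<open>v\<^sub>\<alpha> = u\<^sup>* - u\<^sub>\<alpha>\<close> the bound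
  \<open>\<parallel>u\<^sub>\<alpha>\<parallel> \<le> \<parallel>u\<^sup>*\<parallel>\<close> gives \<open>\<parallel>v\<^sub>\<alpha>\<parallel>\<^sup>2 \<le> 2 \<langle>u\<^sup>*, v\<^sub>\<alpha>\<rangle>\<close>, so it is enough that \<open>\<langle>u\<^sup>*, v\<^sub>\<alpha>\<rangle> \<rightarrow> 0\<close>.

  The controls \<open>v\<^sub>\<alpha>\<close> are bounded, hence it suffices to prove \<open>\<langle>\<psi>, v\<^sub>\<alpha>\<rangle> \<rightarrow> 0\<close> for \<open>\<psi>\<close> in a dense set, for
  which finite sums of \<open>b(t) e\<^sub>n(x)\<close> with continuous \<open>b\<close> are chosen (\<open>sine_sums_dense\<close>). Every
  such \<open>b\<close> splits as \<open>b = c exp (\<lambda>\<^sub>n t) + (a' + \<lambda>\<^sub>n a)\<close> with \<open>a(0) = a(T) = 0\<close>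
  (\<open>exponential_decomposition\<close>).

  \<^item> The control \<open>(a' + \<lambda>\<^sub>n a)(t) e\<^sub>n(x)\<close> produces the state \<open>a(t) e\<^sub>n(x)\<close>, which starts and ends at
    zero (\<open>weak_solution_add_separated\<close>). Adding a multiple of it to an optimal control preserves
    the final state, so both \<open>u\<^sup>*\<close> and \<open>u\<^sub>\<alpha>\<close> are orthogonal to it
    (\<open>minimal_control_orthogonal\<close>).

  \<^item> Pairing a control with \<open>exp (\<lambda>\<^sub>n t) e\<^sub>n(x)\<close> reads off the \<open>n\<close>-th sine coefficient of its final
    state, up to a constant factor and the contribution of \<open>y\<^sub>0\<close> (\<open>weak_solution_coefficient\<close>).
    For the difference \<open>v\<^sub>\<alpha>\<close> the contributions of \<open>y\<^sub>0\<close> cancel and a multiple of the coefficient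
    of \<open>y\<^sub>T - y\<^sub>\<alpha>(T)\<close> remains, which tends to zero.

  The only weak solutions that have to be constructed are therefore separated ones. The calculus
  behind the two facts rests on smooth cutoffs, which show that \<open>e\<^sub>n\<close> is admissible in the weak
  formulation and carry the distributional equation in time up to \<open>0\<close> and \<open>T\<close>.
\<close>

section \<open>The seminormed space of square integrable functions\<close>

lemma L2_integrable_mult:
  assumes "f \<in> L2 M" "g \<in> L2 M"
  shows "integrable M (\<lambda>x. f x * g x)"
proof (rule Bochner_Integration.integrable_bound)
  show "integrable M (\<lambda>x. (f x)\<^sup>2 + (g x)\<^sup>2)"
    using assms by (auto simp: L2_def)
  show "(\<lambda>x. f x * g x) \<in> borel_measurable M"
    using assms by (auto simp: L2_def)
  have "\<bar>a * b\<bar> \<le> a\<^sup>2 + b\<^sup>2" for a b :: real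
  proof -
    have "2 * \<bar>a * b\<bar> \<le> a\<^sup>2 + b\<^sup>2"
      using sum_squares_bound[of "\<bar>a\<bar>" "\<bar>b\<bar>"] by (simp add: abs_mult mult.assoc)
    then show ?thesis by linarith
  qed
  then show "AE x in M. norm (f x * g x) \<le> norm ((f x)\<^sup>2 + (g x)\<^sup>2)"
    by (intro AE_I2) (simp add: order_trans)
qed

lemma L2_add: "f \<in> L2 M \<Longrightarrow> g \<in> L2 M \<Longrightarrow> (\<lambda>x. f x + g x) \<in> L2 M"
  using L2_integrable_mult[of f M g]
  by (auto simp: L2_def power2_sum mult.assoc)

lemma L2_scale: "f \<in> L2 M \<Longrightarrow> (\<lambda>x. c * f x) \<in> L2 M"
  by (auto simp: L2_def power_mult_distrib)

lemma L2_diff: "f \<in> L2 M \<Longrightarrow> g \<in> L2 M \<Longrightarrow> (\<lambda>x. f x - g x) \<in> L2 M"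
  using L2_add[of f M "\<lambda>x. (-1) * g x"] L2_scale[of g M "-1"] by simp

lemma L2_norm_nonneg [simp]: "0 \<le> L2_norm M f"
  by (simp add: L2_norm_def)

lemma L2_norm_power2: "(L2_norm M f)\<^sup>2 = (\<integral>x. (f x)\<^sup>2 \<partial>M)"
  by (simp add: L2_norm_def)

lemma L2_norm_cong_AE:
  assumes "f \<in> borel_measurable M" "g \<in> borel_measurable M" "AE x in M. f x = g x"
  shows "L2_norm M f = L2_norm M g"
  unfolding L2_norm_def
  by (rule arg_cong[where f = sqrt], rule integral_cong_AE) (use assms in auto)

lemma L2_norm_scale: "L2_norm M (\<lambda>x. c * f x) = \<bar>c\<bar> * L2_norm M f"
  by (simp add: L2_norm_def power_mult_distrib real_sqrt_mult)

lemma L2_norm_minus: "L2_norm M (\<lambda>x. f x - g x) = L2_norm M (\<lambda>x. g x - f x)"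
  by (simp add: L2_norm_def power2_commute)

lemma L2_norm_add_power2:
  assumes "f \<in> L2 M" "g \<in> L2 M"
  shows "(L2_norm M (\<lambda>x. f x + g x))\<^sup>2
       = (L2_norm M f)\<^sup>2 + 2 * (\<integral>x. f x * g x \<partial>M) + (L2_norm M g)\<^sup>2"
  using assms L2_integrable_mult[OF assms]
  by (auto simp: L2_norm_power2 L2_def power2_sum mult.assoc)

lemma L2_Cauchy_Schwarz:
  assumes "f \<in> L2 M" "g \<in> L2 M"
  shows "\<bar>\<integral>x. f x * g x \<partial>M\<bar> \<le> L2_norm M f * L2_norm M g"
proof -
  define a b c where "a = (L2_norm M f)\<^sup>2" and "b = (\<integral>x. f x * g x \<partial>M)" and "c = (L2_norm M g)\<^sup>2"
  have quad: "0 \<le> a + 2 * s * b + s\<^sup>2 * c" for s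
  proof -
    have "0 \<le> (L2_norm M (\<lambda>x. f x + s * g x))\<^sup>2" by simp
    also have "\<dots> = a + 2 * s * b + s\<^sup>2 * c"
      by (subst L2_norm_add_power2[OF assms(1) L2_scale[OF assms(2)]])
        (simp add: a_def b_def c_def L2_norm_scale power_mult_distrib mult.left_commute)
    finally show ?thesis .
  qed
  have "b\<^sup>2 \<le> a * c"
  proof (cases "c = 0")
    case True
    have "b = 0"
    proof (rule ccontr)
      assume "b \<noteq> 0"
      then have "a + 2 * (- (a + 1) / (2 * b)) * b = -1" by (simp add: field_simps)
      with quad[of "- (a + 1) / (2 * b)"] True show False by simp
    qed
    with True show ?thesis by simp
  next
    case False
    then have "0 < c" by (simp add: c_def)
    with quad[of "- b / c"] show ?thesis
      by (simp add: field_simps power2_eq_square)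
  qed
  then have "\<bar>b\<bar> \<le> sqrt (a * c)"
    by (simp add: real_le_rsqrt)
  then show ?thesis
    by (simp add: a_def b_def c_def real_sqrt_mult)
qed

lemma L2_norm_triangle:
  assumes "f \<in> L2 M" "g \<in> L2 M"
  shows "L2_norm M (\<lambda>x. f x + g x) \<le> L2_norm M f + L2_norm M g"
proof (rule power2_le_imp_le)
  show "(L2_norm M (\<lambda>x. f x + g x))\<^sup>2 \<le> (L2_norm M f + L2_norm M g)\<^sup>2"
    using L2_Cauchy_Schwarz[OF assms]
    by (simp add: L2_norm_add_power2[OF assms] power2_sum)
qed simp

lemma L2_norm_triangle_diff:
  assumes "f \<in> L2 M" "g \<in> L2 M" "h \<in> L2 M"
  shows "L2_norm M (\<lambda>x. f x - h x) \<le> L2_norm M (\<lambda>x. f x - g x) + L2_norm M (\<lambda>x. g x - h x)"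
  using L2_norm_triangle[OF L2_diff[OF assms(1,2)] L2_diff[OF assms(2,3)]] by simp

lemma L2_bounded:
  assumes "finite_measure M" "f \<in> borel_measurable M" "\<And>x. x \<in> space M \<Longrightarrow> \<bar>f x\<bar> \<le> B"
  shows "f \<in> L2 M"
proof -
  interpret finite_measure M by fact
  have "integrable M (\<lambda>x. (f x)\<^sup>2)"
  proof (rule integrable_const_bound[where B = "B\<^sup>2"])
    show "AE x in M. norm ((f x)\<^sup>2) \<le> B\<^sup>2"
      using assms(3) by (intro AE_I2) (simp add: abs_le_square_iff[symmetric] order_trans[OF _ abs_ge_self])
  qed (use assms in auto)
  with assms(2) show ?thesis by (simp add: L2_def)
qed

lemma L2_norm_dominated_convergence:
  assumes "\<And>n. f n \<in> borel_measurable M" "g \<in> L2 M"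
    and "\<And>n. AE x in M. \<bar>f n x\<bar> \<le> g x"
    and "AE x in M. (\<lambda>n. f n x) \<longlonglongrightarrow> 0"
  shows "(\<lambda>n. L2_norm M (f n)) \<longlonglongrightarrow> 0"
proof -
  have "(\<lambda>n. \<integral>x. (f n x)\<^sup>2 \<partial>M) \<longlonglongrightarrow> (\<integral>x. 0 \<partial>M)"
  proof (rule integral_dominated_convergence)
    show "integrable M (\<lambda>x. (g x)\<^sup>2)" using assms(2) by (simp add: L2_def)
    show "AE x in M. norm ((f n x)\<^sup>2) \<le> (g x)\<^sup>2" for n
      using assms(3)[of n]
      by eventually_elim (simp add: abs_le_square_iff[symmetric] order_trans[OF _ abs_ge_self])
    show "AE x in M. (\<lambda>n. (f n x)\<^sup>2) \<longlonglongrightarrow> 0"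
      using assms(4) by eventually_elim (metis tendsto_power zero_power2)
  qed (use assms in auto)
  then have "(\<lambda>n. sqrt (\<integral>x. (f n x)\<^sup>2 \<partial>M)) \<longlonglongrightarrow> sqrt (\<integral>x. 0 \<partial>M)"
    by (rule tendsto_real_sqrt)
  then show ?thesis
    by (simp add: L2_norm_def)
qed

section \<open>Smooth functions and cutoffs\<close>

text \<open>Counting derivatives by recursion on the function makes closure under products a short
  induction, which iterating \<^const>\<open>deriv\<close> does not.\<close>

fun differentiable_times :: "nat \<Rightarrow> (real \<Rightarrow> real) \<Rightarrow> bool" where
  "differentiable_times 0 f \<longleftrightarrow> True"
| "differentiable_times (Suc n) f \<longleftrightarrow>
     (\<exists>f'. (\<forall>x. (f has_real_derivative f' x) (at x)) \<and> differentiable_times n f')"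

definition smooth :: "(real \<Rightarrow> real) \<Rightarrow> bool" where
  "smooth f \<longleftrightarrow> (\<forall>n. differentiable_times n f)"

lemma differentiable_times_mono: "differentiable_times (Suc n) f \<Longrightarrow> differentiable_times n f"
  by (induction n arbitrary: f) (simp_all, blast)

lemma differentiable_times_add:
  "differentiable_times n f \<Longrightarrow> differentiable_times n g \<Longrightarrow> differentiable_times n (\<lambda>x. f x + g x)"
proof (induction n arbitrary: f g)
  case (Suc n)
  then obtain f' g' where "\<And>x. (f has_real_derivative f' x) (at x)" "differentiable_times n f'"
    "\<And>x. (g has_real_derivative g' x) (at x)" "differentiable_times n g'" by auto
  then show ?case
    using Suc.IH[of f' g'] by (auto intro!: exI[of _ "\<lambda>x. f' x + g' x"] derivative_intros)
qed simp

lemma differentiable_times_mult: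
  "differentiable_times n f \<Longrightarrow> differentiable_times n g \<Longrightarrow> differentiable_times n (\<lambda>x. f x * g x)"
proof (induction n arbitrary: f g)
  case (Suc n)
  then obtain f' g' where *: "\<And>x. (f has_real_derivative f' x) (at x)" "differentiable_times n f'"
    "\<And>x. (g has_real_derivative g' x) (at x)" "differentiable_times n g'" by auto
  have "differentiable_times n (\<lambda>x. f' x * g x + f x * g' x)"
    using Suc.prems * differentiable_times_mono
    by (intro differentiable_times_add Suc.IH) blast+
  then show ?case using *
    by (auto intro!: exI[of _ "\<lambda>x. f' x * g x + f x * g' x"] derivative_eq_intros)
qed simp

lemma differentiable_times_const: "differentiable_times n (\<lambda>x. c)"
  by (induction n arbitrary: c) (auto intro!: exI[of _ "\<lambda>x. 0"] derivative_intros)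

lemma differentiable_times_affine:
  "differentiable_times n f \<Longrightarrow> differentiable_times n (\<lambda>x. f (c * x + d))"
proof (induction n arbitrary: f)
  case (Suc n)
  then obtain f' where *: "\<And>x. (f has_real_derivative f' x) (at x)" "differentiable_times n f'"
    by auto
  have "((\<lambda>x. f (c * x + d)) has_real_derivative f' (c * x + d) * c) (at x)" for x
    by (rule DERIV_chain2[where f = f]) (auto intro!: *(1) derivative_eq_intros)
  moreover have "differentiable_times n (\<lambda>x. f' (c * x + d) * c)"
    by (intro differentiable_times_mult differentiable_times_const Suc.IH *)
  ultimately show ?case by (auto intro!: exI[of _ "\<lambda>x. f' (c * x + d) * c"])
qed simp

lemma smooth_add: "smooth f \<Longrightarrow> smooth g \<Longrightarrow> smooth (\<lambda>x. f x + g x)"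
  and smooth_mult: "smooth f \<Longrightarrow> smooth g \<Longrightarrow> smooth (\<lambda>x. f x * g x)"
  and smooth_const: "smooth (\<lambda>x. c)"
  and smooth_affine: "smooth f \<Longrightarrow> smooth (\<lambda>x. f (c * x + d))"
  by (simp_all add: smooth_def differentiable_times_add differentiable_times_mult
      differentiable_times_const differentiable_times_affine)

lemma smoothI_antiderivative:
  assumes "\<And>x. (f has_real_derivative f' x) (at x)" "smooth f'"
  shows "smooth f"
  unfolding smooth_def
proof
  fix n show "differentiable_times n f"
    using assms by (cases n) (auto simp: smooth_def)
qed

text \<open>For trigonometric, exponential and flat functions all derivatives stay in an explicit family,
  and this settles their smoothness in one step.\<close>

lemma smooth_family:
  assumes "f \<in> F" "\<And>g. g \<in> F \<Longrightarrow> \<exists>g'\<in>F. \<forall>x. (g has_real_derivative g' x) (at x)"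
  shows "smooth f"
proof -
  have "differentiable_times n g" if "g \<in> F" for n g
    using that
  proof (induction n arbitrary: g)
    case (Suc n)
    then show ?case using assms(2)[of g] by auto
  qed simp
  with assms(1) show ?thesis by (simp add: smooth_def)
qed

lemma smooth_has_deriv:
  assumes "smooth f"
  shows "(f has_real_derivative deriv f x) (at x)"
proof -
  have "differentiable_times (Suc 0) f" using assms by (simp add: smooth_def del: differentiable_times.simps)
  then show ?thesis by (metis DERIV_imp_deriv differentiable_times.simps(2))
qed

lemma smooth_deriv:
  assumes "smooth f"
  shows "smooth (deriv f)"
  unfolding smooth_def
proof
  fix n
  have "differentiable_times (Suc n) f" using assms by (simp add: smooth_def del: differentiable_times.simps)
  then obtain f' where *: "\<And>x. (f has_real_derivative f' x) (at x)" "differentiable_times n f'"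
    by auto
  then have "deriv f = f'" by (auto intro!: ext DERIV_imp_deriv)
  with * show "differentiable_times n (deriv f)" by simp
qed

lemma smooth_continuous: "smooth f \<Longrightarrow> continuous_on S f"
  by (meson DERIV_continuous continuous_at_imp_continuous_on smooth_has_deriv)

lemma smooth_iff: "smooth f \<longleftrightarrow> (\<forall>k. (deriv ^^ k) f differentiable_on UNIV)"
proof
  assume "smooth f"
  then have "smooth ((deriv ^^ k) f)" for k
    by (induction k) (auto intro: smooth_deriv)
  then have "((deriv ^^ k) f has_real_derivative deriv ((deriv ^^ k) f) x) (at x)" for k x
    by (rule smooth_has_deriv)
  then show "\<forall>k. (deriv ^^ k) f differentiable_on UNIV"
    unfolding differentiable_on_def
    by (metis real_differentiable_def)
next
  assume *: "\<forall>k. (deriv ^^ k) f differentiable_on UNIV"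
  show "smooth f"
  proof (rule smooth_family[of f "range (\<lambda>k. (deriv ^^ k) f)"])
    show "f \<in> range (\<lambda>k. (deriv ^^ k) f)"
      by (rule range_eqI[of _ _ 0]) simp
    fix g assume "g \<in> range (\<lambda>k. (deriv ^^ k) f)"
    then obtain k where g: "g = (deriv ^^ k) f" by auto
    have "(g has_real_derivative deriv g x) (at x)" for x
      using * g by (auto simp: differentiable_on_def DERIV_deriv_iff_real_differentiable)
    moreover have "deriv g \<in> range (\<lambda>k. (deriv ^^ k) f)"
      by (rule range_eqI[of _ _ "Suc k"]) (simp add: g)
    ultimately show "\<exists>g'\<in>range (\<lambda>k. (deriv ^^ k) f). \<forall>x. (g has_real_derivative g' x) (at x)"
      by blast
  qed
qed

lemma test_functions_iff:
  "\<phi> \<in> test_functions a b \<longleftrightarrow>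
     smooth \<phi> \<and> (\<exists>K. compact K \<and> K \<subseteq> {a<..<b} \<and> (\<forall>x. x \<notin> K \<longrightarrow> \<phi> x = 0))"
  by (simp add: test_functions_def smooth_iff)

lemma test_function_mult_smooth:
  "\<phi> \<in> test_functions a b \<Longrightarrow> smooth f \<Longrightarrow> (\<lambda>x. f x * \<phi> x) \<in> test_functions a b"
  by (auto simp: test_functions_iff intro: smooth_mult)

lemma smooth_sin: "smooth (\<lambda>x. sin (c * x))" and smooth_cos: "smooth (\<lambda>x. cos (c * x))"
proof -
  define F where "F = {g. \<exists>a b. g = (\<lambda>x. a * sin (c * x) + b * cos (c * x))}"
  have F: "(\<lambda>x. a * sin (c * x) + b * cos (c * x)) \<in> F" for a b
    unfolding F_def by blast
  have *: "\<exists>g'\<in>F. \<forall>x. (g has_real_derivative g' x) (at x)" if g: "g \<in> F" for g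
  proof -
    obtain a b where g: "g = (\<lambda>x. a * sin (c * x) + b * cos (c * x))"
      using g by (auto simp: F_def)
    have "(g has_real_derivative (- b * c) * sin (c * x) + (a * c) * cos (c * x)) (at x)" for x
      unfolding g by (auto intro!: derivative_eq_intros)
    with F[of "- b * c" "a * c"] show ?thesis
      by (intro bexI[of _ "\<lambda>x. (- b * c) * sin (c * x) + (a * c) * cos (c * x)"]) auto
  qed
  show "smooth (\<lambda>x. sin (c * x))" "smooth (\<lambda>x. cos (c * x))"
    using smooth_family[OF F[of 1 0] *] smooth_family[OF F[of 0 1] *] by simp_all
qed

lemma smooth_exp: "smooth (\<lambda>x. exp (c * x))"
proof -
  have "\<exists>g'\<in>range (\<lambda>a x. a * exp (c * x)). \<forall>x. (g has_real_derivative g' x) (at x)"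
    if g: "g \<in> range (\<lambda>a x. a * exp (c * x))" for g :: "real \<Rightarrow> real"
  proof -
    obtain a where g: "g = (\<lambda>x. a * exp (c * x))" using g by auto
    have "(g has_real_derivative (a * c) * exp (c * x)) (at x)" for x
      unfolding g by (auto intro!: derivative_eq_intros)
    then show ?thesis by (intro bexI[of _ "\<lambda>x. (a * c) * exp (c * x)"]) auto
  qed
  moreover have "(\<lambda>x. exp (c * x)) \<in> range (\<lambda>a x. a * exp (c * x))"
    by (rule range_eqI[of _ _ 1]) simp
  ultimately show ?thesis by (rule smooth_family[rotated])
qed

text \<open>The derivatives of the function equal to \<open>exp (-1/x)\<close> for \<open>x > 0\<close> and to \<open>0\<close> elsewhere stay
  in the family with a polynomial factor in \<open>1/x\<close>, and each of these vanishes to first order at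
  the origin because the exponential decay beats every power.\<close>

definition flat :: "real poly \<Rightarrow> real \<Rightarrow> real" where
  "flat p x = (if x > 0 then poly p (1 / x) * exp (- (1 / x)) else 0)"

lemma poly_times_exp_decay: "((\<lambda>y::real. poly p y * exp (- y)) \<longlongrightarrow> 0) at_top"
proof -
  have "((\<lambda>y::real. (\<Sum>i\<le>degree p. coeff p i * (y ^ i / exp y))) \<longlongrightarrow> (\<Sum>i\<le>degree p. coeff p i * 0)) at_top"
    by (intro tendsto_sum tendsto_mult tendsto_const tendsto_power_div_exp_0)
  moreover have "(\<lambda>y::real. (\<Sum>i\<le>degree p. coeff p i * (y ^ i / exp y))) = (\<lambda>y. poly p y * exp (- y))"
    by (auto simp: poly_altdef exp_minus sum_distrib_right divide_inverse mult.assoc)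
  ultimately show ?thesis by simp
qed

lemma flat_has_derivative:
  "(flat p has_real_derivative flat ([:0, 0, 1:] * (p - pderiv p)) x) (at x)"
proof -
  consider "x > 0" | "x < 0" | "x = 0" by linarith
  then show ?thesis
  proof cases
    case 1
    have "((\<lambda>x. poly p (1 / x) * exp (- (1 / x))) has_real_derivative
        flat ([:0, 0, 1:] * (p - pderiv p)) x) (at x)"
      using 1 by (auto intro!: derivative_eq_intros DERIV_chain2[OF poly_DERIV]
          simp: flat_def field_simps power2_eq_square)
    then show ?thesis
    proof (rule has_field_derivative_transform_within_open[where S = "{0<..}"])
    qed (use 1 in \<open>auto simp: flat_def\<close>)
  next
    case 2
    have "((\<lambda>x. 0) has_real_derivative flat ([:0, 0, 1:] * (p - pderiv p)) x) (at x)"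
      using 2 by (simp add: flat_def)
    then show ?thesis
      by (rule has_field_derivative_transform_within_open[where S = "{..<0}"])
        (use 2 in \<open>auto simp: flat_def\<close>)
  next
    case 3
    have "((\<lambda>h. flat p h / h) \<longlongrightarrow> 0) (at 0)"
      \<comment> \<open>From the right the quotient is again a polynomial in \<open>1/h\<close> times \<open>exp (-1/h)\<close>.\<close>
    proof (rule filterlim_split_at)
      have "((\<lambda>h. poly ([:0, 1:] * p) (inverse h) * exp (- inverse h)) \<longlongrightarrow> 0) (at_right 0)"
        using filterlim_compose[OF poly_times_exp_decay[of "[:0, 1:] * p"] filterlim_inverse_at_top_right] .
      then show "((\<lambda>h. flat p h / h) \<longlongrightarrow> 0) (at_right 0)"
        by (rule Lim_transform_eventually)
          (auto simp: eventually_at_right_field flat_def field_simps intro!: exI[of _ 1])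
      show "((\<lambda>h. flat p h / h) \<longlongrightarrow> 0) (at_left 0)"
        by (rule Lim_transform_eventually[OF tendsto_const])
          (auto simp: eventually_at_left_field flat_def intro!: exI[of _ "-1"])
    qed
    then show ?thesis using 3 by (simp add: DERIV_def flat_def)
  qed
qed

lemma smooth_flat: "smooth (flat p)"
  by (rule smooth_family[of _ "range flat"]) (use flat_has_derivative in blast)+

text \<open>A smooth transition from \<open>0\<close> to \<open>1\<close> is the normalized antiderivative of a bump supported
  in the unit interval.\<close>

lemma smooth_step_exists:
  "\<exists>\<theta>. smooth \<theta> \<and> (\<forall>s\<le>0. \<theta> s = 0) \<and> (\<forall>s\<ge>1. \<theta> s = 1) \<and> (\<forall>s. 0 \<le> deriv \<theta> s)"
proof -
  define b where "b s = flat 1 s * flat 1 (1 - s)" for s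
  have b: "smooth b"
    unfolding b_def using smooth_affine[OF smooth_flat[of 1], of "-1" 1]
    by (intro smooth_mult smooth_flat) (simp add: algebra_simps)
  have b0: "b s = 0" if "s \<le> 0 \<or> 1 \<le> s" for s
    using that by (auto simp: b_def flat_def)
  have b_pos: "b s \<ge> 0" for s by (simp add: b_def flat_def)
  obtain F where F: "\<And>x. (F has_real_derivative b x) (at x)"
    using einterval_antiderivative[of "-\<infinity>" "\<infinity>" b] smooth_continuous[OF b, of UNIV]
    by (auto simp: continuous_on_eq_continuous_at has_real_derivative_iff_has_vector_derivative)
  have const: "F s = F t" if "s < t" "\<And>r. s < r \<Longrightarrow> r < t \<Longrightarrow> b r = 0" for s t
    using DERIV_isconst_end[of s t F] F that
    by (metis DERIV_continuous continuous_at_imp_continuous_on)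
  have left: "F s = F 0" if "s \<le> 0" for s
    using const[of s 0] b0 that by (cases "s = 0") auto
  have right: "F s = F 1" if "s \<ge> 1" for s
    using const[of 1 s] b0 that by (cases "s = 1") auto
  have pos: "F 0 < F 1"
  proof (rule DERIV_pos_imp_increasing_open[of 0 1 F])
    show "\<exists>y. (F has_real_derivative y) (at x) \<and> 0 < y" if "0 < x" "x < 1" for x
      using F[of x] that by (auto simp: b_def flat_def)
    show "continuous_on {0..1} F"
      using F by (metis DERIV_continuous continuous_at_imp_continuous_on)
  qed simp
  define \<theta> where "\<theta> s = (F s - F 0) / (F 1 - F 0)" for s
  have \<theta>': "(\<theta> has_real_derivative inverse (F 1 - F 0) * b s) (at s)" for s
    using DERIV_cdivide[OF DERIV_diff[OF F[of s] DERIV_const[of "F 0"]], of "F 1 - F 0"]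
    by (simp add: \<theta>_def[abs_def] divide_inverse mult.commute)
  have "smooth \<theta>"
    by (rule smoothI_antiderivative[OF \<theta>']) (intro smooth_mult smooth_const b)
  moreover have "0 \<le> deriv \<theta> s" for s
    using DERIV_imp_deriv[OF \<theta>'[of s]] b_pos[of s] pos by simp
  moreover have "\<theta> s = 0" if "s \<le> 0" for s
    using left[OF that] by (simp add: \<theta>_def)
  moreover have "\<theta> s = 1" if "s \<ge> 1" for s
    using right[OF that] pos by (simp add: \<theta>_def)
  ultimately show ?thesis by blast
qed

definition smooth_step :: "real \<Rightarrow> real" where
  "smooth_step = (SOME \<theta>. smooth \<theta> \<and> (\<forall>s\<le>0. \<theta> s = 0) \<and> (\<forall>s\<ge>1. \<theta> s = 1) \<and> (\<forall>s. 0 \<le> deriv \<theta> s))"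

lemma smooth_step: "smooth smooth_step"
  and smooth_step_eq_0: "s \<le> 0 \<Longrightarrow> smooth_step s = 0"
  and smooth_step_eq_1: "s \<ge> 1 \<Longrightarrow> smooth_step s = 1"
  and deriv_smooth_step_nonneg: "0 \<le> deriv smooth_step s"
  using someI_ex[OF smooth_step_exists, folded smooth_step_def] by auto

lemma smooth_step_has_deriv: "(smooth_step has_real_derivative deriv smooth_step s) (at s)"
  by (rule smooth_has_deriv[OF smooth_step])

lemma smooth_step_bounds: "0 \<le> smooth_step s" "smooth_step s \<le> 1"
proof -
  have mono: "smooth_step s \<le> smooth_step t" if "s \<le> t" for s t
    using DERIV_nonneg_imp_nondecreasing[OF that] smooth_step_has_deriv deriv_smooth_step_nonneg
    by blast
  show "0 \<le> smooth_step s"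
    using mono[of "min s 0" s] by (simp add: smooth_step_eq_0)
  show "smooth_step s \<le> 1"
    using mono[of s "max s 1"] by (simp add: smooth_step_eq_1)
qed

lemma deriv_smooth_step_eq_0:
  assumes "s \<notin> {0<..<1}"
  shows "deriv smooth_step s = 0"
proof -
  \<comment> \<open>Every point outside the open interval is a minimum or a maximum of the step.\<close>
  have "(\<forall>t. \<bar>s - t\<bar> < 1 \<longrightarrow> smooth_step s \<le> smooth_step t) \<or>
      (\<forall>t. \<bar>s - t\<bar> < 1 \<longrightarrow> smooth_step t \<le> smooth_step s)"
    using assms smooth_step_bounds by (cases "s \<le> 0") (auto simp: smooth_step_eq_0 smooth_step_eq_1)
  then show ?thesis
    using DERIV_local_min[OF smooth_step_has_deriv[of s] zero_less_one]
      DERIV_local_max[OF smooth_step_has_deriv[of s] zero_less_one] by blast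
qed

lemma deriv_smooth_step_bounded: "\<exists>B>0. \<forall>s. deriv smooth_step s \<le> B"
proof -
  have "compact (deriv smooth_step ` {0..1})"
    by (intro compact_continuous_image smooth_continuous smooth_deriv smooth_step compact_Icc)
  then obtain B where B: "\<forall>y\<in>deriv smooth_step ` {0..1}. \<bar>y\<bar> \<le> B"
    using compact_imp_bounded bounded_real by metis
  have "deriv smooth_step s \<le> \<bar>B\<bar> + 1" for s
  proof (cases "s \<in> {0<..<1}")
    case True
    then have "\<bar>deriv smooth_step s\<bar> \<le> B" using B by auto
    then show ?thesis by linarith
  qed (simp add: deriv_smooth_step_eq_0)
  then show ?thesis by (intro exI[of _ "\<bar>B\<bar> + 1"]) auto
qed

text \<open>The cutoff vanishes within distance \<open>1/k\<close> of the end points and equals one beyond distance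
  \<open>2/k\<close> from both. The shift by one makes its support a compact part of the open interval.\<close>

definition cutoff :: "real \<Rightarrow> real \<Rightarrow> real \<Rightarrow> real \<Rightarrow> real" where
  "cutoff a b k x = smooth_step (k * (x - a) - 1) * smooth_step (k * (b - x) - 1)"

lemma cutoff_bounds: "0 \<le> cutoff a b k x" "cutoff a b k x \<le> 1"
  using smooth_step_bounds by (auto simp: cutoff_def intro!: mult_le_one)

lemma smooth_cutoff: "smooth (cutoff a b k)"
proof -
  have "smooth (\<lambda>x. smooth_step (k * x + (- k * a - 1)) * smooth_step ((- k) * x + (k * b - 1)))"
    by (intro smooth_mult smooth_affine smooth_step)
  moreover have "(\<lambda>x. smooth_step (k * x + (- k * a - 1)) * smooth_step ((- k) * x + (k * b - 1)))
     = cutoff a b k"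
    by (auto simp: cutoff_def algebra_simps)
  ultimately show ?thesis by simp
qed

lemma cutoff_test_function:
  assumes "k > 0"
  shows "cutoff a b k \<in> test_functions a b"
  unfolding test_functions_iff
proof (intro conjI smooth_cutoff exI[of _ "{a + 1/k..b - 1/k}"] allI impI)
  show "{a + 1 / k..b - 1 / k} \<subseteq> {a<..<b}"
    using assms by (auto simp: less_le_trans le_less_trans add_pos_pos)
      (smt (verit) divide_pos_pos)+
  fix x assume "x \<notin> {a + 1 / k..b - 1 / k}"
  then have "k * (x - a) - 1 \<le> 0 \<or> k * (b - x) - 1 \<le> 0"
    using assms by (auto simp: field_simps)
  then show "cutoff a b k x = 0"
    by (auto simp: cutoff_def smooth_step_eq_0)
qed simp

lemma cutoff_eventually_1:
  assumes "a < x" "x < b"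
  shows "\<forall>\<^sub>F k in at_top. cutoff a b k x = 1"
proof -
  have "\<forall>\<^sub>F k in at_top. max (2 / (x - a)) (2 / (b - x)) \<le> k"
    by (rule eventually_ge_at_top)
  then show ?thesis
    by eventually_elim (use assms in \<open>auto simp: cutoff_def smooth_step_eq_1 field_simps\<close>)
qed

lemma deriv_cutoff:
  "deriv (cutoff a b k) x =
     k * deriv smooth_step (k * (x - a) - 1) * smooth_step (k * (b - x) - 1)
   - smooth_step (k * (x - a) - 1) * (k * deriv smooth_step (k * (b - x) - 1))"
proof (rule DERIV_imp_deriv)
  have "((\<lambda>x. smooth_step (k * (x - a) - 1)) has_real_derivative
      deriv smooth_step (k * (x - a) - 1) * k) (at x)"
    by (rule DERIV_chain2[OF smooth_step_has_deriv]) (auto intro!: derivative_eq_intros)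
  moreover have "((\<lambda>x. smooth_step (k * (b - x) - 1)) has_real_derivative
      deriv smooth_step (k * (b - x) - 1) * (- k)) (at x)"
    by (rule DERIV_chain2[OF smooth_step_has_deriv]) (auto intro!: derivative_eq_intros)
  ultimately show "(cutoff a b k has_real_derivative
     k * deriv smooth_step (k * (x - a) - 1) * smooth_step (k * (b - x) - 1)
   - smooth_step (k * (x - a) - 1) * (k * deriv smooth_step (k * (b - x) - 1))) (at x)"
    unfolding cutoff_def by (auto intro!: derivative_eq_intros)
qed

section \<open>Integration over intervals\<close>

lemma finite_measure_lebesgue_on_interval: "finite_measure (lebesgue_on {a<..<b::real})"
  by (rule finite_measure_lebesgue_on) (simp add: bounded_set_imp_lmeasurable)

lemma continuous_bounded_measurable_interval:
  fixes f :: "real \<Rightarrow> real"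
  assumes "continuous_on {a..b} f"
  obtains B where "f \<in> borel_measurable (lebesgue_on {a<..<b})" "\<And>x. x \<in> {a<..<b} \<Longrightarrow> \<bar>f x\<bar> \<le> B"
proof -
  have "compact (f ` {a..b})" using assms by (rule compact_continuous_image) simp
  then obtain B where "\<forall>y\<in>f ` {a..b}. \<bar>y\<bar> \<le> B"
    using compact_imp_bounded bounded_real by metis
  moreover have "f \<in> borel_measurable (lebesgue_on {a<..<b})"
    by (rule continuous_imp_measurable_on_sets_lebesgue[OF continuous_on_subset[OF assms]]) auto
  ultimately show thesis using that by (metis greaterThanLessThan_iff imageI atLeastAtMost_iff less_imp_le)
qed

lemma continuous_L2:
  fixes f :: "real \<Rightarrow> real"
  assumes "continuous_on {a..b} f"
  shows "f \<in> L2 (lebesgue_on {a<..<b})"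
proof -
  obtain B where "f \<in> borel_measurable (lebesgue_on {a<..<b})" "\<And>x. x \<in> {a<..<b} \<Longrightarrow> \<bar>f x\<bar> \<le> B"
    using continuous_bounded_measurable_interval[OF assms] by blast
  then show ?thesis
    by (intro L2_bounded[OF finite_measure_lebesgue_on_interval]) auto
qed

lemma L2_integrable_interval:
  assumes "f \<in> L2 (lebesgue_on {a<..<b::real})"
  shows "integrable (lebesgue_on {a<..<b}) f"
  using L2_integrable_mult[OF assms continuous_L2[of a b "\<lambda>x. 1"]] by simp

lemma continuous_integrable:
  fixes f :: "real \<Rightarrow> real"
  assumes "continuous_on {a..b} f"
  shows "integrable (lebesgue_on {a<..<b}) f"
  by (rule L2_integrable_interval[OF continuous_L2[OF assms]])

lemma integrable_mult_continuous:
  fixes f :: "real \<Rightarrow> real"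
  assumes "integrable (lebesgue_on {a<..<b}) g" "continuous_on {a..b} f"
  shows "integrable (lebesgue_on {a<..<b}) (\<lambda>x. f x * g x)"
proof -
  obtain B where B: "f \<in> borel_measurable (lebesgue_on {a<..<b})" "\<And>x. x \<in> {a<..<b} \<Longrightarrow> \<bar>f x\<bar> \<le> B"
    using continuous_bounded_measurable_interval[OF assms(2)] by blast
  show ?thesis
  proof (rule Bochner_Integration.integrable_bound)
    show "integrable (lebesgue_on {a<..<b}) (\<lambda>x. B * g x)" using assms by simp
    show "AE x in lebesgue_on {a<..<b}. norm (f x * g x) \<le> norm (B * g x)"
      using B(2) by (intro AE_I2) (auto simp: abs_mult intro!: mult_right_mono order_trans[OF B(2)])
  qed (use assms B in measurable)
qed

lemma integral_deriv_interval:
  fixes f :: "real \<Rightarrow> real"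
  assumes "a \<le> b" "\<And>x. (f has_real_derivative f' x) (at x)" "continuous_on {a..b} f'"
  shows "(\<integral>x. f' x \<partial>(lebesgue_on {a<..<b})) = f b - f a"
proof -
  have "(f' has_integral (f b - f a)) {a..b}"
    using assms by (intro fundamental_theorem_of_calculus)
      (auto simp flip: has_real_derivative_iff_has_vector_derivative intro: has_field_derivative_at_within)
  then have "integral {a<..<b} f' = f b - f a"
    by (simp add: integral_unique flip: integral_open_interval_real)
  then show ?thesis
    by (subst lebesgue_integral_eq_integral) (use continuous_integrable assms in auto)
qed

lemma integral_by_parts_test_function:
  assumes "a < b" "\<phi> \<in> test_functions a b"
    and f: "\<And>x. (f has_real_derivative f' x) (at x)" "continuous_on UNIV f'"
  shows "(\<integral>x. f x * deriv \<phi> x \<partial>(lebesgue_on {a<..<b})) = - (\<integral>x. f' x * \<phi> x \<partial>(lebesgue_on {a<..<b}))"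
proof -
  have \<phi>: "smooth \<phi>" "\<phi> a = 0" "\<phi> b = 0"
    using assms(2) by (auto simp: test_functions_iff)
  have cf: "continuous_on S f" for S
    using f(1) by (metis DERIV_continuous continuous_at_imp_continuous_on)
  have cf': "continuous_on S f'" for S
    using f(2) continuous_on_subset by blast
  note c = cf cf' smooth_continuous[OF \<phi>(1)] smooth_continuous[OF smooth_deriv[OF \<phi>(1)]]
  have "(\<integral>x. f x * deriv \<phi> x + f' x * \<phi> x \<partial>(lebesgue_on {a<..<b})) = f b * \<phi> b - f a * \<phi> a"
    using assms(1)
    by (intro integral_deriv_interval)
      (auto intro!: derivative_eq_intros f smooth_has_deriv[OF \<phi>(1)] continuous_intros c)
  then show ?thesis
    by (subst (asm) Bochner_Integration.integral_add)
      (auto intro!: continuous_integrable continuous_intros c simp: \<phi>)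
qed

text \<open>Nonnegative kernels of mass one that concentrate at \<open>c\<close>. The point may be an end point of the
  interval, where the kernels approach from one side.\<close>

lemma approximate_identity:
  fixes A :: "nat \<Rightarrow> real \<Rightarrow> real"
  assumes A: "\<And>n. continuous_on {a..b} (A n)" "\<And>n x. 0 \<le> A n x"
    and mass: "\<forall>\<^sub>F n in sequentially. (\<integral>x. A n x \<partial>(lebesgue_on {a<..<b})) = 1"
    and supp: "\<And>n x. 2 < real n * \<bar>x - c\<bar> \<Longrightarrow> A n x = 0"
    and G: "continuous_on {a..b} G" and c: "c \<in> {a..b}"
  shows "(\<lambda>n. \<integral>x. A n x * G x \<partial>(lebesgue_on {a<..<b})) \<longlonglongrightarrow> G c"
proof (rule tendstoI)
  fix e :: real assume "e > 0"
  then obtain d where d: "d > 0" "\<And>x. x \<in> {a..b} \<Longrightarrow> dist x c < d \<Longrightarrow> dist (G x) (G c) < e / 2"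
    using G c unfolding continuous_on_iff by (metis half_gt_zero)
  have "\<forall>\<^sub>F n in sequentially. 2 / d < real n"
    by (rule eventually_compose_filterlim[OF eventually_gt_at_top filterlim_real_sequentially])
  with mass show "\<forall>\<^sub>F n in sequentially. dist (\<integral>x. A n x * G x \<partial>(lebesgue_on {a<..<b})) (G c) < e"
  proof eventually_elim
    case (elim n)
    have int: "integrable (lebesgue_on {a<..<b}) (A n)"
      "integrable (lebesgue_on {a<..<b}) (\<lambda>x. A n x * G x)"
      "integrable (lebesgue_on {a<..<b}) (\<lambda>x. A n x * (G x - G c))"
      by (intro continuous_integrable continuous_intros A G)+
    have "(\<integral>x. A n x * G x \<partial>(lebesgue_on {a<..<b})) - G c
        = (\<integral>x. A n x * G x \<partial>(lebesgue_on {a<..<b})) - (\<integral>x. A n x * G c \<partial>(lebesgue_on {a<..<b}))"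
      using elim by simp
    also have "\<dots> = (\<integral>x. A n x * (G x - G c) \<partial>(lebesgue_on {a<..<b}))"
      using int by (subst Bochner_Integration.integral_diff[symmetric]) (auto simp: right_diff_distrib)
    also have "\<bar>\<dots>\<bar> \<le> (\<integral>x. \<bar>A n x * (G x - G c)\<bar> \<partial>(lebesgue_on {a<..<b}))"
      by (rule integral_abs_bound)
    also have "\<dots> \<le> (\<integral>x. A n x * (e / 2) \<partial>(lebesgue_on {a<..<b}))"
    proof (rule integral_mono)
      fix x assume "x \<in> space (lebesgue_on {a<..<b})"
      then have x: "x \<in> {a..b}" by auto
      show "\<bar>A n x * (G x - G c)\<bar> \<le> A n x * (e / 2)"
      proof (cases "dist x c < d")
        case True
        with d(2)[OF x] show ?thesis
          using mult_left_mono[OF less_imp_le A(2)[of n x], of "\<bar>G x - G c\<bar>" "e / 2"] A(2)[of n x]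
          by (simp add: abs_mult dist_real_def)
      next
        case False
        have "2 < real n * d" using elim(2) d(1) by (simp add: field_simps)
        also have "\<dots> \<le> real n * \<bar>x - c\<bar>"
          using False by (intro mult_left_mono) (auto simp: dist_real_def)
        finally show ?thesis using supp[of n x] by simp
      qed
    qed (use int in auto)
    also have "\<dots> = e / 2" using elim by simp
    finally show ?case using \<open>e > 0\<close> by (simp add: dist_real_def)
  qed
qed

text \<open>The derivative of a cutoff concentrates with mass \<open>1\<close> at the left and with mass \<open>-1\<close> at the
  right end point.\<close>

lemma integral_deriv_cutoff_tendsto:
  assumes "a < b" "continuous_on {a..b} G"
  shows "(\<lambda>n. \<integral>x. deriv (cutoff a b (real n)) x * G x \<partial>(lebesgue_on {a<..<b})) \<longlonglongrightarrow> G a - G b"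
proof -
  define L R where "L = (\<lambda>n x. real n * deriv smooth_step (real n * (x - a) - 1))"
    and "R = (\<lambda>n x. real n * deriv smooth_step (real n * (b - x) - 1))"
  have cont: "continuous_on S (L n)" "continuous_on S (R n)" for S n
    unfolding L_def R_def
    by (intro continuous_intros continuous_on_compose2[OF smooth_continuous[OF smooth_deriv[OF smooth_step], of UNIV]]; simp)+
  have nonneg: "0 \<le> L n x" "0 \<le> R n x" for n x
    unfolding L_def R_def by (simp_all add: deriv_smooth_step_nonneg)
  have large: "\<forall>\<^sub>F n in sequentially. 4 \<le> real n * (b - a)"
  proof -
    have "\<forall>\<^sub>F n in sequentially. 4 / (b - a) < real n"
      by (rule eventually_compose_filterlim[OF eventually_gt_at_top filterlim_real_sequentially])
    then show ?thesis
      by eventually_elim (use assms(1) in \<open>auto simp: field_simps\<close>)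
  qed
  have "(\<lambda>n. \<integral>x. L n x * G x \<partial>(lebesgue_on {a<..<b})) \<longlonglongrightarrow> G a"
  proof (rule approximate_identity)
    show "\<forall>\<^sub>F n in sequentially. (\<integral>x. L n x \<partial>(lebesgue_on {a<..<b})) = 1"
      using large
    proof eventually_elim
      case (elim n)
      have "((\<lambda>x. smooth_step (real n * (x - a) - 1)) has_real_derivative L n x) (at x)" for x
        unfolding L_def
        by (rule DERIV_cong[OF DERIV_chain2[OF smooth_step_has_deriv]])
          (auto intro!: derivative_eq_intros)
      then have "(\<integral>x. L n x \<partial>(lebesgue_on {a<..<b}))
          = smooth_step (real n * (b - a) - 1) - smooth_step (real n * (a - a) - 1)"
        using assms(1) cont by (intro integral_deriv_interval) auto
      then show ?case
        using elim by (simp add: smooth_step_eq_0 smooth_step_eq_1)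
    qed
    show "L n x = 0" if "2 < real n * \<bar>x - a\<bar>" for n x
    proof -
      have "real n * (x - a) - 1 \<notin> {0<..<1}"
        using that mult_nonneg_nonpos[of "real n" "x - a"] by (cases "x \<le> a") auto
      then show ?thesis by (simp add: L_def deriv_smooth_step_eq_0)
    qed
  qed (use cont nonneg assms in auto)
  moreover have "(\<lambda>n. \<integral>x. R n x * G x \<partial>(lebesgue_on {a<..<b})) \<longlonglongrightarrow> G b"
  proof (rule approximate_identity)
    show "\<forall>\<^sub>F n in sequentially. (\<integral>x. R n x \<partial>(lebesgue_on {a<..<b})) = 1"
      using large
    proof eventually_elim
      case (elim n)
      have "((\<lambda>x. - smooth_step (real n * (b - x) - 1)) has_real_derivative R n x) (at x)" for x
        unfolding R_def
        by (rule DERIV_cong[OF DERIV_minus[OF DERIV_chain2[OF smooth_step_has_deriv]]])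
          (auto intro!: derivative_eq_intros)
      then have "(\<integral>x. R n x \<partial>(lebesgue_on {a<..<b}))
          = - smooth_step (real n * (b - b) - 1) - - smooth_step (real n * (b - a) - 1)"
        using assms(1) cont by (intro integral_deriv_interval) auto
      then show ?case
        using elim by (simp add: smooth_step_eq_0 smooth_step_eq_1)
    qed
    show "R n x = 0" if "2 < real n * \<bar>x - b\<bar>" for n x
    proof -
      have "real n * (b - x) - 1 \<notin> {0<..<1}"
        using that mult_nonneg_nonpos[of "real n" "b - x"] by (cases "b \<le> x") (auto simp: abs_if)
      then show ?thesis by (simp add: R_def deriv_smooth_step_eq_0)
    qed
  qed (use cont nonneg assms in auto)
  ultimately have "(\<lambda>n. (\<integral>x. L n x * G x \<partial>(lebesgue_on {a<..<b}))
      - (\<integral>x. R n x * G x \<partial>(lebesgue_on {a<..<b}))) \<longlonglongrightarrow> G a - G b"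
    by (rule tendsto_diff)
  then show ?thesis
  proof (rule Lim_transform_eventually)
    show "\<forall>\<^sub>F n in sequentially. (\<integral>x. L n x * G x \<partial>(lebesgue_on {a<..<b}))
      - (\<integral>x. R n x * G x \<partial>(lebesgue_on {a<..<b}))
      = (\<integral>x. deriv (cutoff a b (real n)) x * G x \<partial>(lebesgue_on {a<..<b}))"
      using large
    proof eventually_elim
      case (elim n)
      \<comment> \<open>Once the two transition layers are disjoint, each factor of the cutoff
        equals one where the other varies.\<close>
      have eq: "deriv (cutoff a b (real n)) x = L n x - R n x" for x
      proof -
        have sum: "real n * (x - a) + real n * (b - x) \<ge> 4"
          using elim by (simp add: algebra_simps)
        have 1: "deriv smooth_step (real n * (x - a) - 1) = 0 \<or> smooth_step (real n * (b - x) - 1) = 1"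
          using sum deriv_smooth_step_eq_0[of "real n * (x - a) - 1"] smooth_step_eq_1[of "real n * (b - x) - 1"]
          by (cases "real n * (x - a) \<le> 2") auto
        have 2: "deriv smooth_step (real n * (b - x) - 1) = 0 \<or> smooth_step (real n * (x - a) - 1) = 1"
          using sum deriv_smooth_step_eq_0[of "real n * (b - x) - 1"] smooth_step_eq_1[of "real n * (x - a) - 1"]
          by (cases "real n * (b - x) \<le> 2") auto
        show ?thesis using 1 2 by (auto simp: deriv_cutoff L_def R_def)
      qed
      have "integrable (lebesgue_on {a<..<b}) (\<lambda>x. L n x * G x)"
        "integrable (lebesgue_on {a<..<b}) (\<lambda>x. R n x * G x)"
        by (intro continuous_integrable continuous_intros cont assms)+
      then show ?case
        by (simp add: eq left_diff_distrib)
    qed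
  qed
qed

lemma integral_cutoff_tendsto:
  assumes "integrable (lebesgue_on {a<..<b}) H"
  shows "(\<lambda>n. \<integral>x. cutoff a b (real n) x * H x \<partial>(lebesgue_on {a<..<b})) \<longlonglongrightarrow> (\<integral>x. H x \<partial>(lebesgue_on {a<..<b}))"
proof (rule integral_dominated_convergence)
  show "AE x in lebesgue_on {a<..<b}. (\<lambda>n. cutoff a b (real n) x * H x) \<longlonglongrightarrow> H x"
  proof (rule AE_I2)
    fix x assume "x \<in> space (lebesgue_on {a<..<b})"
    then have "\<forall>\<^sub>F n in sequentially. cutoff a b (real n) x = 1"
      by (intro eventually_compose_filterlim[OF cutoff_eventually_1 filterlim_real_sequentially]) auto
    then show "(\<lambda>n. cutoff a b (real n) x * H x) \<longlonglongrightarrow> H x"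
      by (intro tendsto_eventually) (auto elim: eventually_mono)
  qed
  show "AE x in lebesgue_on {a<..<b}. norm (cutoff a b (real n) x * H x) \<le> norm (H x)" for n
    using cutoff_bounds[of a b "real n"] by (intro AE_I2) (auto simp: abs_mult intro!: mult_left_le_one_le)
  show "(\<lambda>x. cutoff a b (real n) x * H x) \<in> borel_measurable (lebesgue_on {a<..<b})" for n
    using integrable_mult_continuous[OF assms smooth_continuous[OF smooth_cutoff]] by blast
qed (use assms in auto)

text \<open>Testing with cutoffs of the whole interval produces the boundary values on one side, because
  their derivatives concentrate at the end points, and the full integral on the other.\<close>

lemma fundamental_theorem_distributional:
  assumes "a < b" "continuous_on {a..b} G" "integrable (lebesgue_on {a<..<b}) H"
    and weak: "\<And>\<phi>. \<phi> \<in> test_functions a b \<Longrightarrow>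
      (\<integral>x. deriv \<phi> x * G x \<partial>(lebesgue_on {a<..<b})) = - (\<integral>x. \<phi> x * H x \<partial>(lebesgue_on {a<..<b}))"
  shows "G b - G a = (\<integral>x. H x \<partial>(lebesgue_on {a<..<b}))"
proof -
  have "(\<lambda>n. - (\<integral>x. cutoff a b (real n) x * H x \<partial>(lebesgue_on {a<..<b}))) \<longlonglongrightarrow> G a - G b"
  proof (rule Lim_transform_eventually[OF integral_deriv_cutoff_tendsto[OF assms(1,2)]])
    show "\<forall>\<^sub>F n in sequentially. (\<integral>x. deriv (cutoff a b (real n)) x * G x \<partial>(lebesgue_on {a<..<b}))
        = - (\<integral>x. cutoff a b (real n) x * H x \<partial>(lebesgue_on {a<..<b}))"
      using eventually_gt_at_top[of 0] by eventually_elim (rule weak[OF cutoff_test_function], simp)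
  qed
  from LIMSEQ_unique[OF this tendsto_minus[OF integral_cutoff_tendsto[OF assms(3)]]]
  show ?thesis by simp
qed

text \<open>Lebesgue measurable functions are almost everywhere limits of continuous ones, and clipping
  keeps a bound.\<close>

lemma bounded_measurable_limit_continuous:
  fixes f :: "'a::euclidean_space \<Rightarrow> real"
  assumes f: "f \<in> borel_measurable (lebesgue_on S)" and S: "S \<in> sets lebesgue"
    and B: "\<And>x. x \<in> S \<Longrightarrow> \<bar>f x\<bar> \<le> B" "0 \<le> B"
  obtains g :: "nat \<Rightarrow> 'a \<Rightarrow> real" where "\<And>n. continuous_on UNIV (g n)" "\<And>n x. \<bar>g n x\<bar> \<le> B"
    "AE x in lebesgue_on S. (\<lambda>n. g n x) \<longlonglongrightarrow> f x"
proof -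
  have "(\<lambda>x. if x \<in> S then f x else 0) measurable_on UNIV"
    using f S by (intro lebesgue_measurable_imp_measurable_on_real) (auto simp: borel_measurable_if)
  then obtain N h where N: "negligible N" and h: "\<And>n. continuous_on UNIV (h n)"
    "\<And>x. x \<notin> N \<Longrightarrow> (\<lambda>n. h n x) \<longlonglongrightarrow> (if x \<in> S then f x else 0)"
    unfolding measurable_on_def by auto
  show thesis
  proof (rule that[of "\<lambda>n x. max (- B) (min B (h n x))"])
    show "continuous_on UNIV (\<lambda>x. max (- B) (min B (h n x)))" for n
      by (intro continuous_intros h)
    show "\<bar>max (- B) (min B (h n x))\<bar> \<le> B" for n x using B(2) by auto
    have "AE x in lebesgue. x \<notin> N"
      using N by (simp add: negligible_iff_null_sets AE_not_in)
    then show "AE x in lebesgue_on S. (\<lambda>n. max (- B) (min B (h n x))) \<longlonglongrightarrow> f x"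
      unfolding AE_restrict_space_iff[of S lebesgue, simplified, OF S]
    proof eventually_elim
      case (elim x)
      show ?case
      proof
        assume x: "x \<in> S"
        then have "(\<lambda>n. max (- B) (min B (h n x))) \<longlonglongrightarrow> max (- B) (min B (f x))"
          using h(2)[OF elim] by (intro tendsto_intros) auto
        with B(1)[OF x] show "(\<lambda>n. max (- B) (min B (h n x))) \<longlonglongrightarrow> f x"
          by (simp add: min_def max_def abs_le_iff split: if_splits)
      qed
    qed
  qed
qed

lemma smooth_real_polynomial_function:
  fixes p :: "real \<Rightarrow> real"
  assumes "real_polynomial_function p"
  shows "smooth p"
  using assms
proof (induction rule: real_polynomial_function.induct)
  case (linear h)
  then obtain c where "h = (\<lambda>x. x * c)" using real_bounded_linear by auto
  then show ?case
    by (intro smoothI_antiderivative[of h "\<lambda>x. c"] smooth_const) (auto intro!: derivative_eq_intros)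
qed (auto intro: smooth_const smooth_add smooth_mult)

text \<open>The fundamental lemma of the calculus of variations. Cutting off and polynomial approximation
  give orthogonality to all continuous functions, which approximate the sign of \<open>g\<close>.\<close>

lemma AE_zero_if_orthogonal_test_functions:
  assumes g: "integrable (lebesgue_on {a<..<b}) g"
    and orth: "\<And>\<phi>. \<phi> \<in> test_functions a b \<Longrightarrow> (\<integral>x. g x * \<phi> x \<partial>(lebesgue_on {a<..<b})) = 0"
  shows "AE x in lebesgue_on {a<..<b}. g x = 0"
proof -
  let ?M = "lebesgue_on {a<..<b}"
  have smooth: "(\<integral>x. f x * g x \<partial>?M) = 0" if "smooth f" for f
  proof -
    have "\<forall>\<^sub>F n in sequentially. 0 = (\<integral>x. cutoff a b (real n) x * (f x * g x) \<partial>?M)"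
      using eventually_gt_at_top[of 0]
    proof eventually_elim
      case (elim n)
      show ?case
        using orth[OF test_function_mult_smooth[OF cutoff_test_function[of "real n" a b] that]] elim
        by (simp add: mult_ac)
    qed
    from LIMSEQ_unique[OF Lim_transform_eventually[OF tendsto_const this]
        integral_cutoff_tendsto[OF integrable_mult_continuous[OF g smooth_continuous[OF that]]]]
    show ?thesis by simp
  qed
  have cont: "(\<integral>x. f x * g x \<partial>?M) = 0" if f: "continuous_on UNIV f" for f
  proof -
    define I where "I = (\<integral>x. \<bar>g x\<bar> \<partial>?M)"
    have I: "0 \<le> I" by (simp add: I_def)
    have fi: "integrable ?M (\<lambda>x. f x * g x)"
      by (intro integrable_mult_continuous[OF g] continuous_on_subset[OF f]) simp
    have "\<bar>\<integral>x. f x * g x \<partial>?M\<bar> \<le> e" if "e > 0" for e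
    proof -
      have "0 < e / (I + 1)" using I that by simp
      then obtain p where p: "real_polynomial_function p" "\<And>x. x \<in> {a..b} \<Longrightarrow> \<bar>f x - p x\<bar> < e / (I + 1)"
        using Stone_Weierstrass_real_polynomial_function[of "{a..b}" f "e / (I + 1)"] f
        by (metis compact_Icc continuous_on_subset subset_UNIV)
      note ps = smooth_real_polynomial_function[OF p(1)]
      have pi: "integrable ?M (\<lambda>x. p x * g x)"
        by (intro integrable_mult_continuous[OF g] smooth_continuous ps)
      have "(\<integral>x. f x * g x \<partial>?M) = (\<integral>x. (f x - p x) * g x \<partial>?M)"
        using smooth[OF ps] fi pi by (simp add: left_diff_distrib)
      also have "\<bar>\<dots>\<bar> \<le> (\<integral>x. e / (I + 1) * \<bar>g x\<bar> \<partial>?M)"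
        using g
      proof (intro order_trans[OF integral_abs_bound] integral_mono)
        show "integrable ?M (\<lambda>x. \<bar>(f x - p x) * g x\<bar>)"
          using fi pi by (simp add: left_diff_distrib)
        fix x assume "x \<in> space ?M"
        then show "\<bar>(f x - p x) * g x\<bar> \<le> e / (I + 1) * \<bar>g x\<bar>"
          using mult_right_mono[OF less_imp_le[OF p(2)[of x]], of "\<bar>g x\<bar>"] by (simp add: abs_mult)
      qed auto
      also have "\<dots> = e * (I / (I + 1))" by (simp add: I_def)
      also have "\<dots> \<le> e * 1"
        using that I by (intro mult_left_mono) (simp_all add: divide_le_eq)
      also have "e * 1 = e" by simp
      finally show ?thesis .
    qed
    then have "\<bar>\<integral>x. f x * g x \<partial>?M\<bar> \<le> 0" by (rule field_le_epsilon) simp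
    then show ?thesis by simp
  qed
  have sgn: "(\<lambda>x. sgn (g x)) \<in> borel_measurable ?M"
    using borel_measurable_integrable[OF g] by measurable
  obtain h :: "nat \<Rightarrow> real \<Rightarrow> real" where h: "\<And>n. continuous_on UNIV (h n)" "\<And>n x. \<bar>h n x\<bar> \<le> 1"
    "AE x in ?M. (\<lambda>n. h n x) \<longlonglongrightarrow> sgn (g x)"
    by (rule bounded_measurable_limit_continuous[OF sgn, of 1]) (simp, simp add: abs_sgn_eq, simp, blast)
  have "(\<lambda>n. \<integral>x. h n x * g x \<partial>?M) \<longlonglongrightarrow> (\<integral>x. sgn (g x) * g x \<partial>?M)"
  proof (rule integral_dominated_convergence)
    show "AE x in ?M. (\<lambda>n. h n x * g x) \<longlonglongrightarrow> sgn (g x) * g x"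
      using h(3) by eventually_elim (intro tendsto_intros)
    show "AE x in ?M. norm (h n x * g x) \<le> norm (g x)" for n
      using h(2)[of n] by (intro AE_I2) (auto simp: abs_mult intro!: mult_left_le_one_le)
    show "(\<lambda>x. h n x * g x) \<in> borel_measurable ?M" for n
      by (intro borel_measurable_integrable integrable_mult_continuous[OF g] continuous_on_subset[OF h(1)]) simp
    show "(\<lambda>x. sgn (g x) * g x) \<in> borel_measurable ?M"
      using sgn borel_measurable_integrable[OF g] by measurable
    show "integrable ?M (\<lambda>x. norm (g x))"
      using g by simp
  qed
  then have "(\<integral>x. sgn (g x) * g x \<partial>?M) = 0"
    using cont[OF h(1)] by (simp only: LIMSEQ_const_iff)
  moreover have "sgn (g x) * g x = \<bar>g x\<bar>" for x by (simp add: sgn_if)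
  ultimately have "(\<integral>x. \<bar>g x\<bar> \<partial>?M) = 0" by (simp only:)
  then have "AE x in ?M. \<bar>g x\<bar> = 0"
    using g by (subst (asm) integral_nonneg_eq_0_iff_AE) auto
  then show ?thesis by simp
qed

section \<open>Sobolev functions on the unit interval\<close>

lemmas L2_\<Omega>_integrable = L2_integrable_interval[of _ 0 1]

lemma smooth_L2: "smooth f \<Longrightarrow> f \<in> L2 (lebesgue_on {a<..<b})"
  by (rule continuous_L2[OF smooth_continuous])

lemma test_function_smooth: "\<phi> \<in> test_functions a b \<Longrightarrow> smooth \<phi>"
  by (simp add: test_functions_iff)

lemma test_function_add:
  assumes "\<phi> \<in> test_functions a b" "\<psi> \<in> test_functions a b"
  shows "(\<lambda>x. \<phi> x + \<psi> x) \<in> test_functions a b"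
proof -
  obtain K L where "compact K" "K \<subseteq> {a<..<b}" "\<forall>x. x \<notin> K \<longrightarrow> \<phi> x = 0"
    "compact L" "L \<subseteq> {a<..<b}" "\<forall>x. x \<notin> L \<longrightarrow> \<psi> x = 0"
    using assms by (auto simp: test_functions_iff)
  then have "compact (K \<union> L) \<and> K \<union> L \<subseteq> {a<..<b} \<and> (\<forall>x. x \<notin> K \<union> L \<longrightarrow> \<phi> x + \<psi> x = 0)"
    by auto
  with assms show ?thesis
    unfolding test_functions_iff by (blast intro: smooth_add)
qed

lemma test_function_scale: "\<phi> \<in> test_functions a b \<Longrightarrow> (\<lambda>x. c * \<phi> x) \<in> test_functions a b"
  by (rule test_function_mult_smooth[OF _ smooth_const])

text \<open>Uniqueness turns the chosen representative \<^const>\<open>weak_deriv\<close> into a linear operation up to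
  null sets, and every weak derivative may be used to compute the Sobolev norm.\<close>

lemma is_weak_deriv_unique:
  assumes "is_weak_deriv v g" "is_weak_deriv v h"
  shows "AE x in \<Omega>. g x = h x"
proof -
  have gh: "g \<in> L2 \<Omega>" "h \<in> L2 \<Omega>" using assms by (auto simp: is_weak_deriv_def)
  have "AE x in \<Omega>. g x - h x = 0"
  proof (rule AE_zero_if_orthogonal_test_functions)
    show "integrable \<Omega> (\<lambda>x. g x - h x)" using gh L2_\<Omega>_integrable by auto
    fix \<phi> assume \<phi>: "\<phi> \<in> test_functions 0 1"
    have "(\<integral>x. g x * \<phi> x \<partial>\<Omega>) = (\<integral>x. h x * \<phi> x \<partial>\<Omega>)"
      using assms \<phi> by (auto simp: is_weak_deriv_def)
    then show "(\<integral>x. (g x - h x) * \<phi> x \<partial>\<Omega>) = 0"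
      using L2_integrable_mult[OF gh(1) smooth_L2[OF test_function_smooth[OF \<phi>]]]
        L2_integrable_mult[OF gh(2) smooth_L2[OF test_function_smooth[OF \<phi>]]]
      by (simp add: left_diff_distrib)
  qed
  then show ?thesis by simp
qed

lemma H1_weak_deriv: "v \<in> H1 \<Longrightarrow> is_weak_deriv v (weak_deriv v)"
  unfolding H1_def weak_deriv_def using someI_ex[of "is_weak_deriv v"] by auto

lemma H1_L2: "v \<in> H1 \<Longrightarrow> v \<in> L2 \<Omega>" "v \<in> H1 \<Longrightarrow> weak_deriv v \<in> L2 \<Omega>"
  using H1_weak_deriv[of v] by (auto simp: H1_def is_weak_deriv_def)

lemma weak_deriv_AE_eq:
  assumes "v \<in> L2 \<Omega>" "is_weak_deriv v g"
  shows "AE x in \<Omega>. weak_deriv v x = g x"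
  using assms by (intro is_weak_deriv_unique[OF H1_weak_deriv]) (auto simp: H1_def)

lemma H1_norm_weak_deriv:
  assumes "v \<in> L2 \<Omega>" "is_weak_deriv v g"
  shows "H1_norm v = sqrt ((L2_norm \<Omega> v)\<^sup>2 + (L2_norm \<Omega> g)\<^sup>2)"
proof -
  have v: "v \<in> H1" using assms by (auto simp: H1_def)
  then have "L2_norm \<Omega> (weak_deriv v) = L2_norm \<Omega> g"
    using assms weak_deriv_AE_eq[OF assms] H1_L2[OF v]
    by (intro L2_norm_cong_AE) (auto simp: L2_def is_weak_deriv_def)
  then show ?thesis by (simp add: H1_norm_def)
qed

lemma is_weak_deriv_add:
  assumes "v \<in> L2 \<Omega>" "w \<in> L2 \<Omega>" "is_weak_deriv v g" "is_weak_deriv w h"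
  shows "is_weak_deriv (\<lambda>x. v x + w x) (\<lambda>x. g x + h x)"
proof -
  have gh: "g \<in> L2 \<Omega>" "h \<in> L2 \<Omega>" using assms by (auto simp: is_weak_deriv_def)
  show ?thesis
    unfolding is_weak_deriv_def
  proof (intro conjI ballI L2_add gh)
    fix \<phi> assume \<phi>: "\<phi> \<in> test_functions 0 1"
    have L2: "\<phi> \<in> L2 \<Omega>" "deriv \<phi> \<in> L2 \<Omega>"
      using test_function_smooth[OF \<phi>] by (auto intro: smooth_L2 smooth_deriv)
    show "(\<integral>x. (v x + w x) * deriv \<phi> x \<partial>\<Omega>) = - (\<integral>x. (g x + h x) * \<phi> x \<partial>\<Omega>)"
      using assms \<phi> gh L2 by (simp add: distrib_right L2_integrable_mult is_weak_deriv_def)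
  qed
qed

lemma is_weak_deriv_scale:
  assumes "is_weak_deriv v g"
  shows "is_weak_deriv (\<lambda>x. c * v x) (\<lambda>x. c * g x)"
  using assms by (auto simp: is_weak_deriv_def L2_scale mult.assoc)

lemma H1_add: "v \<in> H1 \<Longrightarrow> w \<in> H1 \<Longrightarrow> (\<lambda>x. v x + w x) \<in> H1"
  using is_weak_deriv_add[of v w] by (auto simp: H1_def intro: L2_add)

lemma H1_scale: "v \<in> H1 \<Longrightarrow> (\<lambda>x. c * v x) \<in> H1"
  by (auto simp: H1_def intro: L2_scale is_weak_deriv_scale)

lemma weak_deriv_add_AE:
  assumes "v \<in> H1" "w \<in> H1"
  shows "AE x in \<Omega>. weak_deriv (\<lambda>x. v x + w x) x = weak_deriv v x + weak_deriv w x"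
  using assms by (intro weak_deriv_AE_eq is_weak_deriv_add H1_weak_deriv L2_add H1_L2)

lemma weak_deriv_scale_AE:
  assumes "v \<in> H1"
  shows "AE x in \<Omega>. weak_deriv (\<lambda>x. c * v x) x = c * weak_deriv v x"
  using assms by (intro weak_deriv_AE_eq is_weak_deriv_scale H1_weak_deriv L2_scale H1_L2)

lemma H1_norm_nonneg [simp]: "0 \<le> H1_norm v"
  by (simp add: H1_norm_def)

lemma H1_norm_ge: "L2_norm \<Omega> v \<le> H1_norm v" "L2_norm \<Omega> (weak_deriv v) \<le> H1_norm v"
  by (auto simp: H1_norm_def intro!: real_le_rsqrt)

lemma H1_norm_triangle:
  assumes "v \<in> H1" "w \<in> H1"
  shows "H1_norm (\<lambda>x. v x + w x) \<le> H1_norm v + H1_norm w"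
proof -
  note L2 = H1_L2[OF assms(1)] H1_L2[OF assms(2)]
  have "H1_norm (\<lambda>x. v x + w x) = sqrt ((L2_norm \<Omega> (\<lambda>x. v x + w x))\<^sup>2
      + (L2_norm \<Omega> (\<lambda>x. weak_deriv v x + weak_deriv w x))\<^sup>2)"
    by (intro H1_norm_weak_deriv is_weak_deriv_add L2_add L2 H1_weak_deriv assms)
  also have "\<dots> \<le> sqrt ((L2_norm \<Omega> v + L2_norm \<Omega> w)\<^sup>2
      + (L2_norm \<Omega> (weak_deriv v) + L2_norm \<Omega> (weak_deriv w))\<^sup>2)"
    by (intro real_sqrt_le_mono add_mono power_mono L2_norm_triangle L2 L2_norm_nonneg)
  also have "\<dots> \<le> H1_norm v + H1_norm w"
    unfolding H1_norm_def by (rule real_sqrt_sum_squares_triangle_ineq)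
  finally show ?thesis .
qed

lemma H1_norm_scale:
  assumes "v \<in> H1"
  shows "H1_norm (\<lambda>x. c * v x) = \<bar>c\<bar> * H1_norm v"
proof -
  have "H1_norm (\<lambda>x. c * v x) = sqrt ((L2_norm \<Omega> (\<lambda>x. c * v x))\<^sup>2 + (L2_norm \<Omega> (\<lambda>x. c * weak_deriv v x))\<^sup>2)"
    using assms by (intro H1_norm_weak_deriv is_weak_deriv_scale H1_weak_deriv L2_scale H1_L2)
  also have "\<dots> = sqrt (c\<^sup>2 * ((L2_norm \<Omega> v)\<^sup>2 + (L2_norm \<Omega> (weak_deriv v))\<^sup>2))"
    by (simp add: L2_norm_scale power_mult_distrib distrib_left)
  finally show ?thesis by (simp add: H1_norm_def real_sqrt_mult)
qed

lemma smooth_is_weak_deriv: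
  assumes "smooth f"
  shows "is_weak_deriv f (deriv f)"
  using assms
  by (auto simp: is_weak_deriv_def intro!: smooth_L2 smooth_deriv
      integral_by_parts_test_function smooth_has_deriv smooth_continuous)

lemma smooth_H1: "smooth f \<Longrightarrow> f \<in> H1"
  using smooth_is_weak_deriv smooth_L2 by (auto simp: H1_def)

lemma H10_H1: "v \<in> H10 \<Longrightarrow> v \<in> H1"
  by (simp add: H10_def)

lemma H10I:
  assumes "v \<in> H1" "\<And>n. \<phi> n \<in> test_functions 0 1" "(\<lambda>n. H1_norm (\<lambda>x. \<phi> n x - v x)) \<longlonglongrightarrow> 0"
  shows "v \<in> H10"
  using assms by (auto simp: H10_def fun_diff_def)

lemma H10E:
  assumes "v \<in> H10"
  obtains \<phi> where "\<And>n. \<phi> n \<in> test_functions 0 1" "(\<lambda>n. H1_norm (\<lambda>x. \<phi> n x - v x)) \<longlonglongrightarrow> 0"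
  using assms by (auto simp: H10_def fun_diff_def)

lemma H1_diff: "v \<in> H1 \<Longrightarrow> w \<in> H1 \<Longrightarrow> (\<lambda>x. v x - w x) \<in> H1"
  using H1_add[of v "\<lambda>x. (-1) * w x"] H1_scale[of w "-1"] by simp

lemma H10_add:
  assumes "v \<in> H10" "w \<in> H10"
  shows "(\<lambda>x. v x + w x) \<in> H10"
proof -
  obtain \<phi> where \<phi>: "\<And>n. \<phi> n \<in> test_functions 0 1" "(\<lambda>n. H1_norm (\<lambda>x. \<phi> n x - v x)) \<longlonglongrightarrow> 0"
    using H10E[OF assms(1)] by blast
  obtain \<psi> where \<psi>: "\<And>n. \<psi> n \<in> test_functions 0 1" "(\<lambda>n. H1_norm (\<lambda>x. \<psi> n x - w x)) \<longlonglongrightarrow> 0"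
    using H10E[OF assms(2)] by blast
  note H1 = H10_H1[OF assms(1)] H10_H1[OF assms(2)] smooth_H1[OF test_function_smooth]
  show ?thesis
  proof (rule H10I)
    show "(\<lambda>n. H1_norm (\<lambda>x. (\<phi> n x + \<psi> n x) - (v x + w x))) \<longlonglongrightarrow> 0"
    proof (rule tendsto_sandwich[OF _ _ tendsto_const])
      show "\<forall>\<^sub>F n in sequentially. H1_norm (\<lambda>x. (\<phi> n x + \<psi> n x) - (v x + w x))
          \<le> H1_norm (\<lambda>x. \<phi> n x - v x) + H1_norm (\<lambda>x. \<psi> n x - w x)"
      proof (rule always_eventually, rule allI)
        fix n
        have "H1_norm (\<lambda>x. (\<phi> n x - v x) + (\<psi> n x - w x)) \<le> H1_norm (\<lambda>x. \<phi> n x - v x) + H1_norm (\<lambda>x. \<psi> n x - w x)"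
          by (intro H1_norm_triangle H1_diff H1(1,2) H1(3)[OF \<phi>(1)] H1(3)[OF \<psi>(1)])
        then show "H1_norm (\<lambda>x. (\<phi> n x + \<psi> n x) - (v x + w x))
          \<le> H1_norm (\<lambda>x. \<phi> n x - v x) + H1_norm (\<lambda>x. \<psi> n x - w x)"
          by (simp add: algebra_simps)
      qed
      show "(\<lambda>n. H1_norm (\<lambda>x. \<phi> n x - v x) + H1_norm (\<lambda>x. \<psi> n x - w x)) \<longlonglongrightarrow> 0"
        using tendsto_add[OF \<phi>(2) \<psi>(2)] by simp
    qed simp
  qed (auto intro: H1_add H1 test_function_add \<phi> \<psi>)
qed

lemma H10_scale:
  assumes "v \<in> H10"
  shows "(\<lambda>x. c * v x) \<in> H10"
proof -
  obtain \<phi> where \<phi>: "\<And>n. \<phi> n \<in> test_functions 0 1" "(\<lambda>n. H1_norm (\<lambda>x. \<phi> n x - v x)) \<longlonglongrightarrow> 0"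
    using H10E[OF assms] by blast
  have "H1_norm (\<lambda>x. c * \<phi> n x - c * v x) = \<bar>c\<bar> * H1_norm (\<lambda>x. \<phi> n x - v x)" for n
    using H1_norm_scale[OF H1_diff[OF smooth_H1[OF test_function_smooth[OF \<phi>(1)]] H10_H1[OF assms]], of c n]
    by (simp add: right_diff_distrib)
  moreover have "(\<lambda>n. \<bar>c\<bar> * H1_norm (\<lambda>x. \<phi> n x - v x)) \<longlonglongrightarrow> 0"
    using tendsto_mult_left[OF \<phi>(2), of "\<bar>c\<bar>"] by simp
  ultimately show ?thesis
    by (intro H10I[of _ "\<lambda>n x. c * \<phi> n x"]) (auto intro: H1_scale H10_H1 assms test_function_scale \<phi>)
qed

text \<open>Integration by parts against functions with zero boundary values has no boundary term: the
  identity is continuous in the Sobolev norm and holds for test functions.\<close>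

lemma H10_integral_by_parts:
  assumes "v \<in> H10" "smooth g"
  shows "(\<integral>x. g x * weak_deriv v x \<partial>\<Omega>) = - (\<integral>x. deriv g x * v x \<partial>\<Omega>)"
proof -
  define F where "F v = (\<integral>x. g x * weak_deriv v x \<partial>\<Omega>) + (\<integral>x. deriv g x * v x \<partial>\<Omega>)" for v
  have g: "g \<in> L2 \<Omega>" "deriv g \<in> L2 \<Omega>" using assms(2) by (auto intro: smooth_L2 smooth_deriv)
  have bound: "\<bar>F v\<bar> \<le> (L2_norm \<Omega> g + L2_norm \<Omega> (deriv g)) * H1_norm v" if "v \<in> H1" for v
  proof -
    have "\<bar>F v\<bar> \<le> L2_norm \<Omega> g * L2_norm \<Omega> (weak_deriv v) + L2_norm \<Omega> (deriv g) * L2_norm \<Omega> v"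
      unfolding F_def using H1_L2[OF that] g
      by (intro order_trans[OF abs_triangle_ineq] add_mono L2_Cauchy_Schwarz)
    also have "\<dots> \<le> L2_norm \<Omega> g * H1_norm v + L2_norm \<Omega> (deriv g) * H1_norm v"
      by (intro add_mono mult_left_mono H1_norm_ge L2_norm_nonneg)
    finally show ?thesis by (simp add: distrib_right)
  qed
  have test: "F \<phi> = 0" if "\<phi> \<in> test_functions 0 1" for \<phi>
  proof -
    note \<phi> = test_function_smooth[OF that]
    have "(\<integral>x. g x * weak_deriv \<phi> x \<partial>\<Omega>) = (\<integral>x. g x * deriv \<phi> x \<partial>\<Omega>)"
    proof (rule integral_cong_AE)
      show "AE x in \<Omega>. g x * weak_deriv \<phi> x = g x * deriv \<phi> x"
        using weak_deriv_AE_eq[OF smooth_L2[OF \<phi>] smooth_is_weak_deriv[OF \<phi>]]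
        by eventually_elim simp
    qed (use g H1_L2[OF smooth_H1[OF \<phi>]] smooth_L2[OF smooth_deriv[OF \<phi>]] in
        \<open>auto simp: L2_def intro!: borel_measurable_times\<close>)
    also have "\<dots> = - (\<integral>x. deriv g x * \<phi> x \<partial>\<Omega>)"
      using that assms(2)
      by (intro integral_by_parts_test_function smooth_has_deriv smooth_continuous smooth_deriv) auto
    finally show ?thesis by (simp add: F_def)
  qed
  have diff: "F (\<lambda>x. \<phi> x - v x) = F \<phi> - F v" if "\<phi> \<in> H1" "v \<in> H1" for \<phi> v
  proof -
    have v': "(\<lambda>x. (-1) * v x) \<in> H1" using H1_scale[OF that(2)] .
    have "AE x in \<Omega>. weak_deriv (\<lambda>x. \<phi> x - v x) x = weak_deriv \<phi> x - weak_deriv v x"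
      using weak_deriv_add_AE[OF that(1) v'] weak_deriv_scale_AE[OF that(2), of "-1"]
      by eventually_elim simp
    then have "(\<integral>x. g x * weak_deriv (\<lambda>x. \<phi> x - v x) x \<partial>\<Omega>) = (\<integral>x. g x * (weak_deriv \<phi> x - weak_deriv v x) \<partial>\<Omega>)"
      using g H1_L2[OF that(1)] H1_L2[OF that(2)] H1_L2[OF H1_diff[OF that]]
      by (intro integral_cong_AE) (auto simp: L2_def intro!: borel_measurable_times borel_measurable_diff elim!: eventually_mono)
    then show ?thesis
      using g H1_L2[OF that(1)] H1_L2[OF that(2)]
      by (simp add: F_def right_diff_distrib L2_integrable_mult)
  qed
  obtain \<phi> where \<phi>: "\<And>n. \<phi> n \<in> test_functions 0 1" "(\<lambda>n. H1_norm (\<lambda>x. \<phi> n x - v x)) \<longlonglongrightarrow> 0"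
    using H10E[OF assms(1)] by blast
  have v: "v \<in> H1" and \<phi>H1: "\<phi> n \<in> H1" for n
    using assms(1) H10_H1 smooth_H1[OF test_function_smooth[OF \<phi>(1)]] by auto
  have "\<bar>F v\<bar> \<le> (L2_norm \<Omega> g + L2_norm \<Omega> (deriv g)) * H1_norm (\<lambda>x. \<phi> n x - v x)" for n
    using bound[OF H1_diff[OF \<phi>H1 v], of n] by (simp add: diff[OF \<phi>H1 v] test[OF \<phi>(1)])
  then have "\<bar>F v\<bar> \<le> (L2_norm \<Omega> g + L2_norm \<Omega> (deriv g)) * 0"
    by (intro LIMSEQ_le_const[OF tendsto_mult_left[OF \<phi>(2)]]) auto
  then show ?thesis by (simp add: F_def)
qed

text \<open>A smooth function that vanishes at both end points is approximated by its cutoffs: the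
  derivative of the cutoff is of the order of the inverse distance to the end points, but there
  the function is of the order of that distance.\<close>

lemma smooth_vanishing_H10:
  assumes f: "smooth f" "f 0 = 0" "f 1 = 0"
  shows "f \<in> H10"
proof -
  define \<kappa> where "\<kappa> n = cutoff 0 1 (real (Suc n))" for n
  have \<kappa>: "\<kappa> n \<in> test_functions 0 1" "smooth (\<kappa> n)" for n
    unfolding \<kappa>_def by (auto intro: cutoff_test_function smooth_cutoff)
  have lim: "filterlim (\<lambda>n. real (Suc n)) at_top sequentially"
    by (rule filterlim_compose[OF filterlim_real_sequentially filterlim_Suc])
  have \<kappa>1: "\<forall>\<^sub>F n in sequentially. \<kappa> n x = 1" if "x \<in> {0<..<1}" for x
    unfolding \<kappa>_def using that by (intro eventually_compose_filterlim[OF cutoff_eventually_1 lim]) auto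
  have \<kappa>'0: "\<forall>\<^sub>F n in sequentially. deriv (\<kappa> n) x = 0" if "x \<in> {0<..<1}" for x
  proof -
    have "\<forall>\<^sub>F n in sequentially. max (2 / x) (2 / (1 - x)) \<le> real (Suc n)"
      by (rule eventually_compose_filterlim[OF eventually_ge_at_top lim])
    then show ?thesis
      unfolding \<kappa>_def deriv_cutoff
      by eventually_elim
        (use that in \<open>subst deriv_smooth_step_eq_0; (subst deriv_smooth_step_eq_0)?; auto simp: field_simps\<close>)
  qed
  obtain L where L: "\<And>x. x \<in> {0..1} \<Longrightarrow> \<bar>deriv f x\<bar> \<le> L"
  proof -
    have "compact (deriv f ` {0..1})"
      by (intro compact_continuous_image smooth_continuous smooth_deriv f) simp
    then show thesis using compact_imp_bounded bounded_real that by (metis imageI)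
  qed
  have L0: "0 \<le> L" using L[of 0] by auto
  have lip: "\<bar>f x - f y\<bar> \<le> L * \<bar>x - y\<bar>" if "x \<in> {0..1}" "y \<in> {0..1}" for x y
    using field_differentiable_bound[of "{0..1}" f "deriv f" L x y] that L smooth_has_deriv[OF f(1)]
    by (auto intro: has_field_derivative_at_within)
  obtain B where B: "B > 0" "\<And>s. deriv smooth_step s \<le> B"
    using deriv_smooth_step_bounded by blast
  \<comment> \<open>In a transition layer the distance \<open>d\<close> to the end point is at most \<open>2 / k\<close>, which absorbs the
    factor \<open>k\<close> from the chain rule.\<close>
  have layer: "\<bar>k * deriv smooth_step (k * d - 1) * s * c\<bar> \<le> 2 * L * B"
    if "0 \<le> k" "0 \<le> s" "s \<le> 1" "\<bar>c\<bar> \<le> L * d" for k d s c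
  proof (cases "k * d - 1 \<in> {0<..<1}")
    case True
    have "\<bar>k * deriv smooth_step (k * d - 1) * s * c\<bar> = (deriv smooth_step (k * d - 1) * s) * (k * \<bar>c\<bar>)"
      using that by (simp add: abs_mult deriv_smooth_step_nonneg)
    also have "\<dots> \<le> (B * 1) * (k * (L * d))"
      using that B deriv_smooth_step_nonneg by (intro mult_mono) auto
    also have "\<dots> = (B * L) * (k * d)" by simp
    also have "\<dots> \<le> (B * L) * 2"
      using True B L0 by (intro mult_left_mono) auto
    finally show ?thesis by (simp add: mult_ac)
  next
    case False
    then show ?thesis using B L0 by (simp add: deriv_smooth_step_eq_0)
  qed
  have \<kappa>'f: "\<bar>deriv (\<kappa> n) x * f x\<bar> \<le> 4 * L * B" if "x \<in> {0<..<1}" for n x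
  proof -
    have "\<bar>f x\<bar> \<le> L * x" "\<bar>f x\<bar> \<le> L * (1 - x)"
      using lip[of x 0] lip[of x 1] that f by auto
    then have "\<bar>real (Suc n) * deriv smooth_step (real (Suc n) * x - 1) * smooth_step (real (Suc n) * (1 - x) - 1) * f x\<bar> \<le> 2 * L * B"
      "\<bar>real (Suc n) * deriv smooth_step (real (Suc n) * (1 - x) - 1) * smooth_step (real (Suc n) * x - 1) * f x\<bar> \<le> 2 * L * B"
      using smooth_step_bounds by (intro layer; simp)+
    moreover have "deriv (\<kappa> n) x * f x =
        real (Suc n) * deriv smooth_step (real (Suc n) * x - 1) * smooth_step (real (Suc n) * (1 - x) - 1) * f x
      - real (Suc n) * deriv smooth_step (real (Suc n) * (1 - x) - 1) * smooth_step (real (Suc n) * x - 1) * f x"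
      unfolding \<kappa>_def deriv_cutoff diff_0_right by algebra
    ultimately show ?thesis by linarith
  qed
  define r where "r n x = \<kappa> n x * f x - f x" for n x
  have r': "(r n has_real_derivative (\<kappa> n x - 1) * deriv f x + deriv (\<kappa> n) x * f x) (at x)" for n x
    unfolding r_def using smooth_has_deriv[OF f(1), of x] smooth_has_deriv[OF \<kappa>(2), of n x]
    by (auto intro!: derivative_eq_intros simp: algebra_simps)
  have r_smooth: "smooth (r n)" for n
    unfolding r_def using smooth_add[OF smooth_mult[OF \<kappa>(2) f(1)] smooth_mult[OF smooth_const[of "-1"] f(1)]]
    by simp
  have deriv_r: "deriv (r n) = (\<lambda>x. (\<kappa> n x - 1) * deriv f x + deriv (\<kappa> n) x * f x)" for n
    by (rule ext) (rule DERIV_imp_deriv[OF r'])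
  have abs_le: "\<bar>\<kappa> n x - 1\<bar> \<le> 1" for n x
    using cutoff_bounds[of 0 1 "real (Suc n)" x] by (auto simp: \<kappa>_def)
  have "(\<lambda>n. L2_norm \<Omega> (r n)) \<longlonglongrightarrow> 0"
  proof (rule L2_norm_dominated_convergence)
    show "(\<lambda>x. \<bar>f x\<bar>) \<in> L2 \<Omega>"
      by (intro continuous_L2 continuous_intros smooth_continuous f)
    have "\<bar>r n x\<bar> \<le> \<bar>f x\<bar>" for n x
      using abs_le[of n x] mult_right_mono[OF abs_le[of n x], of "\<bar>f x\<bar>"]
      by (simp add: r_def left_diff_distrib flip: abs_mult)
    then show "AE x in \<Omega>. \<bar>r n x\<bar> \<le> \<bar>f x\<bar>" for n by simp
    show "AE x in \<Omega>. (\<lambda>n. r n x) \<longlonglongrightarrow> 0"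
    proof (rule AE_I2)
      fix x assume "x \<in> space \<Omega>"
      then have "\<forall>\<^sub>F n in sequentially. r n x = 0"
        using \<kappa>1[of x] by (auto simp: r_def elim: eventually_mono)
      then show "(\<lambda>n. r n x) \<longlonglongrightarrow> 0" by (rule tendsto_eventually)
    qed
    show "r n \<in> borel_measurable \<Omega>" for n
      using smooth_L2[OF r_smooth[of n], of 0 1] by (simp add: L2_def)
  qed
  moreover have "(\<lambda>n. L2_norm \<Omega> (deriv (r n))) \<longlonglongrightarrow> 0"
  proof (rule L2_norm_dominated_convergence)
    show "(\<lambda>x. \<bar>deriv f x\<bar> + 4 * L * B) \<in> L2 \<Omega>"
      by (intro continuous_L2 continuous_intros smooth_continuous smooth_deriv f)
    show "AE x in \<Omega>. \<bar>deriv (r n) x\<bar> \<le> \<bar>deriv f x\<bar> + 4 * L * B" for n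
    proof (rule AE_I2)
      fix x assume "x \<in> space \<Omega>"
      then show "\<bar>deriv (r n) x\<bar> \<le> \<bar>deriv f x\<bar> + 4 * L * B"
        unfolding deriv_r using \<kappa>'f[of x n] mult_right_mono[OF abs_le[of n x], of "\<bar>deriv f x\<bar>"]
        by (intro order_trans[OF abs_triangle_ineq] add_mono) (auto simp: abs_mult)
    qed
    show "AE x in \<Omega>. (\<lambda>n. deriv (r n) x) \<longlonglongrightarrow> 0"
    proof (rule AE_I2)
      fix x assume "x \<in> space \<Omega>"
      then have "\<forall>\<^sub>F n in sequentially. \<kappa> n x = 1 \<and> deriv (\<kappa> n) x = 0"
        using \<kappa>1[of x] \<kappa>'0[of x] by (auto simp: eventually_conj)
      then have "\<forall>\<^sub>F n in sequentially. deriv (r n) x = 0"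
        by eventually_elim (simp add: deriv_r)
      then show "(\<lambda>n. deriv (r n) x) \<longlonglongrightarrow> 0" by (rule tendsto_eventually)
    qed
    show "deriv (r n) \<in> borel_measurable \<Omega>" for n
      using smooth_L2[OF smooth_deriv[OF r_smooth[of n]], of 0 1] by (simp add: L2_def)
  qed
  ultimately have "(\<lambda>n. sqrt ((L2_norm \<Omega> (r n))\<^sup>2 + (L2_norm \<Omega> (deriv (r n)))\<^sup>2)) \<longlonglongrightarrow> sqrt (0\<^sup>2 + 0\<^sup>2)"
    by (intro tendsto_intros)
  then have "(\<lambda>n. H1_norm (r n)) \<longlonglongrightarrow> 0"
    using H1_norm_weak_deriv[OF smooth_L2[OF r_smooth] smooth_is_weak_deriv[OF r_smooth]] by simp
  then show ?thesis
    unfolding r_def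
    by (intro H10I[of f "\<lambda>n x. \<kappa> n x * f x"] smooth_H1 f)
      (use test_function_mult_smooth[OF \<kappa>(1) f(1)] in \<open>auto simp: mult.commute\<close>)
qed

lemma smooth_eigenfunction: "smooth (eigenfunction n)"
  unfolding eigenfunction_def[abs_def] by (intro smooth_mult smooth_const smooth_sin)

lemma eigenfunction_H10: "eigenfunction n \<in> H10"
  by (rule smooth_vanishing_H10[OF smooth_eigenfunction]) (simp_all add: eigenfunction_def)

lemma eigenfunction_L2: "eigenfunction n \<in> L2 \<Omega>"
  by (rule smooth_L2[OF smooth_eigenfunction])

lemma deriv2_eigenfunction: "deriv (deriv (eigenfunction n)) x = - eigenvalue n * eigenfunction n x"
proof -
  have 1: "deriv (eigenfunction n) = (\<lambda>x. sqrt 2 * (n * pi) * cos (n * pi * x))"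
    by (rule ext, rule DERIV_imp_deriv)
      (auto simp: eigenfunction_def[abs_def] intro!: derivative_eq_intros)
  show ?thesis
    unfolding 1
    by (rule DERIV_imp_deriv)
      (auto simp: eigenfunction_def eigenvalue_def power2_eq_square intro!: derivative_eq_intros)
qed

lemma eigenfunction_weak_eigenvalue:
  assumes "v \<in> H10"
  shows "(\<integral>x. weak_deriv (eigenfunction n) x * weak_deriv v x \<partial>\<Omega>) = eigenvalue n * coefficient v n"
proof -
  let ?e = "eigenfunction n"
  note e = smooth_eigenfunction[of n] H1_L2[OF H10_H1[OF assms]]
  have "(\<integral>x. weak_deriv ?e x * weak_deriv v x \<partial>\<Omega>) = (\<integral>x. deriv ?e x * weak_deriv v x \<partial>\<Omega>)"
  proof (rule integral_cong_AE)
    show "AE x in \<Omega>. weak_deriv ?e x * weak_deriv v x = deriv ?e x * weak_deriv v x"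
      using weak_deriv_AE_eq[OF smooth_L2 smooth_is_weak_deriv, OF e(1) e(1)]
      by eventually_elim simp
  qed (use e H1_L2[OF smooth_H1[OF e(1)]] smooth_L2[OF smooth_deriv[OF e(1)]] in
      \<open>auto simp: L2_def intro!: borel_measurable_times\<close>)
  also have "\<dots> = - (\<integral>x. deriv (deriv ?e) x * v x \<partial>\<Omega>)"
    by (rule H10_integral_by_parts[OF assms smooth_deriv[OF e(1)]])
  also have "\<dots> = eigenvalue n * coefficient v n"
    by (simp add: deriv2_eigenfunction coefficient_def mult_ac)
  finally show ?thesis .
qed

section \<open>Vector valued functions of time\<close>

text \<open>Strong measurability only gives almost everywhere limits of simple functions. Completeness of
  Lebesgue measure makes their norms and values measurable nevertheless.\<close>

lemma borel_measurable_AE_limit: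
  fixes f :: "real \<Rightarrow> real"
  assumes u: "\<And>n. u n \<in> borel_measurable (lebesgue_on S)" and S: "S \<in> sets lebesgue"
    and lim: "AE t in lebesgue_on S. (\<lambda>n. u n t) \<longlonglongrightarrow> f t"
  shows "f \<in> borel_measurable (lebesgue_on S)"
proof -
  define g where "g t = lim (\<lambda>n. u n t)" for t
  have "g \<in> borel_measurable (lebesgue_on S)"
    unfolding g_def using u by measurable
  then have "(\<lambda>t. if t \<in> S then g t else 0) \<in> borel_measurable lebesgue"
    using S by (simp add: borel_measurable_if)
  moreover have "AE t in lebesgue. (if t \<in> S then g t else 0) = (if t \<in> S then f t else 0)"
    using lim unfolding AE_restrict_space_iff[of S lebesgue, simplified, OF S]
    by eventually_elim (auto simp: g_def limI)
  ultimately have "(\<lambda>t. if t \<in> S then f t else 0) \<in> borel_measurable lebesgue"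
    by (rule borel_measurable_AE)
  then show ?thesis using S by (simp add: borel_measurable_if)
qed

text \<open>Both the Sobolev space and its dual are spaces of real functions with a seminorm; this
  interface treats the corresponding spaces of square integrable functions of time together.\<close>

locale seminormed_functions =
  fixes X :: "('b \<Rightarrow> real) set" and nrm :: "('b \<Rightarrow> real) \<Rightarrow> real"
  assumes add: "f \<in> X \<Longrightarrow> g \<in> X \<Longrightarrow> (\<lambda>x. f x + g x) \<in> X"
    and scale: "f \<in> X \<Longrightarrow> (\<lambda>x. c * f x) \<in> X"
    and nonneg: "f \<in> X \<Longrightarrow> 0 \<le> nrm f"
    and triangle: "f \<in> X \<Longrightarrow> g \<in> X \<Longrightarrow> nrm (\<lambda>x. f x + g x) \<le> nrm f + nrm g"
    and scale_le: "f \<in> X \<Longrightarrow> nrm (\<lambda>x. c * f x) \<le> \<bar>c\<bar> * nrm f"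
begin

lemma diff: "f \<in> X \<Longrightarrow> g \<in> X \<Longrightarrow> (\<lambda>x. f x - g x) \<in> X"
  using add[of f "\<lambda>x. (-1) * g x"] scale[of g "-1"] by simp

lemma abs_diff_le:
  assumes "f \<in> X" "g \<in> X"
  shows "\<bar>nrm f - nrm g\<bar> \<le> nrm (\<lambda>x. f x - g x)"
proof -
  have "nrm (\<lambda>x. g x - f x) \<le> nrm (\<lambda>x. f x - g x)"
    using scale_le[OF diff[OF assms], of "-1"] by simp
  moreover have "nrm f \<le> nrm (\<lambda>x. f x - g x) + nrm g" "nrm g \<le> nrm (\<lambda>x. g x - f x) + nrm f"
    using triangle[OF diff[OF assms] assms(2)] triangle[OF diff[OF assms(2,1)] assms(1)] by simp_all
  ultimately show ?thesis by linarith
qed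

lemma borel_measurable_norm_limit:
  assumes s: "\<And>n. simple_function (Time T) (s n)" "\<And>n t. t \<in> {0<..<T} \<Longrightarrow> s n t \<in> X"
    and f: "AE t in Time T. f t \<in> X"
    and lim: "AE t in Time T. (\<lambda>n. nrm (\<lambda>x. s n t x - f t x)) \<longlonglongrightarrow> 0"
  shows "(\<lambda>t. nrm (f t)) \<in> borel_measurable (Time T)"
proof (rule borel_measurable_AE_limit)
  show "(\<lambda>t. nrm (s n t)) \<in> borel_measurable (Time T)" for n
    by (rule borel_measurable_simple_function[OF simple_function_compose1[OF s(1)]])
  show "AE t in Time T. (\<lambda>n. nrm (s n t)) \<longlonglongrightarrow> nrm (f t)"
    using f lim AE_space
  proof eventually_elim
    case (elim t)
    have "(\<lambda>n. nrm (s n t) - nrm (f t)) \<longlonglongrightarrow> 0"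
    proof (rule tendsto_rabs_zero_cancel, rule tendsto_sandwich[OF _ _ tendsto_const elim(2)])
      show "\<forall>\<^sub>F n in sequentially. \<bar>nrm (s n t) - nrm (f t)\<bar> \<le> nrm (\<lambda>x. s n t x - f t x)"
        using elim(3) by (intro always_eventually allI abs_diff_le[OF s(2) elim(1)]) simp
    qed simp
    then show ?case by (rule LIM_zero_cancel)
  qed
qed simp

lemma bochner_L2_iff:
  "f \<in> bochner_L2 T X nrm \<longleftrightarrow> (AE t in Time T. f t \<in> X) \<and>
     (\<exists>s. (\<forall>n. simple_function (Time T) (s n) \<and> (\<forall>t\<in>{0<..<T}. s n t \<in> X)) \<and>
          (AE t in Time T. (\<lambda>n. nrm (\<lambda>x. s n t x - f t x)) \<longlonglongrightarrow> 0)) \<and>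
     integrable (Time T) (\<lambda>t. (nrm (f t))\<^sup>2)"
  by (simp add: bochner_L2_def fun_diff_def)

lemma bochner_L2_add:
  assumes "f \<in> bochner_L2 T X nrm" "g \<in> bochner_L2 T X nrm"
  shows "(\<lambda>t x. f t x + g t x) \<in> bochner_L2 T X nrm"
proof -
  obtain s where f: "AE t in Time T. f t \<in> X" "integrable (Time T) (\<lambda>t. (nrm (f t))\<^sup>2)"
    and s: "\<And>n. simple_function (Time T) (s n)" "\<And>n t. t \<in> {0<..<T} \<Longrightarrow> s n t \<in> X"
    "AE t in Time T. (\<lambda>n. nrm (\<lambda>x. s n t x - f t x)) \<longlonglongrightarrow> 0"
    using assms(1) unfolding bochner_L2_iff by blast
  obtain r where g: "AE t in Time T. g t \<in> X" "integrable (Time T) (\<lambda>t. (nrm (g t))\<^sup>2)"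
    and r: "\<And>n. simple_function (Time T) (r n)" "\<And>n t. t \<in> {0<..<T} \<Longrightarrow> r n t \<in> X"
    "AE t in Time T. (\<lambda>n. nrm (\<lambda>x. r n t x - g t x)) \<longlonglongrightarrow> 0"
    using assms(2) unfolding bochner_L2_iff by blast
  define q where "q n t x = s n t x + r n t x" for n t x
  have q: "simple_function (Time T) (q n)" "t \<in> {0<..<T} \<Longrightarrow> q n t \<in> X" for n t
    using simple_function_compose2[OF s(1) r(1), of "\<lambda>u v x. u x + v x" n n] add[OF s(2) r(2)]
    by (simp_all add: q_def[abs_def])
  have X: "AE t in Time T. (\<lambda>x. f t x + g t x) \<in> X"
    using f(1) g(1) by eventually_elim (rule add)
  have lim: "AE t in Time T. (\<lambda>n. nrm (\<lambda>x. q n t x - (f t x + g t x))) \<longlonglongrightarrow> 0"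
    using f(1) g(1) s(3) r(3) AE_space
  proof eventually_elim
    case (elim t)
    then have t: "t \<in> {0<..<T}" by simp
    have lim0: "(\<lambda>n. nrm (\<lambda>x. s n t x - f t x) + nrm (\<lambda>x. r n t x - g t x)) \<longlonglongrightarrow> 0"
      using tendsto_add[OF elim(3,4)] by simp
    have "nrm (\<lambda>x. (s n t x - f t x) + (r n t x - g t x))
        \<le> nrm (\<lambda>x. s n t x - f t x) + nrm (\<lambda>x. r n t x - g t x)" for n
      by (intro triangle diff s(2) r(2) elim t)
    moreover have "(\<lambda>x. (s n t x - f t x) + (r n t x - g t x)) = (\<lambda>x. q n t x - (f t x + g t x))" for n
      by (auto simp: q_def)
    moreover have "0 \<le> nrm (\<lambda>x. q n t x - (f t x + g t x))" for n
      by (intro nonneg diff add q elim t)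
    ultimately show ?case
      by (intro tendsto_sandwich[OF _ _ tendsto_const lim0]) auto
  qed
  have "integrable (Time T) (\<lambda>t. (nrm (\<lambda>x. f t x + g t x))\<^sup>2)"
  proof (rule Bochner_Integration.integrable_bound)
    show "integrable (Time T) (\<lambda>t. 2 * (nrm (f t))\<^sup>2 + 2 * (nrm (g t))\<^sup>2)"
      using f(2) g(2) by simp
    show "(\<lambda>t. (nrm (\<lambda>x. f t x + g t x))\<^sup>2) \<in> borel_measurable (Time T)"
      by (intro borel_measurable_power borel_measurable_norm_limit[OF q X lim])
    show "AE t in Time T. norm ((nrm (\<lambda>x. f t x + g t x))\<^sup>2) \<le> norm (2 * (nrm (f t))\<^sup>2 + 2 * (nrm (g t))\<^sup>2)"
      using f(1) g(1)
    proof eventually_elim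
      case (elim t)
      have "(nrm (\<lambda>x. f t x + g t x))\<^sup>2 \<le> (nrm (f t) + nrm (g t))\<^sup>2"
        using elim by (intro power_mono triangle nonneg add)
      also have "\<dots> \<le> 2 * (nrm (f t))\<^sup>2 + 2 * (nrm (g t))\<^sup>2"
        using sum_squares_bound[of "nrm (f t)" "nrm (g t)"] by (simp add: power2_sum)
      finally show ?case by simp
    qed
  qed
  with X lim q show ?thesis
    unfolding bochner_L2_iff by blast
qed

lemma bochner_L2_tensor:
  assumes a: "continuous_on {0..T} a" and e: "e \<in> X"
  shows "(\<lambda>t x. a t * e x) \<in> bochner_L2 T X nrm"
proof -
  obtain B where B: "a \<in> borel_measurable (Time T)" "\<And>t. t \<in> {0<..<T} \<Longrightarrow> \<bar>a t\<bar> \<le> B"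
    using continuous_bounded_measurable_interval[OF a] by blast
  obtain b where b: "\<And>n. simple_function (Time T) (b n)" "\<And>t. t \<in> {0<..<T} \<Longrightarrow> (\<lambda>n. b n t) \<longlonglongrightarrow> a t"
    using borel_measurable_implies_sequence_metric[OF B(1), of 0] unfolding space_lebesgue_on by blast
  define s where "s n t x = b n t * e x" for n t x
  have s: "simple_function (Time T) (s n)" "t \<in> {0<..<T} \<Longrightarrow> s n t \<in> X" for n t
    using simple_function_compose1[OF b(1), of "\<lambda>c x. c * e x" n] scale[OF e]
    by (simp_all add: s_def[abs_def])
  have X: "AE t in Time T. (\<lambda>x. a t * e x) \<in> X"
    using scale[OF e] by simp
  have lim: "AE t in Time T. (\<lambda>n. nrm (\<lambda>x. s n t x - a t * e x)) \<longlonglongrightarrow> 0"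
  proof (rule AE_I2)
    fix t assume "t \<in> space (Time T)"
    then have "(\<lambda>n. b n t - a t) \<longlonglongrightarrow> 0"
      using b(2)[of t] by (simp add: LIM_zero)
    then have "(\<lambda>n. \<bar>b n t - a t\<bar> * nrm e) \<longlonglongrightarrow> 0"
      by (intro tendsto_mult_left_zero tendsto_rabs_zero)
    moreover have "nrm (\<lambda>x. s n t x - a t * e x) \<le> \<bar>b n t - a t\<bar> * nrm e"
      "0 \<le> nrm (\<lambda>x. s n t x - a t * e x)" for n
      using scale_le[OF e, of "b n t - a t"] nonneg[OF scale[OF e, of "b n t - a t"]]
      by (simp_all add: s_def left_diff_distrib)
    ultimately show "(\<lambda>n. nrm (\<lambda>x. s n t x - a t * e x)) \<longlonglongrightarrow> 0"
      by (intro tendsto_sandwich[OF _ _ tendsto_const \<open>(\<lambda>n. \<bar>b n t - a t\<bar> * nrm e) \<longlonglongrightarrow> 0\<close>]) auto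
  qed
  have "(\<lambda>t. nrm (\<lambda>x. a t * e x)) \<in> L2 (Time T)"
  proof (rule L2_bounded[OF finite_measure_lebesgue_on_interval])
    show "(\<lambda>t. nrm (\<lambda>x. a t * e x)) \<in> borel_measurable (Time T)"
      by (rule borel_measurable_norm_limit[OF s X lim])
    fix t assume "t \<in> space (Time T)"
    then have "\<bar>a t\<bar> * nrm e \<le> B * nrm e"
      using B(2)[of t] nonneg[OF e] by (intro mult_right_mono) auto
    with scale_le[OF e, of "a t"] nonneg[OF scale[OF e, of "a t"]]
    show "\<bar>nrm (\<lambda>x. a t * e x)\<bar> \<le> B * nrm e" by simp
  qed
  then have "integrable (Time T) (\<lambda>t. (nrm (\<lambda>x. a t * e x))\<^sup>2)" by (simp add: L2_def)
  with X lim s show ?thesis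
    unfolding bochner_L2_iff by blast
qed

end

interpretation H10: seminormed_functions H10 H1_norm
  by unfold_locales
    (auto intro: H10_add H10_scale H1_norm_triangle H10_H1 simp: H1_norm_scale H10_H1)

lemma H10_zero: "(\<lambda>x. 0) \<in> H10" and H1_norm_zero: "H1_norm (\<lambda>x. 0) = 0"
  using H10_scale[OF eigenfunction_H10, of 0] H1_norm_scale[OF H10_H1[OF eigenfunction_H10], of 0] by simp_all

lemma Hm1_bdd:
  assumes "F \<in> Hm1"
  shows "bdd_above {\<bar>F v\<bar> |v. v \<in> H10 \<and> H1_norm v \<le> 1}"
proof -
  obtain C where C: "\<And>v. v \<in> H10 \<Longrightarrow> \<bar>F v\<bar> \<le> C * H1_norm v"
    using assms unfolding Hm1_def by blast
  have "\<bar>F v\<bar> \<le> \<bar>C\<bar>" if "v \<in> H10" "H1_norm v \<le> 1" for v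
  proof -
    have "\<bar>F v\<bar> \<le> \<bar>C\<bar> * H1_norm v"
      by (rule order_trans[OF C[OF that(1)]]) (simp add: mult_right_mono)
    also have "\<dots> \<le> \<bar>C\<bar>" using that(2) by (simp add: mult_left_le)
    finally show ?thesis .
  qed
  then show ?thesis by (intro bdd_aboveI[of _ "\<bar>C\<bar>"]) auto
qed

lemma Hm1_norm_upper:
  assumes "F \<in> Hm1" "v \<in> H10" "H1_norm v \<le> 1"
  shows "\<bar>F v\<bar> \<le> Hm1_norm F"
  unfolding Hm1_norm_def using assms by (intro cSup_upper Hm1_bdd) auto

lemma Hm1_norm_nonneg: "F \<in> Hm1 \<Longrightarrow> 0 \<le> Hm1_norm F"
  using Hm1_norm_upper[OF _ H10_zero, of F] H1_norm_zero by (simp add: order_trans[OF abs_ge_zero])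

lemma Hm1_norm_least:
  assumes "\<And>v. v \<in> H10 \<Longrightarrow> H1_norm v \<le> 1 \<Longrightarrow> \<bar>F v\<bar> \<le> c"
  shows "Hm1_norm F \<le> c"
  unfolding Hm1_norm_def using assms H10_zero H1_norm_zero
  by (intro cSup_least) (auto intro!: exI[of _ "\<lambda>x. 0"])

lemma Hm1_norm_bound:
  assumes F: "F \<in> Hm1" and v: "v \<in> H10"
  shows "\<bar>F v\<bar> \<le> Hm1_norm F * H1_norm v"
proof (cases "H1_norm v = 0")
  case True
  then show ?thesis using F v by (auto simp: Hm1_def)
next
  case False
  then have pos: "0 < H1_norm v" using H1_norm_nonneg[of v] by linarith
  have "\<bar>F (\<lambda>x. inverse (H1_norm v) * v x)\<bar> \<le> Hm1_norm F"
    using pos H10_scale[OF v] H1_norm_scale[OF H10_H1[OF v], of "inverse (H1_norm v)"]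
    by (intro Hm1_norm_upper[OF F]) auto
  moreover have "F (\<lambda>x. inverse (H1_norm v) * v x) = inverse (H1_norm v) * F v"
    using F v by (simp add: Hm1_def)
  ultimately have "inverse (H1_norm v) * \<bar>F v\<bar> \<le> Hm1_norm F" using pos by (simp add: abs_mult)
  then show ?thesis using pos by (simp add: field_simps)
qed

lemma Hm1_add:
  assumes "F \<in> Hm1" "G \<in> Hm1"
  shows "(\<lambda>v. F v + G v) \<in> Hm1"
proof -
  have "\<bar>F v + G v\<bar> \<le> (Hm1_norm F + Hm1_norm G) * H1_norm v" if "v \<in> H10" for v
    using Hm1_norm_bound[OF assms(1) that] Hm1_norm_bound[OF assms(2) that]
    by (simp add: distrib_right)
  then have "\<exists>C. \<forall>v\<in>H10. \<bar>F v + G v\<bar> \<le> C * H1_norm v" by blast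
  with assms show ?thesis by (auto simp: Hm1_def algebra_simps)
qed

lemma Hm1_scale:
  assumes "F \<in> Hm1"
  shows "(\<lambda>v. c * F v) \<in> Hm1"
proof -
  have "\<bar>c * F v\<bar> \<le> (\<bar>c\<bar> * Hm1_norm F) * H1_norm v" if "v \<in> H10" for v
    using mult_left_mono[OF Hm1_norm_bound[OF assms that], of "\<bar>c\<bar>"] by (simp add: abs_mult mult.assoc)
  then have "\<exists>C. \<forall>v\<in>H10. \<bar>c * F v\<bar> \<le> C * H1_norm v" by blast
  with assms show ?thesis by (auto simp: Hm1_def algebra_simps)
qed

interpretation Hm1: seminormed_functions Hm1 Hm1_norm
proof
  fix F G :: "(real \<Rightarrow> real) \<Rightarrow> real" and c :: real
  assume F: "F \<in> Hm1"
  show "(\<lambda>v. c * F v) \<in> Hm1" "0 \<le> Hm1_norm F" by (fact Hm1_scale[OF F] Hm1_norm_nonneg[OF F])+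
  show "Hm1_norm (\<lambda>v. c * F v) \<le> \<bar>c\<bar> * Hm1_norm F"
    by (intro Hm1_norm_least) (simp add: abs_mult mult_left_mono Hm1_norm_upper[OF F])
  assume G: "G \<in> Hm1"
  show "(\<lambda>v. F v + G v) \<in> Hm1" by (rule Hm1_add[OF F G])
  show "Hm1_norm (\<lambda>v. F v + G v) \<le> Hm1_norm F + Hm1_norm G"
  proof (rule Hm1_norm_least)
    fix v assume "v \<in> H10" "H1_norm v \<le> 1"
    with Hm1_norm_upper[OF F this] Hm1_norm_upper[OF G this]
    show "\<bar>F v + G v\<bar> \<le> Hm1_norm F + Hm1_norm G" by linarith
  qed
qed

text \<open>Evaluation at a fixed \<open>v\<close> is bounded on the dual space, so it carries simple approximations of
  \<open>w\<close> to simple approximations of \<open>w(t)(v)\<close>.\<close>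

lemma bochner_Hm1_apply_integrable:
  assumes w: "w \<in> bochner_L2 T Hm1 Hm1_norm" and v: "v \<in> H10"
  shows "integrable (Time T) (\<lambda>t. w t v)"
proof -
  obtain s where X: "AE t in Time T. w t \<in> Hm1" and int: "integrable (Time T) (\<lambda>t. (Hm1_norm (w t))\<^sup>2)"
    and s: "\<And>n. simple_function (Time T) (s n)" "\<And>n t. t \<in> {0<..<T} \<Longrightarrow> s n t \<in> Hm1"
    "AE t in Time T. (\<lambda>n. Hm1_norm (\<lambda>x. s n t x - w t x)) \<longlonglongrightarrow> 0"
    using w unfolding Hm1.bochner_L2_iff by blast
  have "(\<lambda>t. w t v) \<in> borel_measurable (Time T)"
  proof (rule borel_measurable_AE_limit)
    show "(\<lambda>t. s n t v) \<in> borel_measurable (Time T)" for n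
      by (rule borel_measurable_simple_function[OF simple_function_compose1[OF s(1), of "\<lambda>F. F v"]])
    show "AE t in Time T. (\<lambda>n. s n t v) \<longlonglongrightarrow> w t v"
      using X s(3) AE_space
    proof eventually_elim
      case (elim t)
      have "(\<lambda>n. s n t v - w t v) \<longlonglongrightarrow> 0"
      proof (rule tendsto_rabs_zero_cancel, rule tendsto_sandwich[OF _ _ tendsto_const])
        show "\<forall>\<^sub>F n in sequentially. \<bar>s n t v - w t v\<bar> \<le> Hm1_norm (\<lambda>x. s n t x - w t x) * H1_norm v"
          using elim Hm1_norm_bound[OF Hm1.diff[OF s(2) elim(1)] v] by (intro always_eventually allI) auto
        show "(\<lambda>n. Hm1_norm (\<lambda>x. s n t x - w t x) * H1_norm v) \<longlonglongrightarrow> 0"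
          using elim(2) by (rule tendsto_mult_left_zero)
      qed simp
      then show ?case by (rule LIM_zero_cancel)
    qed
  qed simp
  moreover have "integrable (Time T) (\<lambda>t. (Hm1_norm (w t))\<^sup>2 * (H1_norm v)\<^sup>2)"
    using int by simp
  then have "integrable (Time T) (\<lambda>t. (w t v)\<^sup>2)"
  proof (rule Bochner_Integration.integrable_bound)
    show "AE t in Time T. norm ((w t v)\<^sup>2) \<le> norm ((Hm1_norm (w t))\<^sup>2 * (H1_norm v)\<^sup>2)"
      using X
    proof eventually_elim
      case (elim t)
      show ?case
        using power_mono[OF Hm1_norm_bound[OF elim v], of 2] by (simp add: power_mult_distrib)
    qed
  qed (use calculation in measurable)
  ultimately have "(\<lambda>t. w t v) \<in> L2 (Time T)" by (simp add: L2_def)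
  then show ?thesis by (rule L2_integrable_interval)
qed

lemma coefficient_add:
  "v \<in> L2 \<Omega> \<Longrightarrow> w \<in> L2 \<Omega> \<Longrightarrow> coefficient (\<lambda>x. v x + w x) n = coefficient v n + coefficient w n"
  by (simp add: coefficient_def distrib_right L2_integrable_mult eigenfunction_L2)

lemma coefficient_scale: "coefficient (\<lambda>x. c * v x) n = c * coefficient v n"
  by (simp add: coefficient_def mult.assoc)

lemma coefficient_Hm1: "(\<lambda>v. coefficient v n) \<in> Hm1"
proof -
  have "\<bar>coefficient v n\<bar> \<le> L2_norm \<Omega> (eigenfunction n) * H1_norm v" if "v \<in> H10" for v
  proof -
    have "\<bar>coefficient v n\<bar> \<le> L2_norm \<Omega> v * L2_norm \<Omega> (eigenfunction n)"
      unfolding coefficient_def by (intro L2_Cauchy_Schwarz H1_L2 H10_H1 that eigenfunction_L2)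
    also have "\<dots> \<le> H1_norm v * L2_norm \<Omega> (eigenfunction n)"
      by (intro mult_right_mono H1_norm_ge) simp
    finally show ?thesis by (simp add: mult.commute)
  qed
  then show ?thesis
    by (auto simp: Hm1_def coefficient_scale coefficient_add H1_L2 H10_H1)
qed

section \<open>Iterated integrals over the space-time cylinder\<close>

text \<open>Lebesgue measure on the plane is the completion of a product measure and not itself one.
  Fubini's theorem therefore applies to a Borel representative \<open>g\<close>, and the exceptional null set
  has null sections at almost every time.\<close>

lemma lebesgue_Fubini_swap:
  fixes f :: "real \<times> real \<Rightarrow> real"
  assumes f: "integrable lebesgue f"
  shows "AE t in lebesgue. integrable lebesgue (\<lambda>x. f (x, t))"
    and "integrable lebesgue (\<lambda>t. \<integral>x. f (x, t) \<partial>lebesgue)"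
    and "(\<integral>t. (\<integral>x. f (x, t) \<partial>lebesgue) \<partial>lebesgue) = (\<integral>p. f p \<partial>lebesgue)"
proof -
  obtain g where g: "g \<in> borel_measurable lborel" "AE p in lborel. f p = g p"
    using completion_ex_borel_measurable_real[of f lborel] f by blast
  have fg: "AE p in lebesgue. f p = g p" by (rule AE_completion[OF g(2)])
  have g': "g \<in> borel_measurable lebesgue" using g(1) by (rule measurable_completion)
  have "integrable lebesgue g"
    using f g' fg by (rule integrable_cong_AE_imp) 
  then have "integrable lborel g" using g(1) by (simp add: integrable_completion)
  then have int: "integrable (lborel \<Otimes>\<^sub>M lborel) (case_prod (\<lambda>x t. g (x, t)))"
    by (simp add: lborel_prod)
  obtain N where N: "N \<in> null_sets lborel" "{p. f p \<noteq> g p} \<subseteq> N"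
    using g(2) by (auto simp: eventually_ae_filter)
  have N': "N \<in> null_sets (lborel \<Otimes>\<^sub>M lborel)"
    using N(1) by (simp only: lborel_prod)
  then have "AE x in lborel. AE t in lborel. (x, t) \<notin> N"
    by (intro lborel_pair.AE_pair AE_not_in)
  moreover have "{p \<in> space (lborel \<Otimes>\<^sub>M lborel). (fst p, snd p) \<notin> N} \<in> sets (lborel \<Otimes>\<^sub>M lborel)"
    using sets.compl_sets[OF null_setsD2[OF N']] by (simp add: set_diff_eq)
  ultimately have sections: "AE t in lborel. AE x in lborel. (x, t) \<notin> N"
    using lborel_pair.AE_commute[of "\<lambda>x t. (x, t) \<notin> N"] by blast
  have inner: "AE t in lborel. integrable lebesgue (\<lambda>x. f (x, t)) \<and>
      (\<integral>x. f (x, t) \<partial>lebesgue) = (\<integral>x. g (x, t) \<partial>lborel)"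
    using sections lborel_pair.AE_integrable_snd[OF int]
  proof eventually_elim
    case (elim t)
    have gt: "(\<lambda>x. g (x, t)) \<in> borel_measurable lborel" using elim(2) by blast
    have gl: "integrable lebesgue (\<lambda>x. g (x, t))" using elim(2) gt by (simp add: integrable_completion)
    have "g (x, t) = f (x, t)" if "(x, t) \<notin> N" for x
      using N(2) that by (metis (mono_tags, lifting) mem_Collect_eq subsetD)
    then have "AE x in lborel. g (x, t) = f (x, t)"
      using elim(1) by (auto elim: eventually_mono)
    then have eq: "AE x in lebesgue. g (x, t) = f (x, t)" by (rule AE_completion)
    have ft: "(\<lambda>x. f (x, t)) \<in> borel_measurable lebesgue"
      using borel_measurable_AE[OF borel_measurable_integrable[OF gl] eq] .
    have "integrable lebesgue (\<lambda>x. f (x, t))"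
      by (rule integrable_cong_AE_imp[OF gl ft]) (use eq in eventually_elim, simp)
    moreover have "(\<integral>x. f (x, t) \<partial>lebesgue) = (\<integral>x. g (x, t) \<partial>lebesgue)"
      by (rule integral_cong_AE[OF ft borel_measurable_integrable[OF gl]]) (use eq in eventually_elim, simp)
    ultimately show ?case using integral_completion[OF gt] by simp
  qed
  then have inner': "AE t in lebesgue. integrable lebesgue (\<lambda>x. f (x, t)) \<and>
      (\<integral>x. g (x, t) \<partial>lborel) = (\<integral>x. f (x, t) \<partial>lebesgue)"
    by (intro AE_completion) (auto elim: eventually_mono)
  then show "AE t in lebesgue. integrable lebesgue (\<lambda>x. f (x, t))"
    by (rule eventually_mono) simp
  have outer: "integrable lborel (\<lambda>t. \<integral>x. g (x, t) \<partial>lborel)"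
    using lborel_pair.integrable_snd[OF int] by simp
  then have outer': "integrable lebesgue (\<lambda>t. \<integral>x. g (x, t) \<partial>lborel)"
    by (simp add: integrable_completion)
  have eq: "AE t in lebesgue. (\<integral>x. g (x, t) \<partial>lborel) = (\<integral>x. f (x, t) \<partial>lebesgue)"
    using inner' by (rule eventually_mono) simp
  have meas: "(\<lambda>t. \<integral>x. f (x, t) \<partial>lebesgue) \<in> borel_measurable lebesgue"
    using borel_measurable_AE[OF borel_measurable_integrable[OF outer'] eq] .
  show "integrable lebesgue (\<lambda>t. \<integral>x. f (x, t) \<partial>lebesgue)"
    by (rule integrable_cong_AE_imp[OF outer' meas]) (use eq in eventually_elim, simp)
  have "(\<integral>t. (\<integral>x. f (x, t) \<partial>lebesgue) \<partial>lebesgue) = (\<integral>t. (\<integral>x. g (x, t) \<partial>lborel) \<partial>lebesgue)"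
    by (rule integral_cong_AE[OF meas borel_measurable_integrable[OF outer']]) (use eq in eventually_elim, simp)
  also have "\<dots> = (\<integral>t. (\<integral>x. g (x, t) \<partial>lborel) \<partial>lborel)"
    using outer by (intro integral_completion) blast
  also have "\<dots> = (\<integral>p. g p \<partial>lborel)"
    using lborel_pair.integral_snd[OF int] by (simp add: lborel_prod)
  also have "\<dots> = (\<integral>p. g p \<partial>lebesgue)"
    using integral_completion[OF g(1)] by simp
  also have "\<dots> = (\<integral>p. f p \<partial>lebesgue)"
    using f g' fg by (intro integral_cong_AE) (auto elim: eventually_mono)
  finally show "(\<integral>t. (\<integral>x. f (x, t) \<partial>lebesgue) \<partial>lebesgue) = (\<integral>p. f p \<partial>lebesgue)" .
qed

lemma Q_sets: "{0<..<1::real} \<times> {0<..<T::real} \<in> sets lebesgue"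
  by (intro sets_completionI_sets) (simp add: borel_open open_Times)

lemma Q_Fubini:
  fixes g :: "real \<times> real \<Rightarrow> real"
  assumes g: "integrable (Q T) g"
  shows "AE t in Time T. integrable \<Omega> (\<lambda>x. g (x, t))"
    and "integrable (Time T) (\<lambda>t. \<integral>x. g (x, t) \<partial>\<Omega>)"
    and "(\<integral>t. (\<integral>x. g (x, t) \<partial>\<Omega>) \<partial>(Time T)) = (\<integral>p. g p \<partial>(Q T))"
proof -
  define f where "f p = (if p \<in> {0<..<1::real} \<times> {0<..<T} then g p else 0)" for p
  have f: "integrable lebesgue f"
    using iffD2[OF Lebesgue_Measure.integrable_restrict_UNIV[OF Q_sets[of T], of g] g] by (simp only: f_def[abs_def])
  have slice: "(\<lambda>x. f (x, t)) = (\<lambda>x. if x \<in> {0<..<1} then g (x, t) else 0)" if "t \<in> {0<..<T}" for t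
    using that by (auto simp: f_def)
  have inner: "(\<integral>x. f (x, t) \<partial>lebesgue) = (if t \<in> {0<..<T} then \<integral>x. g (x, t) \<partial>\<Omega> else 0)" for t
  proof (cases "t \<in> {0<..<T}")
    case True
    have "(\<integral>x. f (x, t) \<partial>lebesgue) = (\<integral>x. g (x, t) \<partial>\<Omega>)"
      unfolding slice[OF True] by (rule Lebesgue_Measure.integral_restrict_UNIV) simp
    with True show ?thesis by simp
  next
    case False
    then have "(\<lambda>x. f (x, t)) = (\<lambda>x. 0)" by (auto simp: f_def)
    then show ?thesis
      by (simp only: if_not_P[OF False] Bochner_Integration.integral_zero)
  qed
  show "AE t in Time T. integrable \<Omega> (\<lambda>x. g (x, t))"
    unfolding AE_restrict_space_iff[of "{0<..<T}" lebesgue, simplified]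
    using lebesgue_Fubini_swap(1)[OF f]
  proof eventually_elim
    case (elim t)
    show ?case
    proof
      assume t: "0 < t \<and> t < T"
      have "integrable lebesgue (\<lambda>x. if x \<in> {0<..<1} then g (x, t) else 0)"
        using elim slice[of t] t by (simp only: greaterThanLessThan_iff)
      then show "integrable \<Omega> (\<lambda>x. g (x, t))"
        by (rule iffD1[OF Lebesgue_Measure.integrable_restrict_UNIV, rotated]) simp
    qed
  qed
  have "integrable lebesgue (\<lambda>t. if t \<in> {0<..<T} then \<integral>x. g (x, t) \<partial>\<Omega> else 0)"
    using lebesgue_Fubini_swap(2)[OF f] by (simp only: inner)
  then show "integrable (Time T) (\<lambda>t. \<integral>x. g (x, t) \<partial>\<Omega>)"
    by (rule iffD1[OF Lebesgue_Measure.integrable_restrict_UNIV, rotated]) simp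
  have "(\<integral>t. (\<integral>x. g (x, t) \<partial>\<Omega>) \<partial>(Time T)) = (\<integral>t. (if t \<in> {0<..<T} then \<integral>x. g (x, t) \<partial>\<Omega> else 0) \<partial>lebesgue)"
    by (rule Lebesgue_Measure.integral_restrict_UNIV[symmetric]) simp
  also have "\<dots> = (\<integral>p. f p \<partial>lebesgue)"
    using lebesgue_Fubini_swap(3)[OF f] by (simp only: inner)
  also have "\<dots> = (\<integral>p. g p \<partial>(Q T))"
    unfolding f_def by (rule Lebesgue_Measure.integral_restrict_UNIV[OF Q_sets])
  finally show "(\<integral>t. (\<integral>x. g (x, t) \<partial>\<Omega>) \<partial>(Time T)) = (\<integral>p. g p \<partial>(Q T))" .
qed

lemma Q_finite_measure: "finite_measure (Q T)"
proof (rule finite_measure_lebesgue_on)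
  have "bounded ({0<..<1::real} \<times> {0<..<T})"
    by (intro bounded_Times) auto
  then show "{0<..<1::real} \<times> {0<..<T} \<in> lmeasurable"
    using Q_sets by (rule bounded_set_imp_lmeasurable)
qed

lemma continuous_Q_bounded_measurable:
  fixes h :: "real \<times> real \<Rightarrow> real"
  assumes "continuous_on UNIV h"
  obtains B where "h \<in> borel_measurable (Q T)" "\<And>p. p \<in> {0..1} \<times> {0..T} \<Longrightarrow> \<bar>h p\<bar> \<le> B"
proof -
  have "compact (h ` ({0..1} \<times> {0..T}))"
    using assms by (intro compact_continuous_image compact_Times) (auto intro: continuous_on_subset)
  then obtain B where "\<forall>y\<in>h ` ({0..1} \<times> {0..T}). \<bar>y\<bar> \<le> B"
    using compact_imp_bounded bounded_real by metis
  moreover have "h \<in> borel_measurable (Q T)"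
    using Q_sets by (intro continuous_imp_measurable_on_sets_lebesgue continuous_on_subset[OF assms]) auto
  ultimately show thesis using that by blast
qed

lemma continuous_L2_Q:
  fixes h :: "real \<times> real \<Rightarrow> real"
  assumes "continuous_on UNIV h"
  shows "h \<in> L2 (Q T)"
proof -
  obtain B where "h \<in> borel_measurable (Q T)" "\<And>p. p \<in> {0..1} \<times> {0..T} \<Longrightarrow> \<bar>h p\<bar> \<le> B"
    using continuous_Q_bounded_measurable[OF assms] by blast
  then show ?thesis by (intro L2_bounded[OF Q_finite_measure, of h T B]) auto
qed

lemma L2_Q_integrable:
  assumes "u \<in> L2 (Q T)"
  shows "integrable (Q T) u"
  using L2_integrable_mult[OF assms continuous_L2_Q[of "\<lambda>p. 1"]] by simp

lemma L2_Q_sections: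
  assumes "u \<in> L2 (Q T)"
  shows "AE t in Time T. (\<lambda>x. u (x, t)) \<in> L2 \<Omega>"
proof -
  have "integrable (Q T) (\<lambda>p. (u p)\<^sup>2)" using assms by (simp add: L2_def)
  from Q_Fubini(1)[OF this] Q_Fubini(1)[OF L2_Q_integrable[OF assms]] show ?thesis
    by eventually_elim (auto simp: L2_def)
qed


section \<open>Weak solutions tested with eigenfunctions\<close>

lemma continuous_L2_pairing:
  assumes y: "continuous_into_L2 T y" and v: "v \<in> L2 \<Omega>"
  shows "continuous_on {0..T} (\<lambda>t. \<integral>x. y t x * v x \<partial>\<Omega>)"
  unfolding continuous_on_def
proof
  fix t assume t: "t \<in> {0..T}"
  have yt: "y s \<in> L2 \<Omega>" if "s \<in> {0..T}" for s using y that by (auto simp: continuous_into_L2_def)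
  have "((\<lambda>s. (\<integral>x. y s x * v x \<partial>\<Omega>) - (\<integral>x. y t x * v x \<partial>\<Omega>)) \<longlongrightarrow> 0) (at t within {0..T})"
  proof (rule tendsto_rabs_zero_cancel, rule tendsto_sandwich[OF _ _ tendsto_const])
    show "((\<lambda>s. L2_norm \<Omega> (\<lambda>x. y s x - y t x) * L2_norm \<Omega> v) \<longlongrightarrow> 0) (at t within {0..T})"
      using y t by (intro tendsto_mult_left_zero) (auto simp: continuous_into_L2_def)
    show "\<forall>\<^sub>F s in at t within {0..T}. \<bar>(\<integral>x. y s x * v x \<partial>\<Omega>) - (\<integral>x. y t x * v x \<partial>\<Omega>)\<bar>
        \<le> L2_norm \<Omega> (\<lambda>x. y s x - y t x) * L2_norm \<Omega> v"
      unfolding eventually_at_filter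
    proof (intro always_eventually allI impI)
      fix s assume s: "s \<in> {0..T}"
      have "(\<integral>x. y s x * v x \<partial>\<Omega>) - (\<integral>x. y t x * v x \<partial>\<Omega>) = (\<integral>x. (y s x - y t x) * v x \<partial>\<Omega>)"
        using yt[OF s] yt[OF t] v by (simp add: left_diff_distrib L2_integrable_mult)
      then show "\<bar>(\<integral>x. y s x * v x \<partial>\<Omega>) - (\<integral>x. y t x * v x \<partial>\<Omega>)\<bar>
        \<le> L2_norm \<Omega> (\<lambda>x. y s x - y t x) * L2_norm \<Omega> v"
        using L2_Cauchy_Schwarz[OF L2_diff[OF yt[OF s] yt[OF t]] v] by simp
    qed
  qed simp
  then show "((\<lambda>t. \<integral>x. y t x * v x \<partial>\<Omega>) \<longlongrightarrow> (\<integral>x. y t x * v x \<partial>\<Omega>)) (at t within {0..T})"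
    by (rule LIM_zero_cancel)
qed

lemma integral_weak_deriv_add_scale:
  assumes "p \<in> H1" "q \<in> H1" "v \<in> H1"
  shows "(\<integral>x. weak_deriv (\<lambda>x. p x + c * q x) x * weak_deriv v x \<partial>\<Omega>)
    = (\<integral>x. weak_deriv p x * weak_deriv v x \<partial>\<Omega>) + c * (\<integral>x. weak_deriv q x * weak_deriv v x \<partial>\<Omega>)"
proof -
  note L2 = H1_L2(2)[OF assms(1)] H1_L2(2)[OF assms(2)] H1_L2(2)[OF assms(3)]
    H1_L2(2)[OF H1_add[OF assms(1) H1_scale[OF assms(2), of c]]]
  note meas = L2[unfolded L2_def, simplified, THEN conjunct1]
  have "AE x in \<Omega>. weak_deriv (\<lambda>x. p x + c * q x) x * weak_deriv v x
      = (weak_deriv p x + c * weak_deriv q x) * weak_deriv v x"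
    using weak_deriv_add_AE[OF assms(1) H1_scale[OF assms(2), of c]] weak_deriv_scale_AE[OF assms(2), of c]
    by eventually_elim simp
  then have "(\<integral>x. weak_deriv (\<lambda>x. p x + c * q x) x * weak_deriv v x \<partial>\<Omega>)
      = (\<integral>x. (weak_deriv p x + c * weak_deriv q x) * weak_deriv v x \<partial>\<Omega>)"
    using meas by (intro integral_cong_AE borel_measurable_times borel_measurable_add borel_measurable_const)
  also have "\<dots> = (\<integral>x. weak_deriv p x * weak_deriv v x + c * (weak_deriv q x * weak_deriv v x) \<partial>\<Omega>)"
    by (simp add: algebra_simps)
  also have "\<dots> = (\<integral>x. weak_deriv p x * weak_deriv v x \<partial>\<Omega>) + c * (\<integral>x. weak_deriv q x * weak_deriv v x \<partial>\<Omega>)"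
    using L2 by (simp add: L2_integrable_mult)
  finally show ?thesis .
qed

text \<open>A separated state \<open>a(t) e\<^sub>n(x)\<close> solves the heat equation with control
  \<open>(a' + \<lambda>\<^sub>n a)(t) e\<^sub>n(x)\<close>; by linearity it can be added to any solution.\<close>

lemma weak_solution_add_separated:
  assumes T: "T > 0" and u: "u \<in> L2 (Q T)" and sol: "weak_solution T y0 u y"
    and a: "\<And>t. (a has_real_derivative a' t) (at t)" "continuous_on UNIV a'" "a 0 = 0"
  shows "weak_solution T y0
    (\<lambda>p. u p + (a' (snd p) + eigenvalue n * a (snd p)) * eigenfunction n (fst p))
    (\<lambda>t x. y t x + a t * eigenfunction n x)"
proof -
  let ?e = "eigenfunction n"
  obtain w where y: "y \<in> bochner_L2 T H10 H1_norm" "continuous_into_L2 T y"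
    and w: "w \<in> bochner_L2 T Hm1 Hm1_norm" "is_time_deriv T y w"
    and eq: "AE t in Time T. \<forall>v\<in>H10.
           w t v + (\<integral>x. weak_deriv (y t) x * weak_deriv v x \<partial>\<Omega>) = (\<integral>x. u (x, t) * v x \<partial>\<Omega>)"
    and init: "AE x in \<Omega>. y 0 x = y0 x"
    using sol unfolding weak_solution_def by blast
  have ca: "continuous_on S a" for S
    using a(1) by (metis DERIV_continuous continuous_at_imp_continuous_on)
  have ca': "continuous_on S a'" for S
    using a(2) continuous_on_subset by blast
  have yt: "y t \<in> L2 \<Omega>" if "t \<in> {0..T}" for t using y(2) that by (auto simp: continuous_into_L2_def)
  define w' where "w' t v = w t v + a' t * coefficient v n" for t v
  have "continuous_into_L2 T (\<lambda>t x. y t x + a t * ?e x)"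
    unfolding continuous_into_L2_def
  proof (intro ballI conjI)
    fix t assume t: "t \<in> {0..T}"
    show "(\<lambda>x. y t x + a t * ?e x) \<in> L2 \<Omega>"
      by (intro L2_add L2_scale yt t eigenfunction_L2)
    have lim: "((\<lambda>s. L2_norm \<Omega> (\<lambda>x. y s x - y t x) + \<bar>a s - a t\<bar> * L2_norm \<Omega> ?e) \<longlongrightarrow> 0 + 0) (at t within {0..T})"
    proof (rule tendsto_add)
      show "((\<lambda>s. L2_norm \<Omega> (\<lambda>x. y s x - y t x)) \<longlongrightarrow> 0) (at t within {0..T})"
        using y(2) t by (auto simp: continuous_into_L2_def)
      have "(a \<longlongrightarrow> a t) (at t within {0..T})"
        using ca[of "{0..T}"] t by (simp add: continuous_on_def)
      then show "((\<lambda>s. \<bar>a s - a t\<bar> * L2_norm \<Omega> ?e) \<longlongrightarrow> 0) (at t within {0..T})"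
        by (intro tendsto_mult_left_zero tendsto_rabs_zero LIM_zero)
    qed
    show "((\<lambda>s. L2_norm \<Omega> (\<lambda>x. y s x + a s * ?e x - (y t x + a t * ?e x))) \<longlongrightarrow> 0) (at t within {0..T})"
    proof (rule tendsto_sandwich[OF _ _ tendsto_const lim[simplified]])
      show "\<forall>\<^sub>F s in at t within {0..T}. L2_norm \<Omega> (\<lambda>x. y s x + a s * ?e x - (y t x + a t * ?e x))
          \<le> L2_norm \<Omega> (\<lambda>x. y s x - y t x) + \<bar>a s - a t\<bar> * L2_norm \<Omega> ?e"
        unfolding eventually_at_filter
      proof (intro always_eventually allI impI)
        fix s assume s: "s \<in> {0..T}"
        have "L2_norm \<Omega> (\<lambda>x. (y s x - y t x) + (a s - a t) * ?e x)
            \<le> L2_norm \<Omega> (\<lambda>x. y s x - y t x) + L2_norm \<Omega> (\<lambda>x. (a s - a t) * ?e x)"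
          by (intro L2_norm_triangle L2_diff L2_scale yt s t eigenfunction_L2)
        then show "L2_norm \<Omega> (\<lambda>x. y s x + a s * ?e x - (y t x + a t * ?e x))
          \<le> L2_norm \<Omega> (\<lambda>x. y s x - y t x) + \<bar>a s - a t\<bar> * L2_norm \<Omega> ?e"
          unfolding L2_norm_scale by (simp add: algebra_simps)
      qed
    qed simp
  qed
  moreover have "(\<lambda>t x. y t x + a t * ?e x) \<in> bochner_L2 T H10 H1_norm"
    by (intro H10.bochner_L2_add y H10.bochner_L2_tensor ca eigenfunction_H10)
  moreover have "w' \<in> bochner_L2 T Hm1 Hm1_norm"
    unfolding w'_def by (intro Hm1.bochner_L2_add w Hm1.bochner_L2_tensor ca' coefficient_Hm1)
  moreover have "is_time_deriv T (\<lambda>t x. y t x + a t * ?e x) w'"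
    unfolding is_time_deriv_def
  proof (intro ballI)
    fix \<phi> v assume \<phi>: "\<phi> \<in> test_functions 0 T" and v: "v \<in> H10"
    note sm = test_function_smooth[OF \<phi>]
    have vL2: "v \<in> L2 \<Omega>" using v by (intro H1_L2 H10_H1)
    have int: "integrable (Time T) (\<lambda>t. deriv \<phi> t * (\<integral>x. y t x * v x \<partial>\<Omega>))"
      "integrable (Time T) (\<lambda>t. coefficient v n * (a t * deriv \<phi> t))"
      "integrable (Time T) (\<lambda>t. coefficient v n * (a' t * \<phi> t))"
      by (intro continuous_integrable continuous_intros continuous_L2_pairing y vL2 ca ca'
          smooth_continuous smooth_deriv sm)+
    have intw: "integrable (Time T) (\<lambda>t. \<phi> t * w t v)"
      by (rule integrable_mult_continuous[OF bochner_Hm1_apply_integrable[OF w(1) v] smooth_continuous[OF sm]])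
    have "(\<integral>t. deriv \<phi> t * (\<integral>x. (y t x + a t * ?e x) * v x \<partial>\<Omega>) \<partial>(Time T))
        = (\<integral>t. deriv \<phi> t * (\<integral>x. y t x * v x \<partial>\<Omega>) + coefficient v n * (a t * deriv \<phi> t) \<partial>(Time T))"
    proof (rule Bochner_Integration.integral_cong[OF refl])
      fix t assume "t \<in> space (Time T)"
      then have t: "t \<in> {0..T}" by auto
      have "(\<integral>x. (y t x + a t * ?e x) * v x \<partial>\<Omega>) = (\<integral>x. y t x * v x + a t * (v x * ?e x) \<partial>\<Omega>)"
        by (simp add: algebra_simps)
      also have "\<dots> = (\<integral>x. y t x * v x \<partial>\<Omega>) + a t * coefficient v n"
        unfolding coefficient_def using yt[OF t] vL2 eigenfunction_L2
        by (subst Bochner_Integration.integral_add) (auto simp: L2_integrable_mult)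
      finally show "deriv \<phi> t * (\<integral>x. (y t x + a t * ?e x) * v x \<partial>\<Omega>)
        = deriv \<phi> t * (\<integral>x. y t x * v x \<partial>\<Omega>) + coefficient v n * (a t * deriv \<phi> t)"
        by (simp add: algebra_simps)
    qed
    also have "\<dots> = - (\<integral>t. \<phi> t * w t v \<partial>(Time T)) + coefficient v n * (\<integral>t. a t * deriv \<phi> t \<partial>(Time T))"
      using w(2) \<phi> v int by (simp add: is_time_deriv_def)
    also have "(\<integral>t. a t * deriv \<phi> t \<partial>(Time T)) = - (\<integral>t. a' t * \<phi> t \<partial>(Time T))"
      by (rule integral_by_parts_test_function[OF T \<phi> a(1,2)])
    also have "- (\<integral>t. \<phi> t * w t v \<partial>(Time T)) + coefficient v n * - (\<integral>t. a' t * \<phi> t \<partial>(Time T))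
        = - (\<integral>t. \<phi> t * w t v + coefficient v n * (a' t * \<phi> t) \<partial>(Time T))"
      using intw int by simp
    also have "(\<integral>t. \<phi> t * w t v + coefficient v n * (a' t * \<phi> t) \<partial>(Time T)) = (\<integral>t. \<phi> t * w' t v \<partial>(Time T))"
      by (simp add: w'_def algebra_simps)
    finally show "(\<integral>t. deriv \<phi> t * (\<integral>x. (y t x + a t * ?e x) * v x \<partial>\<Omega>) \<partial>(Time T))
        = - (\<integral>t. \<phi> t * w' t v \<partial>(Time T))" .
  qed
  moreover have "AE t in Time T. \<forall>v\<in>H10. w' t v
      + (\<integral>x. weak_deriv (\<lambda>x. y t x + a t * ?e x) x * weak_deriv v x \<partial>\<Omega>)
      = (\<integral>x. (u (x, t) + (a' (snd (x, t)) + eigenvalue n * a (snd (x, t))) * ?e (fst (x, t))) * v x \<partial>\<Omega>)"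
  proof -
    have "AE t in Time T. y t \<in> H10" using y(1) by (simp add: H10.bochner_L2_iff)
    with eq L2_Q_sections[OF u] show ?thesis
    proof eventually_elim
      case (elim t)
      show ?case
      proof
        fix v assume v: "v \<in> H10"
        have vL2: "v \<in> L2 \<Omega>" using v by (intro H1_L2 H10_H1)
        have "(\<integral>x. (u (x, t) + (a' t + eigenvalue n * a t) * ?e x) * v x \<partial>\<Omega>)
            = (\<integral>x. u (x, t) * v x + (a' t + eigenvalue n * a t) * (v x * ?e x) \<partial>\<Omega>)"
          by (simp add: algebra_simps)
        also have "\<dots> = (\<integral>x. u (x, t) * v x \<partial>\<Omega>) + (a' t + eigenvalue n * a t) * coefficient v n"
          unfolding coefficient_def using elim(2) vL2 eigenfunction_L2
          by (subst Bochner_Integration.integral_add) (auto simp: L2_integrable_mult)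
        finally show "w' t v
          + (\<integral>x. weak_deriv (\<lambda>x. y t x + a t * ?e x) x * weak_deriv v x \<partial>\<Omega>)
          = (\<integral>x. (u (x, t) + (a' (snd (x, t)) + eigenvalue n * a (snd (x, t))) * ?e (fst (x, t))) * v x \<partial>\<Omega>)"
          using elim(1)[rule_format, OF v] eigenfunction_weak_eigenvalue[OF v, of n]
            integral_weak_deriv_add_scale[OF H10_H1[OF elim(3)] H10_H1[OF eigenfunction_H10] H10_H1[OF v], of "a t" n]
          by (simp add: w'_def distrib_right distrib_left)
      qed
    qed
  qed
  moreover have "AE x in \<Omega>. y 0 x + a 0 * ?e x = y0 x"
    using init a(3) by simp
  ultimately show ?thesis
    unfolding weak_solution_def by blast
qed

text \<open>Testing with \<open>e\<^sub>n\<close> turns the heat equation into a linear ordinary differential equation for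
  the coefficient, which the integrating factor solves.\<close>

lemma weak_solution_coefficient:
  assumes T: "T > 0" and u: "u \<in> L2 (Q T)" and y0: "y0 \<in> L2 \<Omega>" and sol: "weak_solution T y0 u y"
  shows "exp (eigenvalue n * T) * coefficient (y T) n = coefficient y0 n
    + (\<integral>p. u p * (exp (eigenvalue n * snd p) * eigenfunction n (fst p)) \<partial>(Q T))"
proof -
  let ?e = "eigenfunction n" and ?l = "eigenvalue n"
  obtain w where y: "y \<in> bochner_L2 T H10 H1_norm" "continuous_into_L2 T y"
    and w: "w \<in> bochner_L2 T Hm1 Hm1_norm" "is_time_deriv T y w"
    and eq: "AE t in Time T. \<forall>v\<in>H10.
           w t v + (\<integral>x. weak_deriv (y t) x * weak_deriv v x \<partial>\<Omega>) = (\<integral>x. u (x, t) * v x \<partial>\<Omega>)"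
    and init: "AE x in \<Omega>. y 0 x = y0 x"
    using sol unfolding weak_solution_def by blast
  define G where "G t = exp (?l * t) * coefficient (y t) n" for t
  define H where "H t = ?l * exp (?l * t) * coefficient (y t) n + exp (?l * t) * w t ?e" for t
  have cont: "continuous_on {0..T} (\<lambda>t. coefficient (y t) n)"
    unfolding coefficient_def by (rule continuous_L2_pairing[OF y(2) eigenfunction_L2])
  have intw: "integrable (Time T) (\<lambda>t. w t ?e)"
    by (rule bochner_Hm1_apply_integrable[OF w(1) eigenfunction_H10])
  have intH: "integrable (Time T) H"
    unfolding H_def
    by (intro Bochner_Integration.integrable_add integrable_mult_continuous[OF intw] continuous_integrable
        continuous_intros cont)
  \<comment> \<open>The integrating factor is smooth, so multiplying a test function by it gives a test function;
    this is how the product rule for \<open>G\<close> holds in the sense of distributions.\<close>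
  have "G T - G 0 = (\<integral>t. H t \<partial>(Time T))"
  proof (rule fundamental_theorem_distributional[OF T _ intH])
    show "continuous_on {0..T} G"
      unfolding G_def by (intro continuous_intros cont)
    fix \<phi> assume \<phi>: "\<phi> \<in> test_functions 0 T"
    note sm = test_function_smooth[OF \<phi>]
    define \<psi> where "\<psi> t = exp (?l * t) * \<phi> t" for t
    have \<psi>: "\<psi> \<in> test_functions 0 T"
      unfolding \<psi>_def by (rule test_function_mult_smooth[OF \<phi> smooth_exp])
    have deriv: "deriv \<psi> t = ?l * exp (?l * t) * \<phi> t + exp (?l * t) * deriv \<phi> t" for t
      unfolding \<psi>_def
      by (rule DERIV_imp_deriv) (auto intro!: derivative_eq_intros smooth_has_deriv[OF sm])
    have i1: "integrable (Time T) (\<lambda>t. deriv \<psi> t * coefficient (y t) n)"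
      "integrable (Time T) (\<lambda>t. \<phi> t * (?l * exp (?l * t) * coefficient (y t) n))"
      by (intro continuous_integrable continuous_intros cont smooth_continuous smooth_deriv
          test_function_smooth[OF \<psi>] sm)+
    have i2: "integrable (Time T) (\<lambda>t. \<psi> t * w t ?e)"
      by (intro integrable_mult_continuous[OF intw] smooth_continuous test_function_smooth[OF \<psi>])
    have "(\<integral>t. deriv \<phi> t * G t \<partial>(Time T))
      = (\<integral>t. deriv \<psi> t * coefficient (y t) n - \<phi> t * (?l * exp (?l * t) * coefficient (y t) n) \<partial>(Time T))"
      by (simp add: deriv G_def algebra_simps)
    also have "\<dots> = (\<integral>t. deriv \<psi> t * coefficient (y t) n \<partial>(Time T))
        - (\<integral>t. \<phi> t * (?l * exp (?l * t) * coefficient (y t) n) \<partial>(Time T))"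
      using i1 by (rule Bochner_Integration.integral_diff)
    also have "(\<integral>t. deriv \<psi> t * coefficient (y t) n \<partial>(Time T)) = - (\<integral>t. \<psi> t * w t ?e \<partial>(Time T))"
      using w(2) \<psi> eigenfunction_H10 by (simp add: is_time_deriv_def coefficient_def)
    also have "- (\<integral>t. \<psi> t * w t ?e \<partial>(Time T)) - (\<integral>t. \<phi> t * (?l * exp (?l * t) * coefficient (y t) n) \<partial>(Time T))
       = - (\<integral>t. \<phi> t * (?l * exp (?l * t) * coefficient (y t) n) + \<psi> t * w t ?e \<partial>(Time T))"
      using i1(2) i2 by (subst Bochner_Integration.integral_add) auto
    also have "\<dots> = - (\<integral>t. \<phi> t * H t \<partial>(Time T))"
      by (simp add: H_def \<psi>_def algebra_simps)
    finally show "(\<integral>t. deriv \<phi> t * G t \<partial>(Time T)) = - (\<integral>t. \<phi> t * H t \<partial>(Time T))" .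
  qed
  moreover have "(\<integral>t. H t \<partial>(Time T)) = (\<integral>p. u p * (exp (?l * snd p) * ?e (fst p)) \<partial>(Q T))"
  proof -
    have int: "integrable (Q T) (\<lambda>p. u p * (exp (?l * snd p) * ?e (fst p)))"
      by (intro L2_integrable_mult u continuous_L2_Q continuous_intros
          continuous_on_compose2[OF smooth_continuous[OF smooth_eigenfunction, of UNIV]]) auto
    note F = Q_Fubini[OF int]
    have "AE t in Time T. y t \<in> H10" using y(1) by (simp add: H10.bochner_L2_iff)
    with eq have "AE t in Time T. H t = (\<integral>x. u (x, t) * (exp (?l * snd (x, t)) * ?e (fst (x, t))) \<partial>\<Omega>)"
    proof eventually_elim
      case (elim t)
      have "(\<integral>x. weak_deriv (y t) x * weak_deriv ?e x \<partial>\<Omega>) = ?l * coefficient (y t) n"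
        using eigenfunction_weak_eigenvalue[OF elim(2), of n] by (simp add: mult.commute)
      with elim(1)[rule_format, OF eigenfunction_H10, of n]
      have "(\<integral>x. u (x, t) * ?e x \<partial>\<Omega>) = w t ?e + ?l * coefficient (y t) n" by simp
      then have "exp (?l * t) * (\<integral>x. u (x, t) * ?e x \<partial>\<Omega>) = H t"
        by (simp add: H_def algebra_simps)
      then show ?case
        by (simp add: mult.left_commute[of _ "exp _"])
    qed
    then have "(\<integral>t. H t \<partial>(Time T)) = (\<integral>t. (\<integral>x. u (x, t) * (exp (?l * snd (x, t)) * ?e (fst (x, t))) \<partial>\<Omega>) \<partial>(Time T))"
      using intH F(2) by (intro integral_cong_AE) auto
    then show ?thesis using F(3) by simp
  qed
  moreover have "coefficient (y 0) n = coefficient y0 n"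
  proof -
    have "y 0 \<in> L2 \<Omega>" using y(2) T by (auto simp: continuous_into_L2_def)
    then show ?thesis
      unfolding coefficient_def using init y0 eigenfunction_L2[of n]
      by (intro integral_cong_AE) (auto simp: L2_def intro!: borel_measurable_times elim: eventually_mono)
  qed
  ultimately show ?thesis by (simp add: G_def)
qed

section \<open>Density of finite sine sums\<close>

text \<open>The sums are built up one mode at a time, so that their properties reduce by induction to
  those of a single \<open>b(t) e\<^sub>n(x)\<close>; a mode may occur repeatedly.\<close>

inductive_set sine_sums :: "(real \<times> real \<Rightarrow> real) set" where
  zero: "(\<lambda>p. 0) \<in> sine_sums"
| add_mode: "f \<in> sine_sums \<Longrightarrow> continuous_on UNIV b \<Longrightarrow>
    (\<lambda>p. f p + b (snd p) * eigenfunction n (fst p)) \<in> sine_sums"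

lemma continuous_eigenfunction [continuous_intros]:
  "continuous_on S f \<Longrightarrow> continuous_on S (\<lambda>p. eigenfunction n (f p))"
  by (rule continuous_on_compose2[OF smooth_continuous[OF smooth_eigenfunction, of UNIV]]) auto

lemma continuous_snd_compose:
  "continuous_on UNIV b \<Longrightarrow> continuous_on S (\<lambda>p. b (snd p))"
  by (rule continuous_on_compose2[of UNIV b]) (auto intro: continuous_intros)

lemma sine_sums_continuous: "f \<in> sine_sums \<Longrightarrow> continuous_on UNIV f"
  by (induction rule: sine_sums.induct) (intro continuous_intros continuous_snd_compose; simp)+

lemma sine_sums_L2: "f \<in> sine_sums \<Longrightarrow> f \<in> L2 (Q T)"
  by (rule continuous_L2_Q[OF sine_sums_continuous])

lemma sine_sums_mode: "continuous_on UNIV b \<Longrightarrow> (\<lambda>p. b (snd p) * eigenfunction n (fst p)) \<in> sine_sums"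
  using sine_sums.add_mode[OF sine_sums.zero] by simp

lemma sine_sums_add: "g \<in> sine_sums \<Longrightarrow> f \<in> sine_sums \<Longrightarrow> (\<lambda>p. f p + g p) \<in> sine_sums"
proof (induction arbitrary: f rule: sine_sums.induct)
  case (add_mode g b n)
  have "(\<lambda>p. (f p + g p) + b (snd p) * eigenfunction n (fst p)) \<in> sine_sums"
    using add_mode by (intro sine_sums.add_mode)
  then show ?case by (simp add: add.assoc)
qed simp

lemma sine_sums_mult_time:
  assumes "f \<in> sine_sums" "continuous_on UNIV c"
  shows "(\<lambda>p. c (snd p) * f p) \<in> sine_sums"
  using assms(1)
proof (induction rule: sine_sums.induct)
  case (add_mode f b n)
  have "(\<lambda>p. c (snd p) * f p + (c (snd p) * b (snd p)) * eigenfunction n (fst p)) \<in> sine_sums"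
    using add_mode assms(2)
      sine_sums.add_mode[OF add_mode.IH, of "\<lambda>t. c t * b t" n] by (auto intro: continuous_intros)
  then show ?case by (simp add: algebra_simps)
qed (simp add: sine_sums.zero)

lemma cos_mult_eigenfunction:
  "cos (pi * x) * eigenfunction (Suc n) x = eigenfunction (Suc (Suc n)) x / 2 + eigenfunction n x / 2"
proof -
  have "eigenfunction (Suc (Suc n)) x = sqrt 2 * sin (real (Suc n) * pi * x + pi * x)"
    "eigenfunction n x = sqrt 2 * sin (real (Suc n) * pi * x - pi * x)"
    by (simp_all add: eigenfunction_def algebra_simps)
  then show ?thesis
    unfolding sin_add sin_diff eigenfunction_def[of "Suc n"] right_diff_distrib distrib_left
    by (simp add: diff_divide_distrib add_divide_distrib mult_ac)
qed

lemma sine_sums_mult_cos: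
  assumes "f \<in> sine_sums"
  shows "(\<lambda>p. cos (pi * fst p) * f p) \<in> sine_sums"
  using assms
proof (induction rule: sine_sums.induct)
  case (add_mode f b n)
  have b: "continuous_on UNIV (\<lambda>t. b t / 2)" using add_mode by (intro continuous_intros) auto
  have "(\<lambda>p. b (snd p) * (cos (pi * fst p) * eigenfunction n (fst p))) \<in> sine_sums"
  proof (cases n)
    case 0
    then show ?thesis by (simp add: eigenfunction_def sine_sums.zero)
  next
    case (Suc m)
    have "(\<lambda>p. (b (snd p) / 2) * eigenfunction (Suc (Suc m)) (fst p) + (b (snd p) / 2) * eigenfunction m (fst p)) \<in> sine_sums"
      by (intro sine_sums_add sine_sums_mode b)
    then show ?thesis
      unfolding Suc cos_mult_eigenfunction by (simp add: algebra_simps)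
  qed
  from sine_sums_add[OF this add_mode.IH] show ?case by (simp add: algebra_simps)
qed (simp add: sine_sums.zero)

text \<open>Multiplication by \<open>t\<close> and by \<open>cos (\<pi> x)\<close> preserves sine sums, and these two functions
  separate points. So the multipliers of sine sums form a ring to which the Stone-Weierstrass
  theorem applies, and the sine itself carries the boundary values.\<close>

lemma sine_multiple_approximation:
  assumes G: "continuous_on UNIV G" and e: "e > 0"
  shows "\<exists>\<psi>\<in>sine_sums. L2_norm (Q T) (\<lambda>p. sin (pi * fst p) * G p - \<psi> p) < e"
proof -
  let ?S = "{0..1::real} \<times> {0..T}"
  define P where "P f \<longleftrightarrow> continuous_on ?S f \<and> (\<forall>v\<in>sine_sums. (\<lambda>p. f p * v p) \<in> sine_sums)"
    for f :: "real \<times> real \<Rightarrow> real"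
  have Pcos: "P (\<lambda>p. cos (pi * fst p))" and Psnd: "P snd"
    using sine_sums_mult_cos sine_sums_mult_time[of _ "\<lambda>t. t"]
    by (auto simp: P_def intro!: continuous_intros)
  \<comment> \<open>A uniform error \<open>d\<close> costs at most \<open>d\<close> times the norm of the constant one.\<close>
  define d where "d = e / (L2_norm (Q T) (\<lambda>p. 1) + 1)"
  have d: "d > 0" unfolding d_def using e by (intro divide_pos_pos add_nonneg_pos) auto
  have "\<exists>g. P g \<and> (\<forall>p\<in>?S. \<bar>G p - g p\<bar> < d)"
  proof (rule Stone_Weierstrass_HOL[where P = P])
    show "P (\<lambda>p. c)" for c
      using sine_sums_mult_time[of _ "\<lambda>t. c"] by (auto simp: P_def intro!: continuous_intros)
    show "P (\<lambda>x. f x + g x)" if "P f \<and> P g" for f g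
    proof -
      have "(\<lambda>p. f p * v p + g p * v p) \<in> sine_sums" if "v \<in> sine_sums" for v
        using that \<open>P f \<and> P g\<close> by (intro sine_sums_add) (auto simp: P_def)
      with that show ?thesis by (auto simp: P_def distrib_right intro: continuous_on_add)
    qed
    show "P (\<lambda>x. f x * g x)" if "P f \<and> P g" for f g
    proof -
      have "(\<lambda>p. f p * (g p * v p)) \<in> sine_sums" if "v \<in> sine_sums" for v
      proof -
        have "(\<lambda>p. g p * v p) \<in> sine_sums" using that \<open>P f \<and> P g\<close> by (simp add: P_def)
        moreover have "\<forall>v\<in>sine_sums. (\<lambda>p. f p * v p) \<in> sine_sums" using \<open>P f \<and> P g\<close> by (simp add: P_def)
        ultimately show ?thesis by (rule bspec[rotated])
      qed
      with that show ?thesis by (auto simp: P_def mult.assoc intro: continuous_on_mult)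
    qed
    show "\<exists>f. P f \<and> f x \<noteq> f y" if "x \<in> ?S \<and> y \<in> ?S \<and> x \<noteq> y" for x y
    proof (cases "fst x = fst y")
      case True
      with that have "snd x \<noteq> snd y" by (auto simp: prod_eq_iff)
      with Psnd show ?thesis by blast
    next
      case False
      have "cos (pi * fst x) \<noteq> cos (pi * fst y)"
      proof
        assume "cos (pi * fst x) = cos (pi * fst y)"
        moreover have "pi * fst x \<in> {0..pi}" "pi * fst y \<in> {0..pi}"
          using that by (auto simp: mem_Times_iff mult_left_le)
        ultimately have "pi * fst x = pi * fst y"
          using cos_inj_pi[of "pi * fst x" "pi * fst y"] by simp
        with False show False by simp
      qed
      with Pcos show ?thesis by (intro exI[of _ "\<lambda>p. cos (pi * fst p)"]) simp
    qed
    show "continuous_on ?S G" using G continuous_on_subset by blast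
  qed (auto simp: P_def d intro: compact_Times)
  then obtain g where g: "P g" "\<And>p. p \<in> ?S \<Longrightarrow> \<bar>G p - g p\<bar> < d" by blast
  define \<psi> where "\<psi> p = g p * sin (pi * fst p)" for p
  have "(\<lambda>p. g p * (1 / sqrt 2 * eigenfunction 1 (fst p))) \<in> sine_sums"
    using g(1) sine_sums_mode[of "\<lambda>t. 1 / sqrt 2" 1] by (auto simp: P_def)
  then have \<psi>: "\<psi> \<in> sine_sums" by (simp add: eigenfunction_def \<psi>_def[abs_def])
  have L2: "(\<lambda>p. sin (pi * fst p) * G p - \<psi> p) \<in> L2 (Q T)"
    by (intro continuous_L2_Q continuous_intros G sine_sums_continuous \<psi>)
  have "(L2_norm (Q T) (\<lambda>p. sin (pi * fst p) * G p - \<psi> p))\<^sup>2 \<le> (L2_norm (Q T) (\<lambda>p. d * 1))\<^sup>2"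
    unfolding L2_norm_power2
  proof (rule integral_mono)
    fix p assume "p \<in> space (Q T)"
    then have "p \<in> ?S" by auto
    then have "\<bar>sin (pi * fst p)\<bar> * \<bar>G p - g p\<bar> \<le> 1 * d"
      using g(2)[of p] by (intro mult_mono) auto
    moreover have "sin (pi * fst p) * G p - \<psi> p = sin (pi * fst p) * (G p - g p)"
      by (simp add: \<psi>_def algebra_simps)
    ultimately have "\<bar>sin (pi * fst p) * G p - \<psi> p\<bar> \<le> \<bar>d * 1\<bar>"
      by (simp add: abs_mult)
    then show "(sin (pi * fst p) * G p - \<psi> p)\<^sup>2 \<le> (d * 1)\<^sup>2"
      by (simp only: abs_le_square_iff)
  qed (use L2 continuous_L2_Q[of "\<lambda>p. d * 1" T] in \<open>auto simp: L2_def\<close>)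
  then have "L2_norm (Q T) (\<lambda>p. sin (pi * fst p) * G p - \<psi> p) \<le> L2_norm (Q T) (\<lambda>p. d * 1)"
    by (rule power2_le_imp_le) simp
  also have "\<dots> = d * L2_norm (Q T) (\<lambda>p. 1)"
    using L2_norm_scale[of "Q T" d "\<lambda>p. 1"] d by simp
  also have "\<dots> < d * (L2_norm (Q T) (\<lambda>p. 1) + 1)" using d by simp
  also have "\<dots> = e"
    unfolding d_def by (simp add: add_nonneg_eq_0_iff)
  finally show ?thesis using \<psi> by blast
qed

lemma sine_sums_dense_limit:
  assumes u: "\<And>n. u n \<in> L2 (Q T)" "v \<in> L2 (Q T)"
    and lim: "(\<lambda>n. L2_norm (Q T) (\<lambda>p. u n p - v p)) \<longlonglongrightarrow> 0"
    and approx: "\<And>n e. e > 0 \<Longrightarrow> \<exists>\<psi>\<in>sine_sums. L2_norm (Q T) (\<lambda>p. u n p - \<psi> p) < e"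
    and e: "e > 0"
  shows "\<exists>\<psi>\<in>sine_sums. L2_norm (Q T) (\<lambda>p. v p - \<psi> p) < e"
proof -
  have "\<forall>\<^sub>F n in sequentially. L2_norm (Q T) (\<lambda>p. u n p - v p) < e / 2"
    using order_tendstoD(2)[OF lim, of "e / 2"] e by simp
  then obtain n where n: "L2_norm (Q T) (\<lambda>p. u n p - v p) < e / 2"
    by (auto simp: eventually_sequentially)
  obtain \<psi> where \<psi>: "\<psi> \<in> sine_sums" "L2_norm (Q T) (\<lambda>p. u n p - \<psi> p) < e / 2"
    using approx[of "e / 2" n] e by auto
  have "L2_norm (Q T) (\<lambda>p. v p - \<psi> p) \<le> L2_norm (Q T) (\<lambda>p. v p - u n p) + L2_norm (Q T) (\<lambda>p. u n p - \<psi> p)"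
    by (intro L2_norm_triangle_diff u sine_sums_L2 \<psi>)
  then show ?thesis
    using n \<psi> L2_norm_minus[of "Q T" v "u n"] by (intro bexI[of _ \<psi>]) auto
qed

text \<open>A continuous function need not vanish at the end points in \<open>x\<close>, but it is a limit in the mean of
  functions that carry a factor \<open>sin (\<pi> x)\<close>.\<close>

lemma sine_sums_dense_continuous:
  assumes g: "continuous_on UNIV g" and e: "e > 0"
  shows "\<exists>\<psi>\<in>sine_sums. L2_norm (Q T) (\<lambda>p. g p - \<psi> p) < e"
proof (rule sine_sums_dense_limit)
  \<comment> \<open>This factor tends to \<open>1\<close> inside the cylinder and is a multiple of the sine.\<close>
  define q where "q k p = sin (pi * fst p) / ((sin (pi * fst p))\<^sup>2 + 1 / real (Suc k))"
    for k and p :: "real \<times> real"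
  define u where "u k p = sin (pi * fst p) * (q k p * g p)" for k p
  have den: "(sin (pi * fst p))\<^sup>2 + 1 / real (Suc k) > 0" for k and p :: "real \<times> real"
    by (intro add_nonneg_pos) auto
  have q: "continuous_on UNIV (\<lambda>p. q k p * g p)" for k
    unfolding q_def using den[of _ k, THEN less_imp_neq, symmetric] by (intro continuous_intros g) auto
  have factor: "0 \<le> sin (pi * fst p) * q k p" "sin (pi * fst p) * q k p \<le> 1" for k and p :: "real \<times> real"
  proof -
    define s where "s = (sin (pi * fst p))\<^sup>2"
    have "sin (pi * fst p) * q k p = s / (s + 1 / real (Suc k))"
      by (simp add: q_def s_def power2_eq_square)
    moreover have "0 \<le> s" by (simp add: s_def)
    moreover have "s + 1 / real (Suc k) > 0" using den[of p k] by (simp add: s_def)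
    ultimately show "0 \<le> sin (pi * fst p) * q k p" "sin (pi * fst p) * q k p \<le> 1"
      by (simp_all add: divide_le_eq)
  qed
  show "u k \<in> L2 (Q T)" for k
    unfolding u_def by (intro continuous_L2_Q continuous_intros q)
  show "g \<in> L2 (Q T)" by (rule continuous_L2_Q[OF g])
  show "\<exists>\<psi>\<in>sine_sums. L2_norm (Q T) (\<lambda>p. u k p - \<psi> p) < e" if "e > 0" for k e
    unfolding u_def by (rule sine_multiple_approximation[OF q that])
  show "(\<lambda>k. L2_norm (Q T) (\<lambda>p. u k p - g p)) \<longlonglongrightarrow> 0"
  proof (rule L2_norm_dominated_convergence)
    show "(\<lambda>p. u k p - g p) \<in> borel_measurable (Q T)" for k
    proof -
      have "continuous_on UNIV (\<lambda>p. u k p - g p)"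
        unfolding u_def by (intro continuous_intros q g)
      from continuous_L2_Q[OF this, of T] show ?thesis by (simp add: L2_def)
    qed
    show "(\<lambda>p. \<bar>g p\<bar>) \<in> L2 (Q T)" by (intro continuous_L2_Q continuous_intros g)
    show "AE p in Q T. \<bar>u k p - g p\<bar> \<le> \<bar>g p\<bar>" for k
    proof (rule AE_I2)
      fix p
      have "u k p - g p = - ((1 - sin (pi * fst p) * q k p) * g p)"
        by (simp add: u_def algebra_simps)
      then show "\<bar>u k p - g p\<bar> \<le> \<bar>g p\<bar>"
        using factor[of p k] by (simp add: abs_mult mult_left_le_one_le)
    qed
    show "AE p in Q T. (\<lambda>k. u k p - g p) \<longlonglongrightarrow> 0"
    proof (rule AE_I2)
      fix p assume "p \<in> space (Q T)"
      then have "sin (pi * fst p) > 0" by (intro sin_gt_zero) auto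
      then have s: "(sin (pi * fst p))\<^sup>2 \<noteq> 0" by simp
      have "(\<lambda>k. (sin (pi * fst p))\<^sup>2 / ((sin (pi * fst p))\<^sup>2 + 1 / real (Suc k)) * g p - g p)
          \<longlonglongrightarrow> (sin (pi * fst p))\<^sup>2 / ((sin (pi * fst p))\<^sup>2 + 0) * g p - g p"
        using s by (intro tendsto_intros LIMSEQ_Suc[OF lim_1_over_n]) auto
      then show "(\<lambda>k. u k p - g p) \<longlonglongrightarrow> 0"
        using s by (simp add: u_def q_def power2_eq_square mult.assoc)
    qed
  qed
qed (rule e)

text \<open>Clipping reduces the claim to bounded functions, and these are bounded almost everywhere limits
  of continuous ones.\<close>

lemma sine_sums_dense:
  assumes u: "u \<in> L2 (Q T)" and e: "e > 0"
  shows "\<exists>\<psi>\<in>sine_sums. L2_norm (Q T) (\<lambda>p. u p - \<psi> p) < e"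
proof (rule sine_sums_dense_limit[OF _ u _ _ e])
  have um: "u \<in> borel_measurable (Q T)" using u by (simp add: L2_def)
  define c where "c n p = max (- real n) (min (real n) (u p))" for n p
  have cm: "c n \<in> borel_measurable (Q T)" for n
    unfolding c_def using um by measurable
  have cb: "\<bar>c n p\<bar> \<le> real n" for n p by (auto simp: c_def)
  show cL2: "c n \<in> L2 (Q T)" for n
    by (rule L2_bounded[OF Q_finite_measure cm cb])
  show "(\<lambda>n. L2_norm (Q T) (\<lambda>p. c n p - u p)) \<longlonglongrightarrow> 0"
  proof (rule L2_norm_dominated_convergence)
    show "(\<lambda>p. c n p - u p) \<in> borel_measurable (Q T)" for n using cm um by measurable
    show "(\<lambda>p. \<bar>u p\<bar>) \<in> L2 (Q T)" using u um by (simp add: L2_def borel_measurable_abs)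
    show "AE p in Q T. \<bar>c n p - u p\<bar> \<le> \<bar>u p\<bar>" for n
      by (rule AE_I2) (auto simp: c_def max_def min_def)
    show "AE p in Q T. (\<lambda>n. c n p - u p) \<longlonglongrightarrow> 0"
    proof (rule AE_I2)
      fix p
      have "\<forall>\<^sub>F n in sequentially. \<bar>u p\<bar> \<le> real n"
        by (rule eventually_compose_filterlim[OF eventually_ge_at_top filterlim_real_sequentially])
      then have "\<forall>\<^sub>F n in sequentially. c n p - u p = 0"
        by eventually_elim (auto simp: c_def)
      then show "(\<lambda>n. c n p - u p) \<longlonglongrightarrow> 0" by (rule tendsto_eventually)
    qed
  qed
  show "\<exists>\<psi>\<in>sine_sums. L2_norm (Q T) (\<lambda>p. c n p - \<psi> p) < e" if "e > 0" for n e
  proof -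
    obtain g :: "nat \<Rightarrow> real \<times> real \<Rightarrow> real" where g: "\<And>k. continuous_on UNIV (g k)" "\<And>k p. \<bar>g k p\<bar> \<le> real n"
      "AE p in Q T. (\<lambda>k. g k p) \<longlonglongrightarrow> c n p"
      by (rule bounded_measurable_limit_continuous[OF cm[of n] Q_sets, of "real n"]) (rule cb, simp, blast)
    show ?thesis
    proof (rule sine_sums_dense_limit[OF _ cL2 _ _ that])
      show "g k \<in> L2 (Q T)" for k by (rule continuous_L2_Q[OF g(1)])
      show "\<exists>\<psi>\<in>sine_sums. L2_norm (Q T) (\<lambda>p. g k p - \<psi> p) < e" if "e > 0" for k e
        by (rule sine_sums_dense_continuous[OF g(1) that])
      show "(\<lambda>k. L2_norm (Q T) (\<lambda>p. g k p - c n p)) \<longlonglongrightarrow> 0"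
      proof (rule L2_norm_dominated_convergence)
        show "(\<lambda>p. g k p - c n p) \<in> borel_measurable (Q T)" for k
          using cm continuous_L2_Q[OF g(1)[of k], of T] by (auto simp: L2_def)
        show "(\<lambda>p. 2 * real n) \<in> L2 (Q T)" by (intro continuous_L2_Q continuous_intros)
        show "AE p in Q T. \<bar>g k p - c n p\<bar> \<le> 2 * real n" for k
          using g(2)[of k] cb[of n] by (intro AE_I2) (smt (verit))
        show "AE p in Q T. (\<lambda>k. g k p - c n p) \<longlonglongrightarrow> 0"
          using g(3) by eventually_elim (simp add: LIM_zero)
      qed
    qed
  qed
qed

text \<open>Solving \<open>a' + l a = b - c exp (l t)\<close> with \<open>a(0) = 0\<close> leaves one degree of freedom, the
  multiple \<open>c\<close>, which is used to reach \<open>a(T) = 0\<close>.\<close>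

lemma exponential_decomposition:
  assumes "T > 0" "continuous_on UNIV b"
  obtains a a' :: "real \<Rightarrow> real" and c :: real
  where "\<And>t. (a has_real_derivative a' t) (at t)" "continuous_on UNIV a'" "a 0 = 0" "a T = 0"
    "\<And>t. b t = c * exp (l * t) + (a' t + l * a t)"
proof -
  have antiderivative: "\<exists>F. \<forall>t. (F has_real_derivative f t) (at t)" if "continuous_on UNIV f" for f :: "real \<Rightarrow> real"
    using einterval_antiderivative[of "-\<infinity>" "\<infinity>" f] that
    by (auto simp: continuous_on_eq_continuous_at has_real_derivative_iff_has_vector_derivative)
  obtain B where B: "\<And>t. (B has_real_derivative exp (l * t) * b t) (at t)"
  proof -
    have "continuous_on UNIV (\<lambda>t. exp (l * t) * b t)" by (intro continuous_intros assms(2))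
    from antiderivative[OF this] show thesis using that by blast
  qed
  obtain E where E: "\<And>t. (E has_real_derivative exp (l * t) * exp (l * t)) (at t)"
  proof -
    have "continuous_on UNIV (\<lambda>t. exp (l * t) * exp (l * t))" by (intro continuous_intros)
    from antiderivative[OF this] show thesis using that by blast
  qed
  have "E 0 < E T"
    by (rule DERIV_pos_imp_increasing[OF assms(1)]) (use E in \<open>auto intro!: exI\<close>)
  define c where "c = (B T - B 0) / (E T - E 0)"
  define a where "a t = exp (- l * t) * ((B t - B 0) - c * (E t - E 0))" for t
  define a' where "a' t = b t - c * exp (l * t) - l * a t" for t
  have a': "(a has_real_derivative a' t) (at t)" for t
  proof -
    have "(a has_real_derivative exp (- l * t) * (- l) * ((B t - B 0) - c * (E t - E 0))
        + exp (- l * t) * (exp (l * t) * b t - c * (exp (l * t) * exp (l * t)))) (at t)"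
      unfolding a_def by (auto intro!: derivative_eq_intros B E)
    moreover have "exp (- l * t) * (- l) * ((B t - B 0) - c * (E t - E 0))
        + exp (- l * t) * (exp (l * t) * b t - c * (exp (l * t) * exp (l * t))) = a' t"
    proof -
      have "exp (- l * t) * exp (l * t) = 1"
        by (simp flip: exp_add)
      moreover have "exp (- l * t) * (exp (l * t) * b t - c * (exp (l * t) * exp (l * t)))
          = (exp (- l * t) * exp (l * t)) * (b t - c * exp (l * t))"
        by (simp add: algebra_simps)
      ultimately have "exp (- l * t) * (exp (l * t) * b t - c * (exp (l * t) * exp (l * t))) = b t - c * exp (l * t)"
        by (simp only: mult_1)
      then show ?thesis by (simp add: a'_def a_def)
    qed
    ultimately show ?thesis by simp
  qed
  have "continuous_on UNIV a"
    using a' by (metis DERIV_continuous continuous_at_imp_continuous_on)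
  then have "continuous_on UNIV a'"
    unfolding a'_def by (intro continuous_intros assms(2))
  moreover have "a 0 = 0" by (simp add: a_def)
  moreover have "a T = 0" using \<open>E 0 < E T\<close> by (simp add: a_def c_def)
  moreover have "b t = c * exp (l * t) + (a' t + l * a t)" for t by (simp add: a'_def)
  ultimately show thesis using that a' by blast
qed

section \<open>Convergence of the penalized controls\<close>

text \<open>Adding a multiple of \<open>(a' + \<lambda>\<^sub>n a)(t) e\<^sub>n(x)\<close> with \<open>a(0) = a(T) = 0\<close> leaves the final state
  unchanged, so the norm of the sum is minimal when the multiple is zero.\<close>

lemma minimal_control_orthogonal:
  assumes T: "T > 0" and u: "u \<in> L2 (Q T)" and sol: "weak_solution T y0 u y"
    and min: "\<And>v z. v \<in> L2 (Q T) \<Longrightarrow> weak_solution T y0 v z \<Longrightarrow> z T = y T \<Longrightarrow> (L2_norm (Q T) u)\<^sup>2 \<le> (L2_norm (Q T) v)\<^sup>2"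
    and a: "\<And>t. (a has_real_derivative a' t) (at t)" "continuous_on UNIV a'" "a 0 = 0" "a T = 0"
  shows "(\<integral>p. u p * ((a' (snd p) + eigenvalue n * a (snd p)) * eigenfunction n (fst p)) \<partial>(Q T)) = 0"
proof -
  define h where "h p = (a' (snd p) + eigenvalue n * a (snd p)) * eigenfunction n (fst p)" for p
  have "continuous_on UNIV a"
    using a(1) by (metis DERIV_continuous continuous_at_imp_continuous_on)
  then have h: "h \<in> L2 (Q T)"
    unfolding h_def using a(2) by (intro continuous_L2_Q continuous_intros continuous_snd_compose)
  define b c where "b = (\<integral>p. u p * h p \<partial>(Q T))" and "c = (L2_norm (Q T) h)\<^sup>2"
  have quad: "0 \<le> 2 * s * b + s\<^sup>2 * c" for s
  proof -
    have "weak_solution T y0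
        (\<lambda>p. u p + (s * a' (snd p) + eigenvalue n * (s * a (snd p))) * eigenfunction n (fst p))
        (\<lambda>t x. y t x + s * a t * eigenfunction n x)"
      using a by (intro weak_solution_add_separated[OF T u sol]) (auto intro!: derivative_eq_intros continuous_intros)
    moreover have "(\<lambda>p. u p + (s * a' (snd p) + eigenvalue n * (s * a (snd p))) * eigenfunction n (fst p))
        = (\<lambda>p. u p + s * h p)"
      by (auto simp: h_def algebra_simps)
    ultimately have "weak_solution T y0 (\<lambda>p. u p + s * h p) (\<lambda>t x. y t x + s * a t * eigenfunction n x)"
      by simp
    then have "(L2_norm (Q T) u)\<^sup>2 \<le> (L2_norm (Q T) (\<lambda>p. u p + s * h p))\<^sup>2"
      by (rule min[OF L2_add[OF u L2_scale[OF h]]]) (simp add: a(4))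
    also have "\<dots> = (L2_norm (Q T) u)\<^sup>2 + 2 * s * b + s\<^sup>2 * c"
      by (subst L2_norm_add_power2[OF u L2_scale[OF h]])
        (simp add: b_def c_def L2_norm_scale power_mult_distrib mult.left_commute)
    finally show ?thesis by simp
  qed
  have "0 \<le> c" by (simp add: c_def)
  \<comment> \<open>The minimum of the parabola is at \<open>s = - b / c\<close>; using \<open>c + 1\<close> in place of \<open>c\<close> keeps the
    denominator positive and the value still negative unless \<open>b = 0\<close>.\<close>
  have "b = 0"
  proof -
    have "0 \<le> 2 * (- b / (c + 1)) * b + (- b / (c + 1))\<^sup>2 * c" by (rule quad)
    also have "\<dots> = b\<^sup>2 / (c + 1)\<^sup>2 * (- (c + 2))"
      using \<open>0 \<le> c\<close> by (simp add: power2_eq_square divide_simps) (simp add: algebra_simps)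
    finally have "b\<^sup>2 / (c + 1)\<^sup>2 * (c + 2) \<le> 0" unfolding mult_minus_right by linarith
    then show ?thesis
      using \<open>0 \<le> c\<close> by (simp add: mult_le_0_iff divide_le_0_iff power_le_zero_eq add_nonneg_eq_0_iff)
  qed
  then show ?thesis by (simp add: b_def h_def)
qed

theorem theorem3p4:
  fixes T :: real
    and y0 yT :: "real \<Rightarrow> real"
    and ustar :: "real \<times> real \<Rightarrow> real"
    and u :: "real \<Rightarrow> real \<times> real \<Rightarrow> real"
    and y :: "real \<Rightarrow> real \<Rightarrow> real \<Rightarrow> real"
  assumes "T > 0"
    and "y0 \<in> L2 \<Omega>"
    and "yT \<in> admissible_targets T y0"
    and "hard_optimal T y0 yT ustar"
    and "\<And>\<alpha>. \<alpha> > 0 \<Longrightarrow> penalized_optimal T y0 yT \<alpha> (u \<alpha>) (y \<alpha>)"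
  shows "((\<lambda>\<alpha>. L2_norm (Q T) (\<lambda>p. u \<alpha> p - ustar p)) \<longlongrightarrow> 0) at_top \<and>
         ((\<lambda>\<alpha>. L2_norm \<Omega> (\<lambda>x. y \<alpha> T x - yT x)) \<longlongrightarrow> 0) at_top"
proof -
  obtain ystar where us: "ustar \<in> L2 (Q T)" and ys: "weak_solution T y0 ustar ystar"
    and ysT: "AE x in \<Omega>. ystar T x = yT x"
    using assms(4) by (auto simp: hard_optimal_def hard_feasible_def)
  have yT: "yT \<in> L2 \<Omega>" using assms(3) by (simp add: admissible_targets_def)
  have final_L2: "z T \<in> L2 \<Omega>" if "weak_solution T y0 v z" for v z
    using that assms(1) by (auto simp: weak_solution_def continuous_into_L2_def)
  have uL2: "u \<alpha> \<in> L2 (Q T)" and ysol: "weak_solution T y0 (u \<alpha>) (y \<alpha>)" if "\<alpha> > 0" for \<alpha>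
    using assms(5)[OF that] by (auto simp: penalized_optimal_def)
  define R where "R \<alpha> = L2_norm \<Omega> (\<lambda>x. y \<alpha> T x - yT x)" for \<alpha>
  define N where "N = L2_norm (Q T) ustar"
  have N: "0 \<le> N" by (simp add: N_def)
  have resid_star: "L2_norm \<Omega> (\<lambda>x. ystar T x - yT x) = 0"
  proof -
    have "L2_norm \<Omega> (\<lambda>x. ystar T x - yT x) = L2_norm \<Omega> (\<lambda>x. 0)"
      using ysT final_L2[OF ys] yT by (intro L2_norm_cong_AE) (auto simp: L2_def)
    then show ?thesis by (simp add: L2_norm_def)
  qed
  \<comment> \<open>The hard optimum competes in the penalized problem with zero terminal error.\<close>
  have energy: "(L2_norm (Q T) (u \<alpha>))\<^sup>2 + \<alpha> * (R \<alpha>)\<^sup>2 \<le> N\<^sup>2" if "\<alpha> > 0" for \<alpha>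
  proof -
    have "penalized_cost T yT \<alpha> (u \<alpha>) (y \<alpha>) \<le> penalized_cost T yT \<alpha> ustar ystar"
      using assms(5)[OF that] us ys by (simp add: penalized_optimal_def)
    then show ?thesis
      by (simp add: penalized_cost_def resid_star R_def N_def)
  qed
  have bound: "L2_norm (Q T) (u \<alpha>) \<le> N" if "\<alpha> > 0" for \<alpha>
  proof (rule power2_le_imp_le[OF _ N])
    have "0 \<le> \<alpha> * (R \<alpha>)\<^sup>2" using that by simp
    with energy[OF that] show "(L2_norm (Q T) (u \<alpha>))\<^sup>2 \<le> N\<^sup>2" by linarith
  qed
  have R0: "(R \<longlongrightarrow> 0) at_top"
  proof (rule tendsto_sandwich[OF _ _ tendsto_const])
    show "\<forall>\<^sub>F \<alpha> in at_top. 0 \<le> R \<alpha>" by (simp add: R_def)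
    show "\<forall>\<^sub>F \<alpha> in at_top. R \<alpha> \<le> sqrt (N\<^sup>2 / \<alpha>)"
      using eventually_gt_at_top[of 0]
    proof eventually_elim
      case (elim \<alpha>)
      have "\<alpha> * (R \<alpha>)\<^sup>2 \<le> N\<^sup>2"
        using energy[OF elim] zero_le_power2[of "L2_norm (Q T) (u \<alpha>)"] by linarith
      then show ?case using elim by (intro real_le_rsqrt) (simp add: field_simps)
    qed
    have "((\<lambda>\<alpha>. N\<^sup>2 / \<alpha>) \<longlongrightarrow> 0) at_top"
      by (rule tendsto_divide_0[OF tendsto_const filterlim_at_top_imp_at_infinity[OF filterlim_ident]])
    then show "((\<lambda>\<alpha>. sqrt (N\<^sup>2 / \<alpha>)) \<longlongrightarrow> 0) at_top"
      using tendsto_real_sqrt by fastforce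
  qed
  define v where "v \<alpha> p = ustar p - u \<alpha> p" for \<alpha> p
  have vL2: "v \<alpha> \<in> L2 (Q T)" if "\<alpha> > 0" for \<alpha>
    unfolding v_def by (intro L2_diff us uL2 that)
  have v_bound: "L2_norm (Q T) (v \<alpha>) \<le> 2 * N" if "\<alpha> > 0" for \<alpha>
    using L2_norm_triangle[OF us L2_scale[OF uL2[OF that], of "-1"]] bound[OF that]
      L2_norm_scale[of "Q T" "-1" "u \<alpha>"]
    by (simp add: v_def[abs_def] N_def)
  \<comment> \<open>Both optima have minimal norm among the controls with the same final state.\<close>
  have orth: "(\<integral>p. v \<alpha> p * ((a' (snd p) + eigenvalue n * a (snd p)) * eigenfunction n (fst p)) \<partial>(Q T)) = 0"
    if "\<alpha> > 0" and a: "\<And>t. (a has_real_derivative a' t) (at t)" "continuous_on UNIV a'" "a 0 = 0" "a T = 0"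
    for \<alpha> n and a a' :: "real \<Rightarrow> real"
  proof -
    let ?h = "\<lambda>p. (a' (snd p) + eigenvalue n * a (snd p)) * eigenfunction n (fst p)"
    have "continuous_on UNIV a"
      using a(1) by (metis DERIV_continuous continuous_at_imp_continuous_on)
    then have h: "?h \<in> L2 (Q T)"
      using a(2) by (intro continuous_L2_Q continuous_intros continuous_snd_compose)
    have "(\<integral>p. ustar p * ?h p \<partial>(Q T)) = 0"
    proof (rule minimal_control_orthogonal[OF assms(1) us ys _ a])
      fix w z assume "w \<in> L2 (Q T)" "weak_solution T y0 w z" "z T = ystar T"
      then have "hard_feasible T y0 yT w" using ysT by (auto simp: hard_feasible_def)
      then show "(L2_norm (Q T) ustar)\<^sup>2 \<le> (L2_norm (Q T) w)\<^sup>2"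
        using assms(4) by (auto simp: hard_optimal_def hard_cost_def)
    qed
    moreover have "(\<integral>p. u \<alpha> p * ?h p \<partial>(Q T)) = 0"
    proof (rule minimal_control_orthogonal[OF assms(1) uL2[OF that(1)] ysol[OF that(1)] _ a])
      fix w z assume "w \<in> L2 (Q T)" "weak_solution T y0 w z" "z T = y \<alpha> T"
      then have "penalized_cost T yT \<alpha> (u \<alpha>) (y \<alpha>) \<le> penalized_cost T yT \<alpha> w z"
        using assms(5)[OF that(1)] by (simp add: penalized_optimal_def)
      then show "(L2_norm (Q T) (u \<alpha>))\<^sup>2 \<le> (L2_norm (Q T) w)\<^sup>2"
        using \<open>z T = y \<alpha> T\<close> by (simp add: penalized_cost_def)
    qed
    ultimately show ?thesis
      using L2_integrable_mult[OF us h] L2_integrable_mult[OF uL2[OF that(1)] h]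
      by (simp add: v_def left_diff_distrib)
  qed
  \<comment> \<open>The pairing is a sine coefficient of the terminal error, which tends to zero.\<close>
  have exp_mode: "((\<lambda>\<alpha>. \<integral>p. v \<alpha> p * (exp (eigenvalue n * snd p) * eigenfunction n (fst p)) \<partial>(Q T)) \<longlongrightarrow> 0) at_top"
    for n
  proof (rule tendsto_rabs_zero_cancel, rule tendsto_sandwich[OF _ _ tendsto_const])
    let ?g = "\<lambda>p. exp (eigenvalue n * snd p) * eigenfunction n (fst p)"
    have g: "?g \<in> L2 (Q T)" by (intro continuous_L2_Q continuous_intros)
    show "\<forall>\<^sub>F \<alpha> in at_top. \<bar>\<integral>p. v \<alpha> p * ?g p \<partial>(Q T)\<bar>
        \<le> exp (eigenvalue n * T) * (R \<alpha> * L2_norm \<Omega> (eigenfunction n))"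
      using eventually_gt_at_top[of 0]
    proof eventually_elim
      case (elim \<alpha>)
      note L2 = final_L2[OF ys] final_L2[OF ysol[OF elim]] eigenfunction_L2[of n]
      have "(\<integral>p. v \<alpha> p * ?g p \<partial>(Q T)) = (\<integral>p. ustar p * ?g p \<partial>(Q T)) - (\<integral>p. u \<alpha> p * ?g p \<partial>(Q T))"
        using L2_integrable_mult[OF us g] L2_integrable_mult[OF uL2[OF elim] g]
        by (simp add: v_def left_diff_distrib)
      also have "\<dots> = exp (eigenvalue n * T) * (coefficient (ystar T) n - coefficient (y \<alpha> T) n)"
        using weak_solution_coefficient[OF assms(1) us assms(2) ys, of n]
          weak_solution_coefficient[OF assms(1) uL2[OF elim] assms(2) ysol[OF elim], of n]
        by (simp add: right_diff_distrib)
      also have "coefficient (ystar T) n - coefficient (y \<alpha> T) n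
          = (\<integral>x. (ystar T x - y \<alpha> T x) * eigenfunction n x \<partial>\<Omega>)"
        using L2 by (simp add: coefficient_def left_diff_distrib L2_integrable_mult)
      finally have eq: "\<bar>\<integral>p. v \<alpha> p * ?g p \<partial>(Q T)\<bar>
          = exp (eigenvalue n * T) * \<bar>\<integral>x. (ystar T x - y \<alpha> T x) * eigenfunction n x \<partial>\<Omega>\<bar>"
        by (simp add: abs_mult)
      have "\<bar>\<integral>x. (ystar T x - y \<alpha> T x) * eigenfunction n x \<partial>\<Omega>\<bar>
          \<le> L2_norm \<Omega> (\<lambda>x. ystar T x - y \<alpha> T x) * L2_norm \<Omega> (eigenfunction n)"
        by (intro L2_Cauchy_Schwarz L2_diff L2)
      also have "L2_norm \<Omega> (\<lambda>x. ystar T x - y \<alpha> T x)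
          \<le> L2_norm \<Omega> (\<lambda>x. ystar T x - yT x) + L2_norm \<Omega> (\<lambda>x. yT x - y \<alpha> T x)"
        by (intro L2_norm_triangle_diff L2 yT)
      also have "\<dots> = R \<alpha>"
        using L2_norm_minus[of \<Omega> yT "y \<alpha> T"] by (simp add: resid_star R_def)
      finally show ?case unfolding eq by (simp add: mult_right_mono)
    qed
    show "((\<lambda>\<alpha>. exp (eigenvalue n * T) * (R \<alpha> * L2_norm \<Omega> (eigenfunction n))) \<longlongrightarrow> 0) at_top"
      using R0 by (intro tendsto_mult_right_zero tendsto_mult_left_zero)
  qed simp
  have sums: "((\<lambda>\<alpha>. \<integral>p. v \<alpha> p * \<psi> p \<partial>(Q T)) \<longlongrightarrow> 0) at_top" if "\<psi> \<in> sine_sums" for \<psi>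
    using that
  proof (induction rule: sine_sums.induct)
    case (add_mode f b n)
    obtain a a' c where a: "\<And>t. (a has_real_derivative a' t) (at t)" "continuous_on UNIV a'" "a 0 = 0" "a T = 0"
      and b: "\<And>t. b t = c * exp (eigenvalue n * t) + (a' t + eigenvalue n * a t)"
      using exponential_decomposition[OF assms(1) add_mode.hyps(2), of "eigenvalue n"] by metis
    let ?g = "\<lambda>p. exp (eigenvalue n * snd p) * eigenfunction n (fst p)"
    let ?h = "\<lambda>p. (a' (snd p) + eigenvalue n * a (snd p)) * eigenfunction n (fst p)"
    have "continuous_on UNIV a"
      using a(1) by (metis DERIV_continuous continuous_at_imp_continuous_on)
    then have h: "?h \<in> L2 (Q T)"
      using a(2) by (intro continuous_L2_Q continuous_intros continuous_snd_compose)
    have g: "?g \<in> L2 (Q T)" by (intro continuous_L2_Q continuous_intros)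
    have "((\<lambda>\<alpha>. (\<integral>p. v \<alpha> p * f p \<partial>(Q T)) + c * (\<integral>p. v \<alpha> p * ?g p \<partial>(Q T))) \<longlongrightarrow> 0 + c * 0) at_top"
      by (intro tendsto_add tendsto_mult_left add_mode.IH exp_mode)
    then have "((\<lambda>\<alpha>. \<integral>p. v \<alpha> p * (f p + b (snd p) * eigenfunction n (fst p)) \<partial>(Q T)) \<longlongrightarrow> 0 + c * 0) at_top"
    proof (rule Lim_transform_eventually)
      show "\<forall>\<^sub>F \<alpha> in at_top. (\<integral>p. v \<alpha> p * f p \<partial>(Q T)) + c * (\<integral>p. v \<alpha> p * ?g p \<partial>(Q T))
          = (\<integral>p. v \<alpha> p * (f p + b (snd p) * eigenfunction n (fst p)) \<partial>(Q T))"
        using eventually_gt_at_top[of 0]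
      proof eventually_elim
        case (elim \<alpha>)
        note int = L2_integrable_mult[OF vL2[OF elim]]
        note ints = int[OF sine_sums_L2[OF add_mode.hyps(1)]] int[OF g] int[OF h]
        have "(\<integral>p. v \<alpha> p * (f p + b (snd p) * eigenfunction n (fst p)) \<partial>(Q T))
            = (\<integral>p. (v \<alpha> p * f p + c * (v \<alpha> p * ?g p)) + v \<alpha> p * ?h p \<partial>(Q T))"
          by (simp add: b algebra_simps)
        also have "\<dots> = (\<integral>p. v \<alpha> p * f p \<partial>(Q T)) + c * (\<integral>p. v \<alpha> p * ?g p \<partial>(Q T))
            + (\<integral>p. v \<alpha> p * ?h p \<partial>(Q T))"
          using ints by (subst Bochner_Integration.integral_add, simp, simp)+ simp
        also have "(\<integral>p. v \<alpha> p * ?h p \<partial>(Q T)) = 0"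
          by (rule orth[OF elim a])
        finally show ?case by simp
      qed
    qed
    then show ?case by simp
  qed simp
  \<comment> \<open>Boundedness of \<open>v \<alpha>\<close> passes the limit from the dense set to \<open>ustar\<close>.\<close>
  have pairing: "((\<lambda>\<alpha>. \<integral>p. v \<alpha> p * ustar p \<partial>(Q T)) \<longlongrightarrow> 0) at_top"
  proof (rule tendstoI)
    fix e :: real assume e: "e > 0"
    define d where "d = e / (2 * (2 * N + 1))"
    have d: "d > 0" unfolding d_def using e N by (intro divide_pos_pos) auto
    obtain \<psi> where \<psi>: "\<psi> \<in> sine_sums" "L2_norm (Q T) (\<lambda>p. ustar p - \<psi> p) < d"
      using sine_sums_dense[OF us d] by blast
    have "\<forall>\<^sub>F \<alpha> in at_top. \<bar>\<integral>p. v \<alpha> p * \<psi> p \<partial>(Q T)\<bar> < e / 2"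
      using tendstoD[OF sums[OF \<psi>(1)], of "e / 2"] e by simp
    then show "\<forall>\<^sub>F \<alpha> in at_top. dist (\<integral>p. v \<alpha> p * ustar p \<partial>(Q T)) 0 < e"
      using eventually_gt_at_top[of 0]
    proof eventually_elim
      case (elim \<alpha>)
      note v = vL2[OF elim(2)] and L2 = sine_sums_L2[OF \<psi>(1)]
      have "(\<integral>p. v \<alpha> p * ustar p \<partial>(Q T)) = (\<integral>p. v \<alpha> p * (ustar p - \<psi> p) \<partial>(Q T)) + (\<integral>p. v \<alpha> p * \<psi> p \<partial>(Q T))"
        using L2_integrable_mult[OF v us] L2_integrable_mult[OF v L2]
        by (simp add: right_diff_distrib)
      moreover have "\<bar>\<integral>p. v \<alpha> p * (ustar p - \<psi> p) \<partial>(Q T)\<bar> \<le> (2 * N) * d"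
      proof -
        have "\<bar>\<integral>p. v \<alpha> p * (ustar p - \<psi> p) \<partial>(Q T)\<bar> \<le> L2_norm (Q T) (v \<alpha>) * L2_norm (Q T) (\<lambda>p. ustar p - \<psi> p)"
          by (intro L2_Cauchy_Schwarz v L2_diff us L2)
        also have "\<dots> \<le> (2 * N) * d"
          using v_bound[OF elim(2)] \<psi>(2) N by (intro mult_mono) auto
        finally show ?thesis .
      qed
      moreover have "(2 * N) * d \<le> e / 2"
      proof -
        have "(2 * N) * d \<le> (2 * N + 1) * d" using d by (intro mult_right_mono) auto
        also have "\<dots> = e / 2" unfolding d_def using N by (simp add: divide_simps)
        finally show ?thesis .
      qed
      ultimately show ?case using elim(1) by simp
    qed
  qed
  \<comment> \<open>Expanding the square of \<open>u \<alpha> = ustar - v \<alpha>\<close> and inserting \<open>bound\<close> leaves the pairing.\<close>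
  have "((\<lambda>\<alpha>. L2_norm (Q T) (\<lambda>p. u \<alpha> p - ustar p)) \<longlongrightarrow> 0) at_top"
  proof (rule tendsto_sandwich[OF _ _ tendsto_const])
    have "((\<lambda>\<alpha>. 2 * (\<integral>p. v \<alpha> p * ustar p \<partial>(Q T))) \<longlongrightarrow> 2 * 0) at_top"
      by (intro tendsto_mult_left pairing)
    from tendsto_real_sqrt[OF this]
    show "((\<lambda>\<alpha>. sqrt (2 * (\<integral>p. v \<alpha> p * ustar p \<partial>(Q T)))) \<longlongrightarrow> 0) at_top" by simp
    show "\<forall>\<^sub>F \<alpha> in at_top. L2_norm (Q T) (\<lambda>p. u \<alpha> p - ustar p) \<le> sqrt (2 * (\<integral>p. v \<alpha> p * ustar p \<partial>(Q T)))"
      using eventually_gt_at_top[of 0]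
    proof eventually_elim
      case (elim \<alpha>)
      have "(L2_norm (Q T) (\<lambda>p. ustar p + (-1) * v \<alpha> p))\<^sup>2
          = N\<^sup>2 + 2 * (\<integral>p. ustar p * ((-1) * v \<alpha> p) \<partial>(Q T)) + (L2_norm (Q T) (\<lambda>p. (-1) * v \<alpha> p))\<^sup>2"
        unfolding N_def by (rule L2_norm_add_power2[OF us L2_scale[OF vL2[OF elim]]])
      moreover have "(\<integral>p. ustar p * ((-1) * v \<alpha> p) \<partial>(Q T)) = - (\<integral>p. v \<alpha> p * ustar p \<partial>(Q T))"
        by (simp add: mult.commute)
      moreover have "L2_norm (Q T) (\<lambda>p. (-1) * v \<alpha> p) = L2_norm (Q T) (v \<alpha>)"
        unfolding L2_norm_scale by simp
      moreover have "(\<lambda>p. ustar p + (-1) * v \<alpha> p) = u \<alpha>" by (simp add: v_def)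
      moreover have "(L2_norm (Q T) (u \<alpha>))\<^sup>2 \<le> N\<^sup>2"
        using bound[OF elim] by (intro power_mono) auto
      ultimately have "(L2_norm (Q T) (v \<alpha>))\<^sup>2 \<le> 2 * (\<integral>p. v \<alpha> p * ustar p \<partial>(Q T))"
        by simp
      then show ?case
        using L2_norm_minus[of "Q T" "u \<alpha>" ustar] by (intro real_le_rsqrt) (simp add: v_def[abs_def])
    qed
  qed simp
  moreover have "((\<lambda>\<alpha>. L2_norm \<Omega> (\<lambda>x. y \<alpha> T x - yT x)) \<longlongrightarrow> 0) at_top"
    using R0 unfolding R_def .
  ultimately show ?thesis ..
qed

end
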